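(* Let $\Omega$ be a nonempty clopen subset of $\partial\overline{\mathcal G}$ with $\Omega\neq\partial\overline{\mathcal G}$. Then the set function $E\mapsto\Lambda_q(1_\Omega,E)$, defined for clopen sets $E$, extends (from the clopen subsets of $\Omega$) to a finite positive Borel measure on $\Omega$, and (from the clopen subsets of $\partial\overline{\mathcal G}$) to a signed Borel measure on $\partial\overline{\mathcal G}$.
   Context: A metric graph $\mathcal G$ is a locally finite graph with countable vertex set and edge set $\mathcal E$, without loops or multiple edges, in which each edge is identified with a real interval of finite positive length; Lebesgue measure on the intervals gives a measure on $\mathcal G$. The distance $d(p_1,p_2)$ is the infimum of lengths of paths joining $p_1$ and $p_2$; $\overline{\mathcal G}$ is the metric completion. $\partial\mathcal G$ is the set of vertices of degree one and $\partial\overline{\mathcal G}=\partial\mathcal G\cup(\overline{\mathcal G}\setminus\mathcal G)$. $\overline{\mathcal G}$ is weakly connected if for every pair of distinct points $x,y\in\overline{\mathcal G}$ there is a finite set of points $W\subset\mathcal G$ and disjoint open sets $U,V$ with $\overline{\mathcal G}\setminus W=U\cup V$, $x\in U$, $y\in V$. Clopen means both closed and open (here relative to $\partial\overline{\mathcal G}$). A function $u:\mathcal G\to\mathbb R$ is $q$-harmonic if on each edge $u'$ is absolutely continuous and $u''=qu$ a.e., and at each vertex $v$ of degree at least $2$, $u$ is continuous and $\sum_{e(i)\sim v}\partial_\nu u_i(v)=0$, where $u_i$ is the restriction of $u$ to the incident edge $e(i)$ and $\partial_\nu u_i(v)$ is the derivative at $v$ in the local coordinate identifying $e(i)$ with $[a,b]$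 so that $a$ corresponds to $v$. $\mathcal A$ is the algebra of functions $\phi:\overline{\mathcal G}\to\mathbb R$ which are continuous, infinitely differentiable on the open edges of $\mathcal G$, and for which $\phi'(x)=0$ for all $x$ in the complement of a finite set of edges and in a neighborhood of each vertex of $\mathcal G$. Standing assumptions: $\mathcal G$ is connected; $\overline{\mathcal G}$ is weakly connected and compact; $\partial\overline{\mathcal G}\ne\emptyset$; $q:\mathcal G\to\mathbb R$ is nonnegative, locally integrable, and integrable over $\mathcal G$; and there is a weight $\omega:\mathcal E\to(0,\infty)$ with $\sum_e\omega(e)<\infty$ and $\sum_e\int_e (q(x)/\omega(e))^2\omega(e)\,dx<\infty$. Under these assumptions every continuous $U:\partial\overline{\mathcal G}\to\mathbb R$ has a unique continuous extension $u:\overline{\mathcal G}\to\mathbb R$ that is $q$-harmonic on $\mathcal G$. Write $L\phi=-\phi''+q\phi$. For continuous $U:\partial\overline{\mathcal G}\to\mathbb R$ with $q$-harmonic extension $u$ and clopen $E\subset\partial\overline{\mathcal G}$, the Dirichlet-Neumann function is $$\Lambda_q(U,E)=\int_{\mathcal G}u\,L\phi,$$ where $\phi\in\mathcal A$ is any function with $\phi=1$ on $E$ and $\phi=0$ on $\partial\overline{\mathcal G}\setminus E$ (such $\phi$ exists and the value does not depend on its choice). $1_\Omega$ is the characteristic function of $\Omega$ on $\partial\overline{\mathcal G}$. *)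

theory Defs
  imports "HOL-Analysis.Analysis"
begin

section \<open>Metric graphs\<close>

text \<open>An edge is stored as the ordered pair of its end points; exactly one of the two orders
  occurs, and it fixes the identification of the edge with the interval from \<open>0\<close> to its length
  (\<open>0\<close> at the first end point).\<close>

type_synonym 'v edge = "'v \<times> 'v"

record 'v metric_graph =
  verts :: "'v set"
  edges :: "'v edge set"
  len :: "'v edge \<Rightarrow> real"

datatype 'v point = Vertex 'v | Inner "'v edge" real

definition incident :: "'v metric_graph \<Rightarrow> 'v \<Rightarrow> 'v edge set" where
  "incident G v = {e \<in> edges G. fst e = v \<or> snd e = v}"

definition degree :: "'v metric_graph \<Rightarrow> 'v \<Rightarrow> nat" where
  "degree G v = card (incident G v)"

definition is_metric_graph :: "'v metric_graph \<Rightarrow> bool" where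
  "is_metric_graph G \<longleftrightarrow>
     countable (verts G) \<and>
     edges G \<subseteq> verts G \<times> verts G \<and>
     (\<forall>v. (v, v) \<notin> edges G) \<and>
     (\<forall>v w. (v, w) \<in> edges G \<longrightarrow> (w, v) \<notin> edges G) \<and>
     (\<forall>v\<in>verts G. finite (incident G v)) \<and>
     (\<forall>e\<in>edges G. 0 < len G e)"

definition points :: "'v metric_graph \<Rightarrow> 'v point set" where
  "points G = Vertex ` verts G \<union> {Inner e t |e t. e \<in> edges G \<and> 0 < t \<and> t < len G e}"

text \<open>The point of the closed edge \<open>e\<close> with coordinate \<open>t\<close>, for \<open>t\<close> between \<open>0\<close> and \<open>len G e\<close>.\<close>

definition edge_point :: "'v metric_graph \<Rightarrow> 'v edge \<Rightarrow> real \<Rightarrow> 'v point" where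
  "edge_point G e t =
     (if t \<le> 0 then Vertex (fst e) else if len G e \<le> t then Vertex (snd e) else Inner e t)"

definition on_edge :: "'v metric_graph \<Rightarrow> ('v point \<Rightarrow> real) \<Rightarrow> 'v edge \<Rightarrow> real \<Rightarrow> real" where
  "on_edge G f e t = f (edge_point G e t)"

text \<open>\<open>path_length G x r y\<close>: some path made of finitely many intervals, each contained in a closed
  edge, joins \<open>x\<close> to \<open>y\<close> and has length \<open>r\<close>. The intervals may overlap, which does not affect
  the infimum of the lengths.\<close>

inductive path_length :: "'v metric_graph \<Rightarrow> 'v point \<Rightarrow> real \<Rightarrow> 'v point \<Rightarrow> bool"
  for G :: "'v metric_graph" where
  trivial: "x \<in> points G \<Longrightarrow> path_length G x 0 x"
| extend: "path_length G x r (edge_point G e s) \<Longrightarrow> e \<in> edges G \<Longrightarrow>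
     s \<in> {0..len G e} \<Longrightarrow> t \<in> {0..len G e} \<Longrightarrow>
     path_length G x (r + \<bar>t - s\<bar>) (edge_point G e t)"

definition graph_dist :: "'v metric_graph \<Rightarrow> 'v point \<Rightarrow> 'v point \<Rightarrow> real" where
  "graph_dist G x y = Inf {r. path_length G x r y}"

definition graph_connected :: "'v metric_graph \<Rightarrow> bool" where
  "graph_connected G \<longleftrightarrow> (\<forall>x\<in>points G. \<forall>y\<in>points G. \<exists>r. path_length G x r y)"

text \<open>Lebesgue measure on the graph; a point of an open edge is represented by the pair of the
  edge and the coordinate, and the (null) set of vertices is left out.\<close>

definition graph_measure :: "'v metric_graph \<Rightarrow> ('v edge \<times> real) measure" where
  "graph_measure G =
     restrict_space (count_space (edges G) \<Otimes>\<^sub>M lebesgue) (SIGMA e:edges G. {0<..<len G e})"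


section \<open>The metric completion and its boundary\<close>

text \<open>The complete metric space \<open>'p\<close> is the metric completion of the graph, via the dense
  isometric embedding \<open>\<iota>\<close>.\<close>

definition is_completion :: "'v metric_graph \<Rightarrow> ('v point \<Rightarrow> 'p::complete_space) \<Rightarrow> bool" where
  "is_completion G \<iota> \<longleftrightarrow>
     (\<forall>x\<in>points G. \<forall>y\<in>points G. dist (\<iota> x) (\<iota> y) = graph_dist G x y) \<and>
     closure (\<iota> ` points G) = UNIV"

definition weakly_connected :: "'v metric_graph \<Rightarrow> ('v point \<Rightarrow> 'p::complete_space) \<Rightarrow> bool" where
  "weakly_connected G \<iota> \<longleftrightarrow>
     (\<forall>x y. x \<noteq> y \<longrightarrow>
        (\<exists>W U V. finite W \<and> W \<subseteq> \<iota> ` points G \<and> open U \<and> open V \<and> U \<inter> V = {} \<and>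
           UNIV - W = U \<union> V \<and> x \<in> U \<and> y \<in> V))"

definition bdry :: "'v metric_graph \<Rightarrow> ('v point \<Rightarrow> 'p::complete_space) \<Rightarrow> 'p set" where
  "bdry G \<iota> = \<iota> ` Vertex ` {v \<in> verts G. degree G v = 1} \<union> (UNIV - \<iota> ` points G)"

definition clopen_in :: "'p::topological_space set \<Rightarrow> 'p set \<Rightarrow> bool" where
  "clopen_in S E \<longleftrightarrow> openin (top_of_set S) E \<and> closedin (top_of_set S) E"


section \<open>Harmonic functions\<close>

text \<open>Pairs in \<open>D\<close> are the end points of non-overlapping subintervals.\<close>

definition abs_continuous_on :: "(real \<Rightarrow> real) \<Rightarrow> real \<Rightarrow> real \<Rightarrow> bool" where
  "abs_continuous_on f a b \<longleftrightarrow>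
     (\<forall>\<epsilon>>0. \<exists>\<delta>>0. \<forall>D :: (real \<times> real) set.
        finite D \<longrightarrow> (\<forall>(x, y)\<in>D. a \<le> x \<and> x \<le> y \<and> y \<le> b) \<longrightarrow>
        pairwise (\<lambda>I J. {fst I<..<snd I} \<inter> {fst J<..<snd J} = {}) D \<longrightarrow>
        (\<Sum>(x, y)\<in>D. y - x) < \<delta> \<longrightarrow> (\<Sum>(x, y)\<in>D. \<bar>f y - f x\<bar>) < \<epsilon>)"

text \<open>The derivative of \<open>u\<close> on \<open>e\<close> at its end point \<open>v\<close>, pointing from \<open>v\<close> into the edge: at the
  second end point the local coordinate starting at \<open>v\<close> is \<open>len G e - t\<close>, hence the sign.\<close>

definition normal_deriv :: "'v metric_graph \<Rightarrow> ('v point \<Rightarrow> real) \<Rightarrow> 'v edge \<Rightarrow> 'v \<Rightarrow> real" where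
  "normal_deriv G u e v =
     (if v = fst e then vector_derivative (on_edge G u e) (at 0 within {0..len G e})
      else - vector_derivative (on_edge G u e) (at (len G e) within {0..len G e}))"

definition q_harmonic ::
  "'v metric_graph \<Rightarrow> ('v point \<Rightarrow> real) \<Rightarrow> ('v point \<Rightarrow> real) \<Rightarrow> bool" where
  "q_harmonic G q u \<longleftrightarrow>
     (\<forall>e\<in>edges G. \<exists>u'.
        (\<forall>t\<in>{0..len G e}. (on_edge G u e has_real_derivative u' t) (at t within {0..len G e})) \<and>
        abs_continuous_on u' 0 (len G e) \<and>
        (AE t in lebesgue_on {0..len G e}.
           (u' has_real_derivative on_edge G q e t * on_edge G u e t) (at t within {0..len G e}))) \<and>
     (\<forall>v\<in>verts G. 2 \<le> degree G v \<longrightarrow>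
        (\<forall>\<epsilon>>0. \<exists>\<delta>>0. \<forall>y\<in>points G. graph_dist G (Vertex v) y < \<delta> \<longrightarrow> \<bar>u y - u (Vertex v)\<bar> < \<epsilon>) \<and>
        (\<Sum>e\<in>incident G v. normal_deriv G u e v) = 0)"

definition is_harmonic_extension ::
  "'v metric_graph \<Rightarrow> ('v point \<Rightarrow> 'p::complete_space) \<Rightarrow> ('v point \<Rightarrow> real) \<Rightarrow>
   ('p \<Rightarrow> real) \<Rightarrow> ('p \<Rightarrow> real) \<Rightarrow> bool" where
  "is_harmonic_extension G \<iota> q U u \<longleftrightarrow>
     continuous_on UNIV u \<and> (\<forall>x\<in>bdry G \<iota>. u x = U x) \<and> q_harmonic G q (u \<circ> \<iota>)"

definition harmonic_extension ::
  "'v metric_graph \<Rightarrow> ('v point \<Rightarrow> 'p::complete_space) \<Rightarrow> ('v point \<Rightarrow> real) \<Rightarrow>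
   ('p \<Rightarrow> real) \<Rightarrow> ('p \<Rightarrow> real)" where
  "harmonic_extension G \<iota> q U = (THE u. is_harmonic_extension G \<iota> q U u)"

definition admissible_potential :: "'v metric_graph \<Rightarrow> ('v point \<Rightarrow> real) \<Rightarrow> bool" where
  "admissible_potential G q \<longleftrightarrow>
     (\<forall>x\<in>points G. 0 \<le> q x) \<and>
     (\<forall>e\<in>edges G. set_integrable lebesgue {0..len G e} (on_edge G q e)) \<and>
     integrable (graph_measure G) (\<lambda>(e, t). on_edge G q e t) \<and>
     (\<exists>\<omega> :: 'v edge \<Rightarrow> real. (\<forall>e\<in>edges G. 0 < \<omega> e) \<and> \<omega> summable_on edges G \<and>
        integrable (graph_measure G) (\<lambda>(e, t). (on_edge G q e t / \<omega> e)\<^sup>2 * \<omega> e))"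


section \<open>The test algebra and the Dirichlet-Neumann function\<close>

definition test_algebra ::
  "'v metric_graph \<Rightarrow> ('v point \<Rightarrow> 'p::complete_space) \<Rightarrow> ('p \<Rightarrow> real) set" where
  "test_algebra G \<iota> = {\<phi>.
     continuous_on UNIV \<phi> \<and>
     (\<forall>e\<in>edges G. \<forall>t\<in>{0<..<len G e}. \<forall>n.
        ((deriv ^^ n) (on_edge G (\<phi> \<circ> \<iota>) e)) differentiable (at t)) \<and>
     (\<exists>F. finite F \<and> F \<subseteq> edges G \<and>
        (\<forall>e\<in>edges G - F. \<forall>t\<in>{0<..<len G e}. deriv (on_edge G (\<phi> \<circ> \<iota>) e) t = 0)) \<and>
     (\<forall>v\<in>verts G. \<exists>N. open N \<and> \<iota> (Vertex v) \<in> N \<and>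
        (\<forall>e\<in>edges G. \<forall>t\<in>{0<..<len G e}.
           \<iota> (Inner e t) \<in> N \<longrightarrow> deriv (on_edge G (\<phi> \<circ> \<iota>) e) t = 0))}"

definition schroedinger ::
  "'v metric_graph \<Rightarrow> ('v point \<Rightarrow> 'p::complete_space) \<Rightarrow> ('v point \<Rightarrow> real) \<Rightarrow>
   ('p \<Rightarrow> real) \<Rightarrow> 'v edge \<Rightarrow> real \<Rightarrow> real" where
  "schroedinger G \<iota> q \<phi> e t =
     - (deriv ^^ 2) (on_edge G (\<phi> \<circ> \<iota>) e) t + on_edge G q e t * on_edge G (\<phi> \<circ> \<iota>) e t"

definition is_cutoff ::
  "'v metric_graph \<Rightarrow> ('v point \<Rightarrow> 'p::complete_space) \<Rightarrow> 'p set \<Rightarrow> ('p \<Rightarrow> real) \<Rightarrow> bool" where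
  "is_cutoff G \<iota> E \<phi> \<longleftrightarrow>
     \<phi> \<in> test_algebra G \<iota> \<and> (\<forall>x\<in>E. \<phi> x = 1) \<and> (\<forall>x\<in>bdry G \<iota> - E. \<phi> x = 0)"

definition dirichlet_neumann ::
  "'v metric_graph \<Rightarrow> ('v point \<Rightarrow> 'p::complete_space) \<Rightarrow> ('v point \<Rightarrow> real) \<Rightarrow>
   ('p \<Rightarrow> real) \<Rightarrow> 'p set \<Rightarrow> real" where
  "dirichlet_neumann G \<iota> q U E =
     (let u = harmonic_extension G \<iota> q U; \<phi> = (SOME \<phi>. is_cutoff G \<iota> E \<phi>) in
      \<integral>(e, t). on_edge G (u \<circ> \<iota>) e t * schroedinger G \<iota> q \<phi> e t \<partial>graph_measure G)"


section \<open>Signed measures\<close>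

definition signed_measure_on :: "'p measure \<Rightarrow> ('p set \<Rightarrow> real) \<Rightarrow> bool" where
  "signed_measure_on M \<nu> \<longleftrightarrow>
     \<nu> {} = 0 \<and>
     (\<forall>A :: nat \<Rightarrow> 'p set. range A \<subseteq> sets M \<longrightarrow> disjoint_family A \<longrightarrow>
        (\<lambda>i. \<nu> (A i)) sums \<nu> (\<Union>i. A i))"

end

theory Submission imports Defs begin

text \<open>On each edge the solutions of \<open>y'' = q y\<close> are spanned by the two that are \<open>0\<close> and \<open>1\<close> at the end
  points, so a harmonic function is determined by its vertex values \<open>f\<close>, and the Kirchhoff
  conditions say that \<open>f\<close> is a critical point of a discrete energy \<open>\<Sum>\<^sub>e c (f u - f v)\<^sup>2 + k0 (f u)\<^sup>2 + k1 (f v)\<^sup>2\<close>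
  with \<open>c > 0\<close> and \<open>k0, k1 \<ge> 0\<close>. The harmonic extension of \<open>1\<^sub>\<Omega>\<close> comes from minimizing this energy among
  finite energy functions that agree with a cutoff near the boundary. Green's formula turns
  \<open>\<Lambda>\<^sub>q(1\<^sub>\<Omega>, E)\<close> into the energy product of \<open>f\<close> with a cutoff \<open>\<Phi>\<close> of \<open>E\<close>; since \<open>f\<close> is orthogonal to the
  functions vanishing on the boundary, the choice of \<open>\<Phi>\<close> is immaterial and \<open>\<Lambda>\<^sub>q\<close> is additive in \<open>E\<close>.
  Comparing \<open>f\<close> with its truncation at \<open>1 - s \<Phi>\<close> or at \<open>s \<Phi>\<close> to first order in \<open>s\<close> shows \<open>\<Lambda>\<^sub>q \<ge> 0\<close> for
  \<open>E \<subseteq> \<Omega>\<close> and \<open>\<Lambda>\<^sub>q \<le> 0\<close> for \<open>E\<close> disjoint from \<open>\<Omega>\<close>. A nonnegative additive function of the clopen subsets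
  of a compact space with enough clopen sets extends to a Borel measure.\<close>

section \<open>Absolutely continuous functions\<close>

text \<open>There may be infinitely many edges, and the boundary may contain points that lie on no
  edge and carry no vertex. Vanishing on the boundary is therefore encoded on vertex functions:
  value \<open>0\<close> at the leaves, and modulus at least \<open>\<epsilon>\<close> at only
  finitely many vertices for each \<open>\<epsilon> > 0\<close>. Compactness of the completion gives
  this for the vertex values of every continuous function that is zero on the boundary.
  Integrability of \<open>q\<close> carries the passage from single edges to the graph in two ways.
  Since \<open>k0 + k1\<close> is at most the integral of \<open>q\<close> over the edge, a bounded
  function that is constant on all but finitely many edges has finite energy. Since the sum of the
  two basis solutions falls below \<open>1\<close> by at most length times that integral,
  interpolation by edge solutions stays close to the vertex values on all but finitely many edges,
  which yields continuity at the added points. Bounded distances let the energy control the vertex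
  values, and weak connectedness supplies both the cutoffs and enough clopen sets.\<close>

lemma abs_continuous_onE:
  assumes "abs_continuous_on f a b" "e > 0"
  obtains d where "d > 0" "\<And>D. finite D \<Longrightarrow> (\<forall>(x, y)\<in>D. a \<le> x \<and> x \<le> y \<and> y \<le> b) \<Longrightarrow>
        pairwise (\<lambda>I J. {fst I<..<snd I} \<inter> {fst J<..<snd J} = {}) D \<Longrightarrow>
        (\<Sum>(x, y)\<in>D. y - x) < d \<Longrightarrow> (\<Sum>(x, y)\<in>D. \<bar>f y - f x\<bar>) < e"
proof -
  from assms obtain d where "d > 0" "\<forall>D :: (real \<times> real) set.
        finite D \<longrightarrow> (\<forall>(x, y)\<in>D. a \<le> x \<and> x \<le> y \<and> y \<le> b) \<longrightarrow>
        pairwise (\<lambda>I J. {fst I<..<snd I} \<inter> {fst J<..<snd J} = {}) D \<longrightarrow>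
        (\<Sum>(x, y)\<in>D. y - x) < d \<longrightarrow> (\<Sum>(x, y)\<in>D. \<bar>f y - f x\<bar>) < e"
    unfolding abs_continuous_on_def by (elim allE[of _ e] impE exE conjE) simp_all
  then show thesis by (intro that[of d]) simp_all
qed

text \<open>The Lipschitz case and the algebraic closure properties are all instances: increments
  bounded by a multiple of those of \<open>f\<close> and \<open>g\<close> inherit their smallness on
  every finite family, so each case needs one pointwise estimate.\<close>

lemma abs_continuous_on_dominated:
  assumes f: "abs_continuous_on f a b" and g: "abs_continuous_on g a b" and M: "M > 0"
    and h: "\<And>x y. a \<le> x \<Longrightarrow> x \<le> y \<Longrightarrow> y \<le> b \<Longrightarrow>
      \<bar>h y - h x\<bar> \<le> M * (\<bar>f y - f x\<bar> + \<bar>g y - g x\<bar>)"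
  shows "abs_continuous_on h a b"
  unfolding abs_continuous_on_def
proof (intro allI impI)
  fix e :: real assume "e > 0"
  then have e': "e / (2 * M) > 0" using M by simp
  obtain d1 where d1: "d1 > 0" "\<And>D. finite D \<Longrightarrow> (\<forall>(x, y)\<in>D. a \<le> x \<and> x \<le> y \<and> y \<le> b) \<Longrightarrow>
        pairwise (\<lambda>I J. {fst I<..<snd I} \<inter> {fst J<..<snd J} = {}) D \<Longrightarrow>
        (\<Sum>(x, y)\<in>D. y - x) < d1 \<Longrightarrow> (\<Sum>(x, y)\<in>D. \<bar>f y - f x\<bar>) < e / (2 * M)"
    using abs_continuous_onE[OF f e'] by blast
  obtain d2 where d2: "d2 > 0" "\<And>D. finite D \<Longrightarrow> (\<forall>(x, y)\<in>D. a \<le> x \<and> x \<le> y \<and> y \<le> b) \<Longrightarrow>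
        pairwise (\<lambda>I J. {fst I<..<snd I} \<inter> {fst J<..<snd J} = {}) D \<Longrightarrow>
        (\<Sum>(x, y)\<in>D. y - x) < d2 \<Longrightarrow> (\<Sum>(x, y)\<in>D. \<bar>g y - g x\<bar>) < e / (2 * M)"
    using abs_continuous_onE[OF g e'] by blast
  show "\<exists>d>0. \<forall>D :: (real \<times> real) set. finite D \<longrightarrow> (\<forall>(x, y)\<in>D. a \<le> x \<and> x \<le> y \<and> y \<le> b) \<longrightarrow>
        pairwise (\<lambda>I J. {fst I<..<snd I} \<inter> {fst J<..<snd J} = {}) D \<longrightarrow>
        (\<Sum>(x, y)\<in>D. y - x) < d \<longrightarrow> (\<Sum>(x, y)\<in>D. \<bar>h y - h x\<bar>) < e"
  proof (intro exI[of _ "min d1 d2"] conjI allI impI)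
    show "min d1 d2 > 0" using d1 d2 by simp
    fix D :: "(real \<times> real) set"
    assume D: "finite D" "\<forall>(x, y)\<in>D. a \<le> x \<and> x \<le> y \<and> y \<le> b"
      "pairwise (\<lambda>I J. {fst I<..<snd I} \<inter> {fst J<..<snd J} = {}) D"
      "(\<Sum>(x, y)\<in>D. y - x) < min d1 d2"
    have "(\<Sum>(x, y)\<in>D. \<bar>h y - h x\<bar>) \<le> (\<Sum>(x, y)\<in>D. M * (\<bar>f y - f x\<bar> + \<bar>g y - g x\<bar>))"
      using D(2) h by (intro sum_mono) auto
    also have "\<dots> = M * ((\<Sum>(x, y)\<in>D. \<bar>f y - f x\<bar>) + (\<Sum>(x, y)\<in>D. \<bar>g y - g x\<bar>))"
      by (simp add: sum_distrib_left split_def flip: sum.distrib)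
    also have "\<dots> < M * (e / (2 * M) + e / (2 * M))"
      using D d1(2)[of D] d2(2)[of D] M by (intro mult_strict_left_mono add_strict_mono) auto
    also have "\<dots> = e" using M by (simp add: field_simps)
    finally show "(\<Sum>(x, y)\<in>D. \<bar>h y - h x\<bar>) < e" .
  qed
qed

lemma abs_continuous_on_id: "abs_continuous_on (\<lambda>x. x) a b"
proof -
  have "(\<Sum>(x, y)\<in>D. \<bar>y - x\<bar>) = (\<Sum>(x, y)\<in>D. y - x)"
    if "\<forall>(x, y)\<in>D. a \<le> x \<and> x \<le> y \<and> y \<le> b" for D :: "(real \<times> real) set"
    using that by (intro sum.cong) auto
  then show ?thesis
    unfolding abs_continuous_on_def by (auto intro!: exI)
qed

lemma abs_continuous_on_lipschitz:
  assumes "\<And>x y. a \<le> x \<Longrightarrow> x \<le> y \<Longrightarrow> y \<le> b \<Longrightarrow> \<bar>h y - h x\<bar> \<le> M * (y - x)"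
  shows "abs_continuous_on h a b"
proof (rule abs_continuous_on_dominated[OF abs_continuous_on_id abs_continuous_on_id])
  show "\<bar>M\<bar> + 1 > 0" by simp
  fix x y assume xy: "a \<le> x" "x \<le> y" "y \<le> b"
  have "M * (y - x) \<le> (\<bar>M\<bar> + 1) * (y - x)" using xy by (intro mult_right_mono) auto
  also have "\<dots> \<le> (\<bar>M\<bar> + 1) * (\<bar>y - x\<bar> + \<bar>y - x\<bar>)" using xy by (intro mult_left_mono) auto
  finally show "\<bar>h y - h x\<bar> \<le> (\<bar>M\<bar> + 1) * (\<bar>y - x\<bar> + \<bar>y - x\<bar>)"
    using assms[OF xy] by linarith
qed

lemma abs_continuous_on_add:
  assumes "abs_continuous_on f a b" "abs_continuous_on g a b"
  shows "abs_continuous_on (\<lambda>x. f x + g x) a b"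
  by (rule abs_continuous_on_dominated[OF assms, of 1]) auto

lemma abs_continuous_on_cmult:
  assumes "abs_continuous_on f a b"
  shows "abs_continuous_on (\<lambda>x. c * f x) a b"
proof (rule abs_continuous_on_dominated[OF assms assms])
  show "\<bar>c\<bar> + 1 > 0" by simp
  show "\<bar>c * f y - c * f x\<bar> \<le> (\<bar>c\<bar> + 1) * (\<bar>f y - f x\<bar> + \<bar>f y - f x\<bar>)" for x y
    unfolding right_diff_distrib[symmetric] abs_mult by (intro mult_mono) auto
qed

lemma abs_continuous_on_diff:
  assumes "abs_continuous_on f a b" "abs_continuous_on g a b"
  shows "abs_continuous_on (\<lambda>x. f x - g x) a b"
  by (rule abs_continuous_on_dominated[OF assms, of 1]) auto

lemma abs_continuous_on_imp_continuous_on: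
  assumes "abs_continuous_on f a b"
  shows "continuous_on {a..b} f"
  unfolding continuous_on_iff
proof (intro ballI allI impI)
  fix x e :: real assume x: "x \<in> {a..b}" and "e > 0"
  then obtain d where d: "d > 0" "\<And>D. finite D \<Longrightarrow> (\<forall>(x, y)\<in>D. a \<le> x \<and> x \<le> y \<and> y \<le> b) \<Longrightarrow>
        pairwise (\<lambda>I J. {fst I<..<snd I} \<inter> {fst J<..<snd J} = {}) D \<Longrightarrow>
        (\<Sum>(x, y)\<in>D. y - x) < d \<Longrightarrow> (\<Sum>(x, y)\<in>D. \<bar>f y - f x\<bar>) < e"
    using abs_continuous_onE[OF assms \<open>e > 0\<close>] by blast
  show "\<exists>d>0. \<forall>x'\<in>{a..b}. dist x' x < d \<longrightarrow> dist (f x') (f x) < e"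
  proof (intro exI[of _ d] conjI ballI impI d(1))
    fix y assume y: "y \<in> {a..b}" "dist y x < d"
    show "dist (f y) (f x) < e"
      using d(2)[of "{(x, y)}"] d(2)[of "{(y, x)}"] x y by (cases "x \<le> y") (auto simp: dist_real_def abs_minus_commute)
  qed
qed

lemma abs_continuous_on_mult:
  assumes f: "abs_continuous_on f a b" and g: "abs_continuous_on g a b"
  shows "abs_continuous_on (\<lambda>x. f x * g x) a b"
proof -
  have "bounded (f ` {a..b})" "bounded (g ` {a..b})"
    using f g abs_continuous_on_imp_continuous_on compact_continuous_image compact_imp_bounded compact_Icc
    by blast+
  then obtain A B where A: "\<And>x. x \<in> {a..b} \<Longrightarrow> \<bar>f x\<bar> \<le> A" and B: "\<And>x. x \<in> {a..b} \<Longrightarrow> \<bar>g x\<bar> \<le> B"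
    unfolding bounded_real by blast
  define M where "M = max 1 (max A B)"
  show ?thesis
  proof (rule abs_continuous_on_dominated[OF f g])
    show "M > 0" by (auto simp: M_def)
    fix x y assume xy: "a \<le> x" "x \<le> y" "y \<le> b"
    have "f y * g y - f x * g x = g y * (f y - f x) + f x * (g y - g x)" by algebra
    then have "\<bar>f y * g y - f x * g x\<bar> \<le> \<bar>g y\<bar> * \<bar>f y - f x\<bar> + \<bar>f x\<bar> * \<bar>g y - g x\<bar>"
      by (metis abs_mult abs_triangle_ineq)
    also have "\<dots> \<le> M * \<bar>f y - f x\<bar> + M * \<bar>g y - g x\<bar>"
      using A[of x] B[of y] xy by (intro add_mono mult_right_mono) (auto simp: M_def)
    finally show "\<bar>f y * g y - f x * g x\<bar> \<le> M * (\<bar>f y - f x\<bar> + \<bar>g y - g x\<bar>)"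
      by (simp add: algebra_simps)
  qed
qed

lemma abs_continuous_on_subset:
  assumes "abs_continuous_on f a b" "a \<le> c" "d \<le> b"
  shows "abs_continuous_on f c d"
  unfolding abs_continuous_on_def
proof (intro allI impI)
  fix e :: real assume "e > 0"
  then obtain d0 where d: "d0 > 0" "\<And>D. finite D \<Longrightarrow> (\<forall>(x, y)\<in>D. a \<le> x \<and> x \<le> y \<and> y \<le> b) \<Longrightarrow>
        pairwise (\<lambda>I J. {fst I<..<snd I} \<inter> {fst J<..<snd J} = {}) D \<Longrightarrow>
        (\<Sum>(x, y)\<in>D. y - x) < d0 \<Longrightarrow> (\<Sum>(x, y)\<in>D. \<bar>f y - f x\<bar>) < e"
    using abs_continuous_onE[OF assms(1) \<open>e > 0\<close>] by blast
  show "\<exists>d0>0. \<forall>D :: (real \<times> real) set. finite D \<longrightarrow> (\<forall>(x, y)\<in>D. c \<le> x \<and> x \<le> y \<and> y \<le> d) \<longrightarrow>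
        pairwise (\<lambda>I J. {fst I<..<snd I} \<inter> {fst J<..<snd J} = {}) D \<longrightarrow>
        (\<Sum>(x, y)\<in>D. y - x) < d0 \<longrightarrow> (\<Sum>(x, y)\<in>D. \<bar>f y - f x\<bar>) < e"
    using d assms(2,3) by (intro exI[of _ d0] conjI allI impI d) fastforce+
qed

text \<open>Cutting \<open>\<bar>f\<bar>\<close> off at a height \<open>n\<close> leaves a remainder
  of small integral over the whole interval; the bounded part contributes at most \<open>n\<close>
  times the total length of the family.\<close>

lemma abs_continuous_on_indefinite_integral:
  fixes f :: "real \<Rightarrow> real"
  assumes f: "f absolutely_integrable_on {a..b}"
  shows "abs_continuous_on (\<lambda>x. integral {a..x} f) a b"
  unfolding abs_continuous_on_def
proof (intro allI impI)
  fix e :: real assume "e > 0"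
  define g where "g n x = min \<bar>f x\<bar> (real n)" for n x
  have absf: "(\<lambda>x. \<bar>f x\<bar>) integrable_on {a..b}"
    using f absolutely_integrable_on_def by (auto simp: absolutely_integrable_on_def)
  have g_int: "g n absolutely_integrable_on {a..b}" for n
  proof -
    have "(\<lambda>x. min \<bar>f x\<bar> (real n)) absolutely_integrable_on {a..b}"
      using f by (intro absolutely_integrable_min_1 set_integrable_abs) auto
    then show ?thesis by (simp add: g_def[abs_def])
  qed
  then have g_int': "g n integrable_on {a..b}" for n
    using absolutely_integrable_on_def by blast
  have "(\<lambda>n. integral {a..b} (g n)) \<longlonglongrightarrow> integral {a..b} (\<lambda>x. \<bar>f x\<bar>)"
  proof (rule dominated_convergence(2)[OF g_int' absf])
    show "norm (g n x) \<le> \<bar>f x\<bar>" for n x by (auto simp: g_def)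
    fix x
    obtain N where N: "\<bar>f x\<bar> \<le> real N" using real_arch_simple by blast
    have "eventually (\<lambda>n. g n x = \<bar>f x\<bar>) sequentially"
      using eventually_ge_at_top[of N] by eventually_elim (use N in \<open>auto simp: g_def\<close>)
    then show "(\<lambda>n. g n x) \<longlonglongrightarrow> \<bar>f x\<bar>" by (rule tendsto_eventually)
  qed
  then obtain n where n: "\<bar>integral {a..b} (g n) - integral {a..b} (\<lambda>x. \<bar>f x\<bar>)\<bar> < e / 2"
    using \<open>e > 0\<close> half_gt_zero[OF \<open>e > 0\<close>] by (metis LIMSEQ_D order_refl real_norm_def)
  show "\<exists>d>0. \<forall>D :: (real \<times> real) set. finite D \<longrightarrow> (\<forall>(x, y)\<in>D. a \<le> x \<and> x \<le> y \<and> y \<le> b) \<longrightarrow>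
        pairwise (\<lambda>I J. {fst I<..<snd I} \<inter> {fst J<..<snd J} = {}) D \<longrightarrow>
        (\<Sum>(x, y)\<in>D. y - x) < d \<longrightarrow> (\<Sum>(x, y)\<in>D. \<bar>integral {a..y} f - integral {a..x} f\<bar>) < e"
  proof (intro exI[of _ "e / (2 * (real n + 1))"] conjI allI impI)
    show "e / (2 * (real n + 1)) > 0" using \<open>e > 0\<close> by simp
    fix D :: "(real \<times> real) set"
    assume D: "finite D" "\<forall>(x, y)\<in>D. a \<le> x \<and> x \<le> y \<and> y \<le> b"
      "pairwise (\<lambda>I J. {fst I<..<snd I} \<inter> {fst J<..<snd J} = {}) D"
      "(\<Sum>(x, y)\<in>D. y - x) < e / (2 * (real n + 1))"
    have DE: "a \<le> x \<and> x \<le> y \<and> y \<le> b" if "(x, y) \<in> D" for x y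
      using bspec[OF D(2) that] by simp
    define r where "r x = \<bar>f x\<bar> - g n x" for x
    have r0: "r x \<ge> 0" for x by (auto simp: r_def g_def)
    have r_int: "r integrable_on {a..b}"
      unfolding r_def[abs_def] using integrable_diff[OF absf g_int'[of n]] .
    have sub: "h integrable_on {x..y}" if "h integrable_on {a..b}" "(x, y) \<in> D" for h :: "real \<Rightarrow> real" and x y
      using DE[OF that(2)] by (intro integrable_on_subinterval[OF that(1)]) auto
    have one: "\<bar>integral {a..y} f - integral {a..x} f\<bar> \<le> integral {x<..<y} r + real n * (y - x)"
      if xy: "(x, y) \<in> D" for x y
    proof -
      have le: "a \<le> x" "x \<le> y" "y \<le> b" using DE[OF xy] by auto
      have fi: "f integrable_on {a..b}" using f absolutely_integrable_on_def by blast
      have "integral {a..y} f - integral {a..x} f = integral {x..y} f"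
        using Henstock_Kurzweil_Integration.integral_combine[of a x y f] le
          integrable_on_subinterval[OF fi, of a y] by auto
      also have "\<bar>\<dots>\<bar> \<le> integral {x..y} (\<lambda>x. \<bar>f x\<bar>)"
        using integral_norm_bound_integral[of f "{x..y}" "\<lambda>x. \<bar>f x\<bar>"] sub[OF fi xy] sub[OF absf xy] by auto
      also have "\<dots> = integral {x..y} r + integral {x..y} (g n)"
        using integral_add[OF sub[OF r_int xy] sub[OF g_int' xy], of n] by (simp add: r_def)
      also have "integral {x..y} (g n) \<le> integral {x..y} (\<lambda>_. real n)"
        by (intro integral_le sub[OF g_int' xy]) (auto simp: g_def)
      also have "\<dots> = real n * (y - x)" using le by simp
      finally show ?thesis by (simp add: integral_open_interval_real)
    qed
    have rD: "(\<lambda>t. indicat_real {x<..<y} t * r t) integrable_on {a..b}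
        \<and> integral {a..b} (\<lambda>t. indicat_real {x<..<y} t * r t) = integral {x<..<y} r" if "(x, y) \<in> D" for x y
    proof -
      have le: "a \<le> x" "x \<le> y" "y \<le> b" using DE[OF that] by auto
      then have sub': "{x<..<y} \<subseteq> {a..b}" by auto
      have eq: "(\<lambda>t. indicat_real {x<..<y} t * r t) = (\<lambda>t. if t \<in> {x<..<y} then r t else 0)"
        by (auto simp: indicator_def)
      have "r integrable_on {x<..<y}"
        using sub[OF r_int that] by (simp add: integrable_on_open_interval_real)
      then show ?thesis
        unfolding eq integrable_restrict_Int Henstock_Kurzweil_Integration.integral_restrict_Int
        using sub' by (simp add: Int_absorb2)
    qed
    have "(\<Sum>(x, y)\<in>D. integral {x<..<y} r) = (\<Sum>p\<in>D. integral {a..b} (\<lambda>t. indicat_real {fst p<..<snd p} t * r t))"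
      using rD by (intro sum.cong) auto
    also have "\<dots> = integral {a..b} (\<lambda>t. \<Sum>p\<in>D. indicat_real {fst p<..<snd p} t * r t)"
      using D(1) rD by (intro integral_sum[symmetric]) auto
    also have "\<dots> \<le> integral {a..b} r"
    proof (rule integral_le)
      show "(\<lambda>t. \<Sum>p\<in>D. indicat_real {fst p<..<snd p} t * r t) integrable_on {a..b}"
        using D(1) rD by (intro integrable_sum) auto
      show "r integrable_on {a..b}" by (rule r_int)
      fix t
      \<comment> \<open>The open intervals are pairwise disjoint, so at most one term is nonzero at
        \<open>t\<close>; closed intervals could share end points.\<close>
      show "(\<Sum>p\<in>D. indicat_real {fst p<..<snd p} t * r t) \<le> r t"
      proof (cases "\<exists>p\<in>D. t \<in> {fst p<..<snd p}")
        case True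
        then obtain p where p: "p \<in> D" "t \<in> {fst p<..<snd p}" by blast
        have "(\<Sum>p\<in>D. indicat_real {fst p<..<snd p} t * r t) = (\<Sum>p'\<in>{p}. indicat_real {fst p'<..<snd p'} t * r t)"
        proof (intro sum.mono_neutral_right ballI)
          fix p' assume "p' \<in> D - {p}"
          then have "{fst p<..<snd p} \<inter> {fst p'<..<snd p'} = {}"
            using D(3) p(1) unfolding pairwise_def by blast
          then show "indicat_real {fst p'<..<snd p'} t * r t = 0"
            using p(2) by (auto simp: indicator_def)
        qed (use D(1) p in auto)
        also have "\<dots> = indicat_real {fst p<..<snd p} t * r t" by (subst sum.insert) auto
        finally show ?thesis using p by simp
      next
        case False
        then have "(\<Sum>p\<in>D. indicat_real {fst p<..<snd p} t * r t) = 0"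
          by (intro sum.neutral) (auto simp: indicator_def)
        then show ?thesis using r0 by simp
      qed
    qed
    also have "\<dots> < e / 2"
      using n integral_diff[OF absf g_int'[of n]] unfolding r_def[abs_def] abs_less_iff by linarith
    finally have 1: "(\<Sum>(x, y)\<in>D. integral {x<..<y} r) < e / 2" .
    have "(\<Sum>(x, y)\<in>D. \<bar>integral {a..y} f - integral {a..x} f\<bar>) \<le> (\<Sum>(x, y)\<in>D. integral {x<..<y} r + real n * (y - x))"
      using one by (intro sum_mono) auto
    also have "\<dots> = (\<Sum>(x, y)\<in>D. integral {x<..<y} r) + real n * (\<Sum>(x, y)\<in>D. y - x)"
      by (simp add: sum.distrib split_def sum_distrib_left)
    also have "real n * (\<Sum>(x, y)\<in>D. y - x) \<le> real n * (e / (2 * (real n + 1)))"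
      using D(4) by (intro mult_left_mono) auto
    also have "\<dots> \<le> e / 2" using \<open>e > 0\<close> by (simp add: field_simps)
    finally show "(\<Sum>(x, y)\<in>D. \<bar>integral {a..y} f - integral {a..x} f\<bar>) < e" using 1 by linarith
  qed
qed

text \<open>Tags in the exceptional null set get intervals inside an open set of small measure, where
  absolute continuity controls the increments; at the other tags differentiability does.\<close>

lemma abs_continuous_on_has_integral:
  assumes "a \<le> b" and F: "abs_continuous_on F a b"
    and deriv: "AE t in lebesgue_on {a..b}. (F has_real_derivative f t) (at t within {a..b})"
  shows "(f has_integral (F b - F a)) {a..b}"
proof -
  define N where "N = {t \<in> {a..b}. \<not> (F has_real_derivative f t) (at t within {a..b})}"
  have N: "negligible N"
  proof -
    have "AE t in lebesgue. t \<in> {a..b} \<longrightarrow> (F has_real_derivative f t) (at t within {a..b})"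
      using deriv by (subst (asm) AE_restrict_space_iff) auto
    then obtain Z where Z: "Z \<in> null_sets lebesgue"
        "{t. \<not> (t \<in> {a..b} \<longrightarrow> (F has_real_derivative f t) (at t within {a..b}))} \<subseteq> Z"
      unfolding eventually_ae_filter by auto
    then show ?thesis
      unfolding negligible_iff_null_sets[symmetric] N_def by (rule_tac negligible_subset) auto
  qed
  \<comment> \<open>With the value \<open>0\<close> on \<open>N\<close> the Riemann sum does not see
    tags in \<open>N\<close>, and at these only the increments of \<open>F\<close> remain to be
    estimated.\<close>
  define f0 where "f0 t = (if t \<in> N then 0 else f t)" for t
  have "(f0 has_integral (F b - F a)) {a..b}"
    unfolding has_integral_real
  proof (intro allI impI)
    fix e :: real assume "e > 0"
    then obtain d where d: "d > 0" "\<And>D. finite D \<Longrightarrow> (\<forall>(x, y)\<in>D. a \<le> x \<and> x \<le> y \<and> y \<le> b) \<Longrightarrow>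
        pairwise (\<lambda>I J. {fst I<..<snd I} \<inter> {fst J<..<snd J} = {}) D \<Longrightarrow>
        (\<Sum>(x, y)\<in>D. y - x) < d \<Longrightarrow> (\<Sum>(x, y)\<in>D. \<bar>F y - F x\<bar>) < e / 2"
      using abs_continuous_onE[OF F half_gt_zero[OF \<open>e > 0\<close>]] by blast
    obtain O' where O': "open O'" "N \<subseteq> O'" "O' \<in> lmeasurable" "measure lebesgue O' < d"
    proof -
      have N': "N \<in> sets lebesgue" "N \<in> lmeasurable" using N by (auto simp: negligible_iff_null_sets null_setsD2 negligible_imp_measurable)
      obtain T where T: "open T" "N \<subseteq> T" "T - N \<in> lmeasurable" "emeasure lebesgue (T - N) < ennreal d"
        using sets_lebesgue_outer_open[OF N'(1) d(1)] by auto
      have "T = (T - N) \<union> N" using T by auto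
      then have "T \<in> lmeasurable" using T N' by (metis fmeasurable.Un)
      moreover have "measure lebesgue T = measure lebesgue (T - N)"
        using N T(1) by (simp add: measure_Diff_null_set negligible_iff_null_sets)
      moreover have "measure lebesgue (T - N) < d"
        using T(3,4) d(1) by (simp add: emeasure_eq_measure2 ennreal_less_iff)
      ultimately show thesis using T that by auto
    qed
    \<comment> \<open>The errors at good tags add up to at most \<open>\<eta> * (b - a)\<close>; the
      \<open>+ 1\<close> keeps \<open>\<eta>\<close> positive when \<open>a = b\<close>.\<close>
    define \<eta> where "\<eta> = e / (2 * (b - a + 1))"
    have \<eta>: "\<eta> > 0" using \<open>e > 0\<close> \<open>a \<le> b\<close> by (simp add: \<eta>_def)
    have "\<exists>\<rho>>0. (x \<in> N \<longrightarrow> ball x \<rho> \<subseteq> O') \<and>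
       (x \<in> {a..b} - N \<longrightarrow> (\<forall>y\<in>{a..b}. \<bar>y - x\<bar> < \<rho> \<longrightarrow> \<bar>F y - F x - f x * (y - x)\<bar> \<le> \<eta> * \<bar>y - x\<bar>))" for x
    proof (cases "x \<in> N")
      case True
      then show ?thesis using O' by (metis DiffD2 open_contains_ball subset_eq)
    next
      case False
      show ?thesis
      proof (cases "x \<in> {a..b}")
        case True
        then have "(F has_derivative (\<lambda>h. f x * h)) (at x within {a..b})"
          using False by (auto simp: N_def has_field_derivative_def)
        then obtain \<rho> where "\<rho> > 0" "\<And>y. y\<in>{a..b} \<Longrightarrow> norm (y - x) < \<rho> \<Longrightarrow>
            norm (F y - F x - f x * (y - x)) \<le> \<eta> * norm (y - x)"
          using \<eta> unfolding has_derivative_within_alt by metis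
        then show ?thesis using False by (intro exI[of _ \<rho>]) auto
      qed (use False in \<open>auto intro!: exI[of _ 1]\<close>)
    qed
    then obtain \<rho> where \<rho>: "\<And>x. \<rho> x > 0" "\<And>x. x \<in> N \<Longrightarrow> ball x (\<rho> x) \<subseteq> O'"
       "\<And>x y. x \<in> {a..b} - N \<Longrightarrow> y\<in>{a..b} \<Longrightarrow> \<bar>y - x\<bar> < \<rho> x \<Longrightarrow> \<bar>F y - F x - f x * (y - x)\<bar> \<le> \<eta> * \<bar>y - x\<bar>"
      by metis
    show "\<exists>\<gamma>. gauge \<gamma> \<and> (\<forall>\<D>. \<D> tagged_division_of {a..b} \<and> \<gamma> fine \<D> \<longrightarrow>
             norm ((\<Sum>(x, k)\<in>\<D>. measure lborel k *\<^sub>R f0 x) - (F b - F a)) < e)"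
    proof (intro exI[of _ "\<lambda>x. ball x (\<rho> x)"] conjI allI impI)
      show "gauge (\<lambda>x. ball x (\<rho> x))" using \<rho>(1) by (auto simp: gauge_def)
      fix \<D> assume "\<D> tagged_division_of {a..b} \<and> (\<lambda>x. ball x (\<rho> x)) fine \<D>"
      then have D: "\<D> tagged_division_of {a..b}" and fine: "\<And>x K. (x, K) \<in> \<D> \<Longrightarrow> K \<subseteq> ball x (\<rho> x)"
        by (auto simp: fine_def)
      have finD: "finite \<D>" using D by (rule tagged_division_ofD(1))
      have K: "\<exists>u v. K = {u..v} \<and> u \<le> x \<and> x \<le> v \<and> a \<le> u \<and> v \<le> b \<and> x \<in> {a..b}
            \<and> Inf K = u \<and> Sup K = v \<and> measure lborel K = v - u \<and> interior K = {u<..<v}" if xK: "(x, K) \<in> \<D>" for x K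
      proof -
        obtain u v where "K = {u..v}" using tagged_division_ofD(4)[OF D xK] by auto
        moreover have "x \<in> K" "K \<subseteq> {a..b}" using tagged_division_ofD(2,3)[OF D xK] by auto
        ultimately show ?thesis by (intro exI[of _ u] exI[of _ v]) auto
      qed
      define D1 where "D1 = {p \<in> \<D>. fst p \<in> N}"
      define D2 where "D2 = {p \<in> \<D>. fst p \<notin> N}"
      have D12: "\<D> = D1 \<union> D2" "D1 \<inter> D2 = {}" "finite D1" "finite D2" "D1 \<subseteq> \<D>" "D2 \<subseteq> \<D>"
        using finD by (auto simp: D1_def D2_def)
      \<comment> \<open>A tagged division may contain one-point intervals. Two different members
        with equal end points would have disjoint interiors, hence be the same single point with the
        same tag; so passing from members to pairs of end points is injective.\<close>
      have ends: "(x1, K1) = (x2, K2)" if m: "(x1, K1) \<in> \<D>" "(x2, K2) \<in> \<D>" "Inf K1 = Inf K2" "Sup K1 = Sup K2"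
        for x1 x2 K1 K2
      proof (rule ccontr)
        assume ne: "(x1, K1) \<noteq> (x2, K2)"
        then have "interior K1 \<inter> interior K2 = {}" using tagged_division_ofD(5)[OF D m(1,2)] by auto
        moreover obtain u v where uv: "K1 = {u..v}" "u \<le> x1" "x1 \<le> v" "Inf K1 = u" "Sup K1 = v"
          using K[OF m(1)] by auto
        moreover obtain u' v' where uv': "K2 = {u'..v'}" "u' \<le> x2" "x2 \<le> v'" "Inf K2 = u'" "Sup K2 = v'"
          using K[OF m(2)] by auto
        ultimately have "K1 = K2" "{u<..<v} = {}" using m by auto
        then have "u = v" using uv by (simp add: greaterThanLessThan_empty_iff)
        then show False using ne uv uv' m by auto
      qed
      define E where "E = (\<lambda>p. (Inf (snd p), Sup (snd p))) ` D1"
      have injE: "inj_on (\<lambda>p. (Inf (snd p), Sup (snd p))) D1"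
      proof (rule inj_onI)
        fix p p' assume "p \<in> D1" "p' \<in> D1" "(Inf (snd p), Sup (snd p)) = (Inf (snd p'), Sup (snd p'))"
        then show "p = p'" using ends[of "fst p" "snd p" "fst p'" "snd p'"] D12(5) by auto
      qed
      have sumE: "(\<Sum>(x, y)\<in>E. g x y) = (\<Sum>(x, K)\<in>D1. g (Inf K) (Sup K))" for g :: "real \<Rightarrow> real \<Rightarrow> real"
        unfolding E_def using injE by (subst sum.reindex) (auto simp: split_def)
      have "(\<Sum>(x, y)\<in>E. \<bar>F y - F x\<bar>) < e / 2"
      proof (rule d(2))
        show "finite E" using D12 by (auto simp: E_def)
        show "\<forall>(x, y)\<in>E. a \<le> x \<and> x \<le> y \<and> y \<le> b"
        proof (clarsimp simp: E_def)
          fix x K assume "(x, K) \<in> D1"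
          then have "(x, K) \<in> \<D>" using D12 by auto
          from K[OF this] show "a \<le> Inf K \<and> Inf K \<le> Sup K \<and> Sup K \<le> b" by auto
        qed
        show "pairwise (\<lambda>I J. {fst I<..<snd I} \<inter> {fst J<..<snd J} = {}) E"
          unfolding pairwise_def
        proof (intro ballI impI)
          fix I J assume "I \<in> E" "J \<in> E" "I \<noteq> J"
          then obtain p1 p2 where p: "p1 \<in> D1" "p2 \<in> D1" "I = (Inf (snd p1), Sup (snd p1))"
            "J = (Inf (snd p2), Sup (snd p2))" by (auto simp: E_def)
          define x1 K1 x2 K2 where "x1 = fst p1" "K1 = snd p1" "x2 = fst p2" "K2 = snd p2"
          then have *: "(x1, K1) \<in> \<D>" "(x2, K2) \<in> \<D>"
            "I = (Inf K1, Sup K1)" "J = (Inf K2, Sup K2)" using p D12(5) by auto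
          with \<open>I \<noteq> J\<close> have "(x1, K1) \<noteq> (x2, K2)" by auto
          then have "interior K1 \<inter> interior K2 = {}" using tagged_division_ofD(5)[OF D *(1,2)] by auto
          then show "{fst I<..<snd I} \<inter> {fst J<..<snd J} = {}"
            using K[OF *(1)] K[OF *(2)] *(3,4) by (elim exE conjE) (simp only: fst_conv snd_conv)
        qed
        have "D1 tagged_partial_division_of {a..b}"
          using D D12(5) by (auto intro: tagged_partial_division_subset simp: tagged_division_of_def)
        then have td: "D1 tagged_division_of (\<Union>(snd ` D1))"
          by (simp add: tagged_partial_division_of_Union_self)
        have "(\<Sum>(x, y)\<in>E. y - x) = (\<Sum>(x, K)\<in>D1. measure lborel K)"
          unfolding sumE 
        proof (intro sum.cong refl, clarify)
          fix x K assume "(x, K) \<in> D1"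
          then have "(x, K) \<in> \<D>" using D12 by auto
          from K[OF this] show "Sup K - Inf K = measure lborel K" by auto
        qed
        also have "\<dots> = sum (measure lborel) (snd ` D1)"
          using sum.over_tagged_division_lemma[OF td, of "measure lborel"] by (simp add: content_eq_0_interior)
        also have "\<dots> = sum (measure lebesgue) (snd ` D1)"
        proof (intro sum.cong refl)
          fix K assume "K \<in> snd ` D1"
          then obtain x where "(x, K) \<in> \<D>" using D12(5) by auto
          from K[OF this] obtain u v where "K = {u..v}" by blast
          then show "measure lborel K = measure lebesgue K" by simp
        qed
        also have "\<dots> = measure lebesgue (\<Union>(snd ` D1))"
          using content_division[OF division_of_tagged_division[OF td]] by simp
        also have "\<dots> \<le> measure lebesgue O'"
        proof (rule measure_mono_fmeasurable)
          show "\<Union>(snd ` D1) \<subseteq> O'"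
          proof
            fix y assume "y \<in> \<Union>(snd ` D1)"
            then obtain x K where "(x, K) \<in> D1" "y \<in> K" by auto
            then show "y \<in> O'" using fine[of x K] \<rho>(2)[of x] by (auto simp: D1_def)
          qed
          show "\<Union>(snd ` D1) \<in> sets lebesgue"
          proof (intro sets.finite_Union)
            show "finite (snd ` D1)" using D12 by auto
            show "snd ` D1 \<subseteq> sets lebesgue"
            proof clarsimp
              fix x K assume "(x, K) \<in> D1"
              then have "(x, K) \<in> \<D>" using D12 by auto
              from K[OF this] obtain u v where "K = {u..v}" by blast
              then show "K \<in> sets lebesgue" by simp
            qed
          qed
        qed (rule O')
        also have "\<dots> < d" by (rule O')
        finally show "(\<Sum>(x, y)\<in>E. y - x) < d" .
      qed
      then have b1: "(\<Sum>(x, K)\<in>D1. \<bar>F (Sup K) - F (Inf K)\<bar>) < e / 2"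
        by (simp add: sumE)
      have "(\<Sum>(x, K)\<in>D2. \<bar>measure lborel K * f0 x - (F (Sup K) - F (Inf K))\<bar>) \<le> (\<Sum>(x, K)\<in>D2. \<eta> * measure lborel K)"
      proof (rule sum_mono, clarify)
        fix x K assume xK: "(x, K) \<in> D2"
        then have mem: "(x, K) \<in> \<D>" "x \<notin> N" by (auto simp: D2_def)
        then obtain u v where uv: "K = {u..v}" "u \<le> x" "x \<le> v" "a \<le> u" "v \<le> b" "x \<in> {a..b}"
            "Inf K = u" "Sup K = v" "measure lborel K = v - u"
          using K by blast
        have "u \<in> K" "v \<in> K" using uv by auto
        then have "\<bar>u - x\<bar> < \<rho> x" "\<bar>v - x\<bar> < \<rho> x"
          using fine[OF mem(1)] by (auto simp: dist_real_def subset_iff)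
        then have "\<bar>F u - F x - f x * (u - x)\<bar> \<le> \<eta> * \<bar>u - x\<bar>" "\<bar>F v - F x - f x * (v - x)\<bar> \<le> \<eta> * \<bar>v - x\<bar>"
          using uv(2-6) mem(2) by (intro \<rho>(3); simp)+
        moreover have "measure lborel K * f0 x - (F (Sup K) - F (Inf K))
            = (F u - F x - f x * (u - x)) - (F v - F x - f x * (v - x))"
          using mem uv by (simp add: f0_def algebra_simps)
        moreover have "\<eta> * \<bar>u - x\<bar> + \<eta> * \<bar>v - x\<bar> = \<eta> * measure lborel K"
          using uv by (simp add: algebra_simps)
        ultimately show "\<bar>measure lborel K * f0 x - (F (Sup K) - F (Inf K))\<bar> \<le> \<eta> * measure lborel K" by linarith
      qed
      also have "\<dots> = \<eta> * (\<Sum>(x, K)\<in>D2. measure lborel K)" by (simp add: sum_distrib_left split_def)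
      also have "\<dots> \<le> \<eta> * (\<Sum>(x, K)\<in>\<D>. measure lborel K)"
        using D12 finD \<eta> by (intro mult_left_mono sum_mono2) auto
      also have "(\<Sum>(x, K)\<in>\<D>. measure lborel K) = b - a"
        using additive_content_tagged_division[of \<D> a b] D \<open>a \<le> b\<close> by simp
      also have "\<eta> * (b - a) < e / 2" using \<open>e > 0\<close> \<open>a \<le> b\<close> by (simp add: \<eta>_def field_simps)
      finally have b2: "(\<Sum>(x, K)\<in>D2. \<bar>measure lborel K * f0 x - (F (Sup K) - F (Inf K))\<bar>) < e / 2" .
      have "(\<Sum>(x, k)\<in>\<D>. measure lborel k *\<^sub>R f0 x) - (F b - F a)
          = (\<Sum>(x, K)\<in>\<D>. measure lborel K * f0 x - (F (Sup K) - F (Inf K)))"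
        using additive_tagged_division_1[OF \<open>a \<le> b\<close> D, of F] by (simp add: split_def sum_subtractf)
      also have "norm \<dots> \<le> (\<Sum>(x, K)\<in>\<D>. \<bar>measure lborel K * f0 x - (F (Sup K) - F (Inf K))\<bar>)"
        using sum_abs by (simp add: split_def)
      also have "\<dots> = (\<Sum>(x, K)\<in>D1. \<bar>F (Sup K) - F (Inf K)\<bar>)
          + (\<Sum>(x, K)\<in>D2. \<bar>measure lborel K * f0 x - (F (Sup K) - F (Inf K))\<bar>)"
      proof -
        have "(\<Sum>(x, K)\<in>D1. \<bar>F (Sup K) - F (Inf K)\<bar>) = (\<Sum>(x, K)\<in>D1. \<bar>measure lborel K * f0 x - (F (Sup K) - F (Inf K))\<bar>)"
          by (intro sum.cong) (auto simp: D1_def f0_def)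
        then show ?thesis using D12 by (simp add: sum.union_disjoint)
      qed
      finally show "norm ((\<Sum>(x, k)\<in>\<D>. measure lborel k *\<^sub>R f0 x) - (F b - F a)) < e" using b1 b2 by linarith
    qed
  qed
  then show ?thesis
    by (rule has_integral_spike[OF N, rotated]) (auto simp: f0_def)
qed

section \<open>Differentiation of the indefinite integral\<close>

text \<open>By Henstock's lemma the intervals on which the difference quotient is off by more than
  \<open>1 / (n + 1)\<close> have small total length if they are disjoint; Vitali's covering lemma selects
  disjoint intervals without losing more than a constant factor.\<close>

lemma negligible_bad_derivative_aux:
  fixes f :: "real \<Rightarrow> real" and n :: nat
  assumes f: "f integrable_on {a..b}"
  defines "F \<equiv> \<lambda>x. integral {a..x} f"
  shows "negligible {x \<in> {a..b}. \<forall>d>0. \<exists>y\<in>{a..b}. y \<noteq> x \<and> \<bar>y - x\<bar> < d \<and>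
           \<bar>F y - F x - f x * (y - x)\<bar> > \<bar>y - x\<bar> / (real n + 1)}"
proof -
  define E where "E = {x \<in> {a..b}. \<forall>d>0. \<exists>y\<in>{a..b}. y \<noteq> x \<and> \<bar>y - x\<bar> < d \<and>
           \<bar>F y - F x - f x * (y - x)\<bar> > \<bar>y - x\<bar> / (real n + 1)}"
  have "negligible E"
    unfolding negligible_outer_le
  proof (intro allI impI)
    fix e :: real assume "e > 0"
    \<comment> \<open>The factor \<open>5\<close> pays for the enlargement in Vitali's lemma,
      \<open>n + 1\<close> for the size of the error on each bad interval.\<close>
    define e' where "e' = e / (5 * (real n + 1))"
    have e': "e' > 0" using \<open>e > 0\<close> by (simp add: e'_def)
    obtain \<gamma> where \<gamma>: "gauge \<gamma>" "\<And>p. p tagged_partial_division_of {a..b} \<Longrightarrow> \<gamma> fine p \<Longrightarrow>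
        (\<Sum>(x, k)\<in>p. norm (measure lborel k *\<^sub>R f x - integral k f)) < e'"
      using Henstock_lemma[of f a b e', unfolded box_real, OF f e'] by blast
    have "\<exists>y\<in>{a..b}. y \<noteq> x \<and> \<bar>y - x\<bar> \<le> 1 \<and> closed_segment x y \<subseteq> \<gamma> x \<and>
        \<bar>F y - F x - f x * (y - x)\<bar> > \<bar>y - x\<bar> / (real n + 1)" if x: "x \<in> E" for x
    proof -
      have "open (\<gamma> x)" "x \<in> \<gamma> x" using \<gamma>(1) by (auto simp: gauge_def)
      then obtain d where d: "d > 0" "ball x d \<subseteq> \<gamma> x" using open_contains_ball by blast
      then have "min d 1 > 0" by simp
      then obtain y where y: "y\<in>{a..b}" "y \<noteq> x" "\<bar>y - x\<bar> < min d 1"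
          "\<bar>F y - F x - f x * (y - x)\<bar> > \<bar>y - x\<bar> / (real n + 1)"
        using x unfolding E_def by blast
      have "closed_segment x y \<subseteq> ball x d"
        using y(3) d(1) by (intro closed_segment_subset) (auto simp: dist_real_def abs_minus_commute)
      then show ?thesis using y d by (intro bexI[of _ y]) auto
    qed
    then have "\<forall>x\<in>E. \<exists>y. y\<in>{a..b} \<and> y \<noteq> x \<and> \<bar>y - x\<bar> \<le> 1 \<and> closed_segment x y \<subseteq> \<gamma> x \<and>
        \<bar>F y - F x - f x * (y - x)\<bar> > \<bar>y - x\<bar> / (real n + 1)"
      by blast
    from bchoice[OF this] obtain y where y: "\<And>x. x \<in> E \<Longrightarrow> y x \<in> {a..b} \<and> y x \<noteq> x \<and> \<bar>y x - x\<bar> \<le> 1 \<and>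
       closed_segment x (y x) \<subseteq> \<gamma> x \<and> \<bar>F (y x) - F x - f x * (y x - x)\<bar> > \<bar>y x - x\<bar> / (real n + 1)"
      by auto
    \<comment> \<open>\<open>cball (c x) (r x)\<close> is the segment from \<open>x\<close> to
      \<open>y x\<close>: Vitali's lemma wants balls, while Henstock's lemma wants an interval
      containing its tag, here an end point.\<close>
    define c r where "c x = (x + y x) / 2" and "r x = \<bar>y x - x\<bar> / 2" for x
    have cb: "cball (c x) (r x) = closed_segment x (y x)" for x
      by (auto simp: c_def r_def closed_segment_eq_real_ivl dist_real_def abs_if field_simps split: if_splits)
    have cov: "E \<subseteq> (\<Union>i\<in>E. cball (c i) (r i))"
      unfolding cb by auto
    have r: "0 < r i \<and> r i \<le> 1" if "i \<in> E" for i using y[OF that] by (auto simp: r_def)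
    obtain C where C: "countable C" "C \<subseteq> E"
       "pairwise (\<lambda>i j. disjnt (cball (c i) (r i)) (cball (c j) (r j))) C"
       "E \<subseteq> (\<Union>i\<in>C. cball (c i) (5 * r i))"
      using Vitali_covering_lemma_cballs[OF cov r] by blast
    \<comment> \<open>Henstock's lemma speaks of finite families; a bound uniform over the finite
      subsets passes to the countable family \<open>C\<close>.\<close>
    have key: "measure lebesgue (\<Union>i\<in>I. cball (c i) (5 * r i)) \<le> e" if I: "I \<subseteq> C" "finite I" for I
    proof -
      have IE: "I \<subseteq> E" using I C by blast
      define p where "p = (\<lambda>x. (x, cball (c x) (r x))) ` I"
      have sub: "cball (c x) (r x) \<subseteq> {a..b}" if "x \<in> I" for x
        unfolding cb using y[of x] IE that by (intro closed_segment_subset) (auto simp: E_def)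
      have "p tagged_partial_division_of {a..b}"
        unfolding tagged_partial_division_of_def
      proof (intro conjI allI impI)
        show "finite p" using I by (simp add: p_def)
        fix x K assume xK: "(x, K) \<in> p"
        then show "x \<in> K" by (auto simp: p_def cb)
        show "K \<subseteq> {a..b}" using xK sub by (auto simp: p_def)
        have "K = {c x - r x..c x + r x}" using xK by (auto simp: p_def cball_eq_atLeastAtMost)
        then show "\<exists>a b. K = cbox a b" by (metis box_real(2))
      next
        fix x1 K1 x2 K2 assume "(x1, K1) \<in> p \<and> (x2, K2) \<in> p \<and> (x1, K1) \<noteq> (x2, K2)"
        then have "x1 \<in> C" "x2 \<in> C" "x1 \<noteq> x2" "K1 = cball (c x1) (r x1)" "K2 = cball (c x2) (r x2)"
          using I by (auto simp: p_def)
        then have "disjnt K1 K2" using C(3) by (auto simp: pairwise_def)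
        then show "interior K1 \<inter> interior K2 = {}"
          using interior_subset[of K1] interior_subset[of K2] by (auto simp: disjnt_def)
      qed
      moreover have "\<gamma> fine p"
        using y IE by (auto simp: fine_def p_def cb)
      ultimately have "(\<Sum>(x, k)\<in>p. norm (measure lborel k *\<^sub>R f x - integral k f)) < e'"
        by (rule \<gamma>(2))
      also have "(\<Sum>(x, k)\<in>p. norm (measure lborel k *\<^sub>R f x - integral k f))
          = (\<Sum>x\<in>I. \<bar>measure lborel (cball (c x) (r x)) * f x - integral (cball (c x) (r x)) f\<bar>)"
        unfolding p_def by (subst sum.reindex) (auto simp: inj_on_def)
      finally have less: "(\<Sum>x\<in>I. \<bar>measure lborel (cball (c x) (r x)) * f x - integral (cball (c x) (r x)) f\<bar>) < e'" .
      have each: "2 * r x / (real n + 1) \<le> \<bar>measure lborel (cball (c x) (r x)) * f x - integral (cball (c x) (r x)) f\<bar>"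
        if "x \<in> I" for x
      proof -
        have x: "x \<in> E" using that IE by blast
        define u v where "u = min x (y x)" and "v = max x (y x)"
        have uv: "a \<le> u" "u \<le> v" "v \<le> b" "cball (c x) (r x) = {u..v}" "v - u = 2 * r x"
          using y[OF x] x unfolding cb E_def
          by (auto simp: u_def v_def closed_segment_eq_real_ivl r_def min_def max_def)
        have "F v - F u = integral {u..v} f"
          using Henstock_Kurzweil_Integration.integral_combine[of a u v f] uv
            integrable_on_subinterval[OF f, of a v] by (auto simp: F_def)
        then have "\<bar>measure lborel (cball (c x) (r x)) * f x - integral (cball (c x) (r x)) f\<bar>
            = \<bar>(F v - F u) - f x * (v - u)\<bar>"
          using uv by (simp add: algebra_simps abs_minus_commute)
        also have "\<dots> = \<bar>F (y x) - F x - f x * (y x - x)\<bar>"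
          by (cases "x \<le> y x") (auto simp: u_def v_def algebra_simps abs_minus_commute)
        finally show ?thesis using y[OF x] by (simp add: r_def)
      qed
      have sm: "(\<Sum>x\<in>I. 2 * r x / (real n + 1)) < e'"
        by (rule le_less_trans[OF sum_mono[OF each] less])
      have S: "(\<Sum>x\<in>I. 10 * r x) < e"
      proof -
        have "(\<Sum>x\<in>I. 10 * r x) = (5 * (real n + 1)) * (\<Sum>x\<in>I. 2 * r x / (real n + 1))"
          unfolding sum_distrib_left by (intro sum.cong refl) (simp add: field_simps)
        also have "\<dots> < (5 * (real n + 1)) * e'" using sm by (intro mult_strict_left_mono) auto
        also have "\<dots> = e" by (simp add: e'_def)
        finally show ?thesis .
      qed
      have "measure lebesgue (\<Union>i\<in>I. cball (c i) (5 * r i)) \<le> (\<Sum>i\<in>I. measure lebesgue (cball (c i) (5 * r i)))"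
        using I by (intro measure_UNION_le) auto
      also have "\<dots> = (\<Sum>x\<in>I. 10 * r x)"
      proof (intro sum.cong refl)
        fix x assume "x \<in> I"
        then have "r x > 0" using r IE by blast
        then show "measure lebesgue (cball (c x) (5 * r x)) = 10 * r x"
          unfolding cball_eq_atLeastAtMost by simp
      qed
      finally show ?thesis using S by simp
    qed
    have m: "\<And>i. i \<in> C \<Longrightarrow> cball (c i) (5 * r i) \<in> lmeasurable" by auto
    show "\<exists>T. E \<subseteq> T \<and> T \<in> lmeasurable \<and> measure lebesgue T \<le> e"
      using C(4) fmeasurable_UN_bound[OF C(1) m key] measure_UN_bound[OF C(1) m key] by blast
  qed
  then show ?thesis by (simp add: E_def)
qed

text \<open>Where the derivative fails to be \<open>f t\<close>, the error quotient exceeds some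
  \<open>1 / (n + 1)\<close> arbitrarily close to \<open>t\<close>, so the exceptional set is a
  countable union of the negligible sets just found.\<close>

lemma AE_has_real_derivative_integral:
  fixes f :: "real \<Rightarrow> real"
  assumes f: "f integrable_on {a..b}"
  shows "AE t in lebesgue_on {a..b}. ((\<lambda>x. integral {a..x} f) has_real_derivative f t) (at t within {a..b})"
proof -
  define F where "F = (\<lambda>x. integral {a..x} f)"
  define E where "E n = {x \<in> {a..b}. \<forall>d>0. \<exists>y\<in>{a..b}. y \<noteq> x \<and> \<bar>y - x\<bar> < d \<and>
           \<bar>F y - F x - f x * (y - x)\<bar> > \<bar>y - x\<bar> / (real n + 1)}" for n :: nat
  have "negligible (\<Union>n. E n)"
    unfolding E_def F_def by (intro negligible_countable_Union) (use negligible_bad_derivative_aux[OF f] in auto)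
  then have "AE t in lebesgue. t \<notin> (\<Union>n. E n)"
    unfolding negligible_iff_null_sets by (rule AE_not_in)
  then have "AE t in lebesgue. t \<in> {a..b} \<longrightarrow> (F has_real_derivative f t) (at t within {a..b})"
  proof (rule AE_mp[OF _ AE_I2], intro impI)
    fix t assume t: "t \<notin> (\<Union>n. E n)" "t \<in> {a..b}"
    show "(F has_real_derivative f t) (at t within {a..b})"
      unfolding has_field_derivative_def has_derivative_within_alt
    proof (intro conjI allI impI)
      show "bounded_linear ((*) (f t))" by (rule bounded_linear_mult_right)
      fix e :: real assume "e > 0"
      obtain n :: nat where n: "1 / (real n + 1) < e"
        using reals_Archimedean[OF \<open>e > 0\<close>] by (auto simp: inverse_eq_divide add.commute)
      from t have "\<not> (\<forall>d>0. \<exists>y\<in>{a..b}. y \<noteq> t \<and> \<bar>y - t\<bar> < d \<and>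
           \<bar>F y - F t - f t * (y - t)\<bar> > \<bar>y - t\<bar> / (real n + 1))"
        unfolding E_def by blast
      then obtain d where d0: "d > 0" "\<forall>y\<in>{a..b}. \<not> (y \<noteq> t \<and> \<bar>y - t\<bar> < d \<and>
           \<bar>F y - F t - f t * (y - t)\<bar> > \<bar>y - t\<bar> / (real n + 1))"
        by blast
      then have d: "d > 0" "\<And>y. y \<in> {a..b} \<Longrightarrow> y \<noteq> t \<Longrightarrow> \<bar>y - t\<bar> < d \<Longrightarrow>
           \<bar>F y - F t - f t * (y - t)\<bar> \<le> \<bar>y - t\<bar> / (real n + 1)"
        by (auto simp: not_less)
      show "\<exists>d>0. \<forall>y\<in>{a..b}. norm (y - t) < d \<longrightarrow> norm (F y - F t - f t * (y - t)) \<le> e * norm (y - t)"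
      proof (intro exI[of _ d] conjI ballI impI d(1))
        fix y assume y: "y \<in> {a..b}" "norm (y - t) < d"
        show "norm (F y - F t - f t * (y - t)) \<le> e * norm (y - t)"
        proof (cases "y = t")
          case False
          then have "\<bar>F y - F t - f t * (y - t)\<bar> \<le> (1 / (real n + 1)) * \<bar>y - t\<bar>"
            using d(2)[of y] y by simp
          also have "\<dots> \<le> e * \<bar>y - t\<bar>" using n by (intro mult_right_mono) auto
          finally show ?thesis by simp
        qed simp
      qed
    qed
  qed
  then show ?thesis
    unfolding F_def by (subst AE_restrict_space_iff) auto
qed

lemma AE_lebesgue_on_subinterval:
  assumes "AE t in lebesgue_on {a..b}. (F has_real_derivative f t) (at t within {a..b})"
    and "a \<le> c" "d \<le> (b :: real)"
  shows "AE t in lebesgue_on {c..d}. (F has_real_derivative f t) (at t within {c..d})"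
proof -
  have "AE t in lebesgue. t \<in> {a..b} \<longrightarrow> (F has_real_derivative f t) (at t within {a..b})"
    using assms(1) by (subst (asm) AE_restrict_space_iff) auto
  then have "AE t in lebesgue. t \<in> {c..d} \<longrightarrow> (F has_real_derivative f t) (at t within {c..d})"
    by (rule AE_mp[OF _ AE_I2]) (use assms(2,3) in \<open>auto intro: DERIV_subset\<close>)
  then show ?thesis by (subst AE_restrict_space_iff) auto
qed

lemma abs_continuous_on_has_integral_subinterval:
  assumes F: "abs_continuous_on F a b"
    and "AE t in lebesgue_on {a..b}. (F has_real_derivative f t) (at t within {a..b})"
    and "a \<le> c" "c \<le> d" "d \<le> b"
  shows "(f has_integral (F d - F c)) {c..d}"
  using assms by (intro abs_continuous_on_has_integral abs_continuous_on_subset[OF F]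
      AE_lebesgue_on_subinterval[OF assms(2)]) auto

section \<open>The equation \<open>y'' = q y\<close> on an interval\<close>

text \<open>The derivative \<open>y'\<close> is a parameter because its values at the two end points
  enter the Kirchhoff sums and Green's formula. The three clauses are the edge condition of
  \<open>q_harmonic\<close> with the witness made explicit.\<close>

definition ode_sol :: "(real \<Rightarrow> real) \<Rightarrow> real \<Rightarrow> (real \<Rightarrow> real) \<Rightarrow> (real \<Rightarrow> real) \<Rightarrow> bool" where
  "ode_sol q l y y' \<longleftrightarrow>
     (\<forall>t\<in>{0..l}. (y has_real_derivative y' t) (at t within {0..l})) \<and>
     abs_continuous_on y' 0 l \<and>
     (AE t in lebesgue_on {0..l}. (y' has_real_derivative q t * y t) (at t within {0..l}))"

lemma absolutely_integrable_mult_continuous: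
  fixes q y :: "real \<Rightarrow> real"
  assumes q: "q absolutely_integrable_on {a..b}" and y: "continuous_on {a..b} y"
  shows "(\<lambda>t. q t * y t) absolutely_integrable_on {a..b}"
proof -
  have "(\<lambda>t. y t * q t) absolutely_integrable_on {a..b}"
  proof (rule absolutely_integrable_bounded_measurable_product_real[OF _ _ _ q])
    show "y \<in> borel_measurable (lebesgue_on {a..b})"
      using y by (intro continuous_imp_measurable_on_sets_lebesgue) auto
    show "bounded (y ` {a..b})"
      using y by (intro compact_imp_bounded compact_continuous_image) auto
  qed auto
  then show ?thesis by (simp add: mult.commute)
qed

text \<open>These are the terms of the Neumann series, not the Picard iterates: the solution is
  their sum over \<open>n\<close>, and the affine term carries both initial values.\<close>

primrec picard :: "(real \<Rightarrow> real) \<Rightarrow> real \<Rightarrow> real \<Rightarrow> nat \<Rightarrow> real \<Rightarrow> real" where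
  "picard q a b 0 = (\<lambda>t. a + b * t)"
| "picard q a b (Suc n) = (\<lambda>t. integral {0..t} (\<lambda>r. integral {0..r} (\<lambda>s. q s * picard q a b n s)))"

locale schroedinger_interval =
  fixes q :: "real \<Rightarrow> real" and l :: real
  assumes l: "l > 0" and q0: "\<And>t. t \<in> {0..l} \<Longrightarrow> q t \<ge> 0" and q: "q absolutely_integrable_on {0..l}"
begin

lemma q_integrable: "q integrable_on {0..l}"
  using q absolutely_integrable_on_def by blast

lemma q_mult_integrable:
  assumes "continuous_on {0..l} y" "t \<le> l"
  shows "(\<lambda>s. q s * y s) integrable_on {0..t}" "(\<lambda>s. q s * y s) absolutely_integrable_on {0..l}"
proof -
  show *: "(\<lambda>s. q s * y s) absolutely_integrable_on {0..l}"
    by (rule absolutely_integrable_mult_continuous[OF q assms(1)])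
  then have "(\<lambda>s. q s * y s) integrable_on {0..l}"
    unfolding absolutely_integrable_on_def by blast
  then show "(\<lambda>s. q s * y s) integrable_on {0..t}"
    by (rule integrable_on_subinterval) (use assms(2) in auto)
qed

abbreviation (input) "Q \<equiv> \<lambda>t. integral {0..t} q"

lemma Q_mono: "0 \<le> s \<Longrightarrow> s \<le> t \<Longrightarrow> t \<le> l \<Longrightarrow> 0 \<le> Q s \<and> Q s \<le> Q t"
  using q0 by (intro conjI integral_nonneg integral_subset_le integrable_on_subinterval[OF q_integrable]) auto

text \<open>The chain rule holds almost everywhere for powers of \<open>Q\<close>, and these are
  absolutely continuous. For a merely integrable \<open>q\<close> this replaces the integration of
  powers of \<open>t\<close> and is the source of the factorials in the series bounds.\<close>

lemma integral_q_Q_power: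
  assumes "0 \<le> t" "t \<le> l"
  shows "((\<lambda>s. q s * Q s ^ n) has_integral Q t ^ Suc n / Suc n) {0..t}"
proof -
  have ac: "abs_continuous_on Q 0 l" by (rule abs_continuous_on_indefinite_integral[OF q])
  have ac': "abs_continuous_on (\<lambda>t. Q t ^ n) 0 l" for n
  proof (induction n)
    case (Suc n)
    from abs_continuous_on_mult[OF ac Suc] show ?case by simp
  qed (auto intro!: abs_continuous_on_lipschitz[of _ _ _ 0])
  have "((\<lambda>s. real (Suc n) * (q s * Q s ^ n)) has_integral Q t ^ Suc n - Q 0 ^ Suc n) {0..t}"
  proof (rule abs_continuous_on_has_integral_subinterval[OF ac'])
    show "AE t in lebesgue_on {0..l}.
       ((\<lambda>t. Q t ^ Suc n) has_real_derivative real (Suc n) * (q t * Q t ^ n)) (at t within {0..l})"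
      using AE_has_real_derivative_integral[OF q_integrable]
    proof (rule eventually_mono)
      fix t assume "(Q has_real_derivative q t) (at t within {0..l})"
      from DERIV_power_Suc[OF this, of n]
      show "((\<lambda>t. Q t ^ Suc n) has_real_derivative real (Suc n) * (q t * Q t ^ n)) (at t within {0..l})"
        by (simp only: of_nat_Suc)
    qed
  qed (use assms in auto)
  from has_integral_mult_right[OF this, of "1 / real (Suc n)"] show ?thesis
    by simp
qed

lemma picard_continuous: "continuous_on {0..l} (picard q a b n)"
proof (induction n)
  case (Suc n)
  then have "(\<lambda>s. q s * picard q a b n s) integrable_on {0..l}"
    using q_mult_integrable(1)[OF Suc, of l] by simp
  then have "continuous_on {0..l} (\<lambda>r. integral {0..r} (\<lambda>s. q s * picard q a b n s))"
    by (rule indefinite_integral_continuous_1)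
  then have "continuous_on {0..l} (\<lambda>t. integral {0..t} (\<lambda>r. integral {0..r} (\<lambda>s. q s * picard q a b n s)))"
    by (rule indefinite_integral_continuous_1[OF integrable_continuous_interval])
  then show ?case by simp
qed (auto intro!: continuous_intros)

text \<open>Both bounds run through one induction: integrating the bound on the inner integral over
  a length of at most \<open>l\<close> gives the next term. \<open>M\<close> bounds the affine
  start.\<close>

lemma picard_bounds:
  assumes M_def: "M = \<bar>a\<bar> + \<bar>b\<bar> * l" and t: "0 \<le> t" "t \<le> l"
  shows "\<bar>picard q a b n t\<bar> \<le> M * (l * Q t) ^ n / fact n \<and>
    \<bar>integral {0..t} (\<lambda>s. q s * picard q a b n s)\<bar> \<le> M * l ^ n * Q t ^ Suc n / fact (Suc n)"
  using t
proof (induction n arbitrary: t)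
  have M: "M \<ge> 0" using l by (simp add: M_def)
  have step: "\<bar>integral {0..t} (\<lambda>s. q s * picard q a b n s)\<bar> \<le> M * l ^ n * Q t ^ Suc n / fact (Suc n)"
    if t: "0 \<le> t" "t \<le> l" and IH: "\<And>s. 0 \<le> s \<Longrightarrow> s \<le> t \<Longrightarrow> \<bar>picard q a b n s\<bar> \<le> M * (l * Q s) ^ n / fact n" for n t
  proof -
    have hi: "((\<lambda>s. (M * l ^ n / fact n) * (q s * Q s ^ n)) has_integral (M * l ^ n / fact n) * (Q t ^ Suc n / Suc n)) {0..t}"
      by (intro has_integral_mult_right integral_q_Q_power t)
    have "norm (integral {0..t} (\<lambda>s. q s * picard q a b n s)) \<le> integral {0..t} (\<lambda>s. (M * l ^ n / fact n) * (q s * Q s ^ n))"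
    proof (rule integral_norm_bound_integral)
      show "(\<lambda>s. q s * picard q a b n s) integrable_on {0..t}"
        by (rule q_mult_integrable(1)[OF picard_continuous t(2)])
      show "(\<lambda>s. (M * l ^ n / fact n) * (q s * Q s ^ n)) integrable_on {0..t}" using hi by blast
      fix s assume s: "s \<in> {0..t}"
      have "\<bar>q s * picard q a b n s\<bar> = q s * \<bar>picard q a b n s\<bar>" using q0[of s] s t by (simp add: abs_mult)
      also have "\<dots> \<le> q s * (M * (l * Q s) ^ n / fact n)"
        using IH[of s] q0[of s] s t by (intro mult_left_mono) auto
      finally show "norm (q s * picard q a b n s) \<le> (M * l ^ n / fact n) * (q s * Q s ^ n)"
        by (simp add: power_mult_distrib algebra_simps)
    qed
    also have "\<dots> = (M * l ^ n / fact n) * (Q t ^ Suc n / Suc n)" using hi by blast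
    finally show ?thesis by (simp add: field_simps)
  qed
  {
    case 0
    have bs: "\<bar>b * s\<bar> \<le> \<bar>b\<bar> * l" if "0 \<le> s" "s \<le> t" for s
      using 0 that by (auto simp: abs_mult intro!: mult_mono)
    have "\<bar>picard q a b 0 s\<bar> \<le> M * (l * Q s) ^ 0 / fact 0" if "0 \<le> s" "s \<le> t" for s
      using bs[OF that] abs_triangle_ineq[of a "b * s"] by (simp add: M_def)
    then have B: "\<bar>picard q a b 0 s\<bar> \<le> M * (l * Q s) ^ 0 / fact 0" if "0 \<le> s" "s \<le> t" for s
      using that by blast
    from B[of t] step[OF 0 B] 0 show ?case by blast
  next
    case (Suc n)
    have P: "\<bar>picard q a b (Suc n) t\<bar> \<le> M * (l * Q t) ^ Suc n / fact (Suc n)" if t: "0 \<le> t" "t \<le> l" for t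
    proof -
      have "norm (integral {0..t} (\<lambda>r. integral {0..r} (\<lambda>s. q s * picard q a b n s)))
          \<le> integral {0..t} (\<lambda>r. M * l ^ n * Q t ^ Suc n / fact (Suc n))"
      proof (rule integral_norm_bound_integral)
        have "continuous_on {0..l} (\<lambda>r. integral {0..r} (\<lambda>s. q s * picard q a b n s))"
          using q_mult_integrable(1)[OF picard_continuous[of a b n], of l] by (intro indefinite_integral_continuous_1) auto
        then show "(\<lambda>r. integral {0..r} (\<lambda>s. q s * picard q a b n s)) integrable_on {0..t}"
          using t by (intro integrable_continuous_interval) (auto intro: continuous_on_subset)
        show "norm (integral {0..r} (\<lambda>s. q s * picard q a b n s)) \<le> M * l ^ n * Q t ^ Suc n / fact (Suc n)"
          if r: "r \<in> {0..t}" for r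
        proof -
          have "\<bar>integral {0..r} (\<lambda>s. q s * picard q a b n s)\<bar> \<le> M * l ^ n * Q r ^ Suc n / fact (Suc n)"
            using Suc.IH[of r] r t by auto
          also have "\<dots> \<le> M * l ^ n * Q t ^ Suc n / fact (Suc n)"
            using Q_mono[of r t] r t M l by (intro divide_right_mono mult_left_mono power_mono) auto
          finally show ?thesis by simp
        qed
      qed auto
      also have "\<dots> = t * (M * l ^ n * Q t ^ Suc n / fact (Suc n))" using t by simp
      also have "\<dots> \<le> l * (M * l ^ n * Q t ^ Suc n / fact (Suc n))"
        using t M l Q_mono[of 0 t] by (intro mult_right_mono) auto
      finally show ?thesis by (simp add: power_mult_distrib algebra_simps)
    qed
    from P[OF Suc.prems] step[OF Suc.prems P] Suc.prems show ?case by auto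
  }
qed

lemma ode_sol_exists:
  "\<exists>y y'. ode_sol q l y y' \<and> y 0 = a \<and> y' 0 = b"
proof -
  define M where "M = \<bar>a\<bar> + \<bar>b\<bar> * l"
  have M: "M \<ge> 0" using l by (simp add: M_def)
  define Y where "Y = picard q a b"
  \<comment> \<open>\<open>P n\<close> is the derivative of the term \<open>Y n\<close>; only the
    index \<open>0\<close> sees the slope \<open>b\<close>.\<close>
  define P where "P n t = (case n of 0 \<Rightarrow> b | Suc m \<Rightarrow> integral {0..t} (\<lambda>s. q s * Y m s))" for n t
  define c where "c n = M * (l * Q l) ^ n / fact n" for n
  have sc: "summable c"
    unfolding c_def using summable_mult[OF summable_exp[of "l * Q l"], of M] by (simp add: field_simps)
  have Ycont: "continuous_on {0..l} (Y n)" for n unfolding Y_def by (rule picard_continuous)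
  have Yb: "\<bar>Y n t\<bar> \<le> c n" if "t \<in> {0..l}" for n t
  proof -
    have "\<bar>Y n t\<bar> \<le> M * (l * Q t) ^ n / fact n" using picard_bounds[of M a b t n] that by (auto simp: Y_def M_def)
    also have "\<dots> \<le> c n" unfolding c_def
      using that Q_mono[of t l] l M by (intro divide_right_mono mult_left_mono power_mono) auto
    finally show ?thesis .
  qed
  have Pcont: "continuous_on {0..l} (P n)" for n
  proof (cases n)
    case (Suc m)
    have "(\<lambda>s. q s * Y m s) integrable_on {0..l}" using q_mult_integrable(1)[OF Ycont, of l] by simp
    then show ?thesis unfolding P_def Suc by (auto intro!: indefinite_integral_continuous_1)
  qed (simp add: P_def[abs_def])
  have Yder: "(Y n has_real_derivative P n t) (at t within {0..l})" if t: "t \<in> {0..l}" for n t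
  proof (cases n)
    case 0
    then show ?thesis by (auto simp: Y_def P_def intro!: derivative_eq_intros)
  next
    case (Suc m)
    have eq: "Y n = (\<lambda>t. integral {0..t} (P n))"
      by (auto simp: Suc Y_def P_def[abs_def])
    show ?thesis unfolding eq by (rule integral_has_real_derivative[OF Pcont t])
  qed
  \<comment> \<open>Majorant of \<open>P\<close>, shifted by one index because
    \<open>P (Suc m)\<close> integrates \<open>q * Y m\<close>.\<close>
  define d where "d n = (case n of 0 \<Rightarrow> \<bar>b\<bar> | Suc m \<Rightarrow> Q l * c m)" for n
  have sd: "summable d"
    using summable_mult[OF sc, of "Q l"] by (subst summable_Suc_iff[symmetric]) (simp add: d_def)
  have Pb: "\<bar>P n t\<bar> \<le> d n" if t: "t \<in> {0..l}" for n t
  proof (cases n)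
    case (Suc m)
    have "norm (integral {0..t} (\<lambda>s. q s * Y m s)) \<le> integral {0..t} (\<lambda>s. q s * c m)"
    proof (rule integral_norm_bound_integral)
      show "(\<lambda>s. q s * Y m s) integrable_on {0..t}" using t by (intro q_mult_integrable(1) Ycont) auto
      show "(\<lambda>s. q s * c m) integrable_on {0..t}" using t by (intro q_mult_integrable(1)) auto
      fix s assume "s \<in> {0..t}"
      then show "norm (q s * Y m s) \<le> q s * c m"
        using t q0[of s] Yb[of s m] by (auto simp: abs_mult intro!: mult_mono)
    qed
    also have "\<dots> = Q t * c m" by simp
    also have "\<dots> \<le> Q l * c m" using t Q_mono[of t l] Yb[of 0 m] l by (intro mult_right_mono) auto
    finally show ?thesis by (simp add: P_def d_def Suc)
  qed (simp add: P_def d_def)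
  define y where "y t = (\<Sum>n. Y n t)" for t
  define p where "p t = (\<Sum>n. P n t)" for t
  have ulP: "uniform_limit {0..l} (\<lambda>N t. \<Sum>n<N. P n t) p sequentially"
    unfolding p_def by (rule Weierstrass_m_test[OF _ sd]) (use Pb in auto)
  have ulY: "uniform_limit {0..l} (\<lambda>N t. \<Sum>n<N. Y n t) y sequentially"
    unfolding y_def by (rule Weierstrass_m_test[OF _ sc]) (use Yb in auto)
  have ycont: "continuous_on {0..l} y"
    by (rule uniform_limit_theorem[OF _ ulY]) (auto intro!: always_eventually continuous_intros Ycont)
  have y_sums: "(\<lambda>n. Y n t) sums y t" if "t \<in> {0..l}" for t
    using tendsto_uniform_limitI[OF ulY that] by (simp add: sums_def)
  have p_sums: "(\<lambda>n. P n t) sums p t" if "t \<in> {0..l}" for t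
    using tendsto_uniform_limitI[OF ulP that] by (simp add: sums_def)
  have "\<exists>g. \<forall>t\<in>{0..l}. (\<lambda>n. Y n t) sums g t \<and> (g has_field_derivative p t) (at t within {0..l})"
  proof (rule has_field_derivative_series[OF _ Yder ulP])
    show "(0::real) \<in> {0..l}" using l by simp
    show "summable (\<lambda>n. Y n 0)" using y_sums[of 0] l by (auto simp: sums_iff)
  qed auto
  then obtain g where g: "\<And>t. t \<in> {0..l} \<Longrightarrow> (\<lambda>n. Y n t) sums g t"
      "\<And>t. t \<in> {0..l} \<Longrightarrow> (g has_field_derivative p t) (at t within {0..l})" by blast
  have gy: "g t = y t" if "t \<in> {0..l}" for t using g(1)[OF that] y_sums[OF that] sums_unique2 by blast
  have yder: "(y has_real_derivative p t) (at t within {0..l})" if "t \<in> {0..l}" for t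
    by (rule has_field_derivative_transform_within[OF g(2)[OF that] zero_less_one that]) (use gy in auto)
  have p_eq: "p t = b + integral {0..t} (\<lambda>s. q s * y s)" if t: "t \<in> {0..l}" for t
  proof -
    have "(\<lambda>N. integral {0..t} (\<lambda>s. \<Sum>n<N. q s * Y n s)) \<longlonglongrightarrow> integral {0..t} (\<lambda>s. q s * y s)"
    proof (rule dominated_convergence(2))
      show "(\<lambda>s. \<Sum>n<N. q s * Y n s) integrable_on {0..t}" for N
        using t by (intro integrable_sum q_mult_integrable(1) Ycont) auto
      show "(\<lambda>s. q s * suminf c) integrable_on {0..t}" using t by (intro q_mult_integrable(1)) auto
      fix s assume s: "s \<in> {0..t}"
      have "(\<Sum>n<N. \<bar>Y n s\<bar>) \<le> suminf c" for N
      proof -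
        have "(\<Sum>n<N. \<bar>Y n s\<bar>) \<le> (\<Sum>n<N. c n)" using s t Yb by (intro sum_mono) auto
        also have "\<dots> \<le> suminf c" using order_trans[OF abs_ge_zero Yb[of 0]] l sc by (intro sum_le_suminf) auto
        finally show ?thesis .
      qed
      then show "norm (\<Sum>n<N. q s * Y n s) \<le> q s * suminf c" for N
        using q0[of s] s t unfolding sum_distrib_left[symmetric]
        by (auto simp: abs_mult intro!: mult_mono order_trans[OF sum_abs])
      have "(\<lambda>n. q s * Y n s) sums (q s * y s)" using s t by (intro sums_mult y_sums) auto
      then show "(\<lambda>N. \<Sum>n<N. q s * Y n s) \<longlonglongrightarrow> q s * y s" by (simp add: sums_def)
    qed
    moreover have "integral {0..t} (\<lambda>s. \<Sum>n<N. q s * Y n s) = (\<Sum>n<N. P (Suc n) t)" for N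
      using t by (subst integral_sum) (auto intro!: q_mult_integrable(1) Ycont simp: P_def)
    ultimately have "(\<lambda>n. P (Suc n) t) sums integral {0..t} (\<lambda>s. q s * y s)"
      by (simp add: sums_def)
    then have "(\<lambda>n. P n t) sums (integral {0..t} (\<lambda>s. q s * y s) + P 0 t)"
      by (rule sums_Suc)
    then show ?thesis using p_sums[OF t] sums_unique2 by (fastforce simp: P_def)
  qed
  have qy: "(\<lambda>s. q s * y s) absolutely_integrable_on {0..l}"
    using q_mult_integrable(2)[OF ycont, of l] by simp
  \<comment> \<open>The series \<open>p\<close> equals this integral only on the interval. Taking
    the formula itself as derivative gives absolute continuity and the almost everywhere derivative
    directly from the results on indefinite integrals.\<close>
  define p' where "p' t = b + integral {0..t} (\<lambda>s. q s * y s)" for t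
  have "ode_sol q l y p'"
    unfolding ode_sol_def
  proof (intro conjI ballI)
    show "(y has_real_derivative p' t) (at t within {0..l})" if "t \<in> {0..l}" for t
      using yder[OF that] p_eq[OF that] by (simp add: p'_def)
    show "abs_continuous_on p' 0 l"
      unfolding p'_def[abs_def]
      by (intro abs_continuous_on_add abs_continuous_on_indefinite_integral[OF qy] abs_continuous_on_lipschitz[of _ _ _ 0]) auto
    have "(\<lambda>s. q s * y s) integrable_on {0..l}" using qy absolutely_integrable_on_def by blast
    from AE_has_real_derivative_integral[OF this]
    show "AE t in lebesgue_on {0..l}. (p' has_real_derivative q t * y t) (at t within {0..l})"
      by (rule AE_mp[OF _ AE_I2]) (auto simp: p'_def[abs_def] intro!: derivative_eq_intros)
  qed
  moreover have "y 0 = a"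
  proof -
    have "Y n 0 = (if n = 0 then a else 0)" for n by (cases n) (auto simp: Y_def)
    then have "(\<lambda>n. Y n 0) sums a" using sums_If_finite[of "\<lambda>n. n = 0" "\<lambda>_. a"] by simp
    then show ?thesis using y_sums[of 0] l sums_unique2 by auto
  qed
  moreover have "p' 0 = b" by (simp add: p'_def)
  ultimately show ?thesis by blast
qed

end

lemma ode_solD:
  assumes "ode_sol q l y y'"
  shows "\<And>t. t \<in> {0..l} \<Longrightarrow> (y has_real_derivative y' t) (at t within {0..l})"
    and "abs_continuous_on y' 0 l"
    and "AE t in lebesgue_on {0..l}. (y' has_real_derivative q t * y t) (at t within {0..l})"
  using assms by (auto simp: ode_sol_def)

lemma ode_sol_continuous:
  assumes "ode_sol q l y y'" shows "continuous_on {0..l} y" "continuous_on {0..l} y'"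
  using DERIV_continuous_on[OF ode_solD(1)[OF assms]] abs_continuous_on_imp_continuous_on[OF ode_solD(2)[OF assms]]
  by auto

lemma abs_continuous_on_C1:
  assumes d: "\<And>t. t \<in> {0..l} \<Longrightarrow> (f has_real_derivative f' t) (at t within {0..l})"
    and c: "continuous_on {0..l} f'"
  shows "abs_continuous_on f 0 l"
proof -
  have "bounded (f' ` {0..l})" by (intro compact_imp_bounded compact_continuous_image c) auto
  then obtain B where B: "\<And>t. t \<in> {0..l} \<Longrightarrow> \<bar>f' t\<bar> \<le> B" unfolding bounded_real by blast
  show ?thesis
  proof (rule abs_continuous_on_lipschitz)
    fix x y assume xy: "0 \<le> x" "x \<le> y" "y \<le> l"
    have "norm (f y - f x) \<le> B * norm (y - x)"
      by (rule field_differentiable_bound[of "{0..l}" f f']) (use xy d B in auto)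
    then show "\<bar>f y - f x\<bar> \<le> B * (y - x)" using xy by simp
  qed
qed

lemma ode_sol_abs_continuous:
  assumes "ode_sol q l y y'" shows "abs_continuous_on y 0 l"
  using abs_continuous_on_C1[OF ode_solD(1)[OF assms] ode_sol_continuous(2)[OF assms]] .

lemma ode_sol_lincomb:
  assumes "ode_sol q l y y'" "ode_sol q l z z'"
  shows "ode_sol q l (\<lambda>t. a * y t + b * z t) (\<lambda>t. a * y' t + b * z' t)"
  unfolding ode_sol_def
proof (intro conjI ballI)
  fix t assume "t \<in> {0..l}"
  then show "((\<lambda>t. a * y t + b * z t) has_real_derivative a * y' t + b * z' t) (at t within {0..l})"
    using ode_solD(1)[OF assms(1)] ode_solD(1)[OF assms(2)] by (auto intro!: derivative_eq_intros)
next
  show "abs_continuous_on (\<lambda>t. a * y' t + b * z' t) 0 l"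
    using assms by (intro abs_continuous_on_add abs_continuous_on_cmult ode_solD(2))
  show "AE t in lebesgue_on {0..l}. ((\<lambda>t. a * y' t + b * z' t) has_real_derivative
      q t * (a * y t + b * z t)) (at t within {0..l})"
    using ode_solD(3)[OF assms(1)] ode_solD(3)[OF assms(2)]
    by eventually_elim (auto intro!: derivative_eq_intros simp: algebra_simps)
qed

lemma ode_sol_uminus:
  assumes "ode_sol q l y y'" shows "ode_sol q l (\<lambda>t. - y t) (\<lambda>t. - y' t)"
  using ode_sol_lincomb[OF assms assms, of "-1" 0] by simp

lemma ode_sol_has_integral:
  assumes "ode_sol q l y y'" "0 \<le> s" "s \<le> t" "t \<le> l"
  shows "((\<lambda>r. q r * y r) has_integral (y' t - y' s)) {s..t}" "(y' has_integral (y t - y s)) {s..t}"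
proof -
  show "((\<lambda>r. q r * y r) has_integral (y' t - y' s)) {s..t}"
    using ode_solD[OF assms(1)] assms(2-4)
    by (intro abs_continuous_on_has_integral_subinterval[where a = 0 and b = l]) auto
  show "(y' has_integral (y t - y s)) {s..t}"
  proof (rule fundamental_theorem_of_calculus[OF assms(3)])
    fix x assume x: "x \<in> {s..t}"
    then have "(y has_real_derivative y' x) (at x within {s..t})"
      using ode_solD(1)[OF assms(1), of x] assms by (auto intro: DERIV_subset)
    then show "(y has_vector_derivative y' x) (at x within {s..t})"
      by (simp add: has_real_derivative_iff_has_vector_derivative)
  qed
qed

lemma ode_sol_interior_deriv:
  assumes "ode_sol q l y y'" "0 < t" "t < l"
  shows "(y has_real_derivative y' t) (at t)"
  using ode_solD(1)[OF assms(1), of t] assms(2,3) by (simp add: at_within_Icc_at)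

section \<open>Convexity and maximum principles on one edge\<close>

context schroedinger_interval
begin

text \<open>While \<open>y\<close> is nonnegative so is \<open>q * y\<close>, hence
  \<open>y'\<close> does not decrease and \<open>y\<close> does not fall below \<open>y t0\<close>.
  This supports itself: a first point with value at most half of \<open>y t0\<close> would be
  reached through nonnegative values only, and so would have value at least
  \<open>y t0\<close>.\<close>

lemma ode_rise_right:
  assumes sol: "ode_sol q l y y'" and t0: "0 \<le> t0" "y t0 > 0" "y' t0 \<ge> 0" and t: "t0 \<le> t" "t \<le> l"
  shows "y t \<ge> y t0 \<and> y' t \<ge> y' t0"
proof -
  have pos: "y' s \<ge> y' t0 \<and> y s \<ge> y t0"
    if s: "t0 \<le> s" "s \<le> l" and p: "\<And>r. t0 \<le> r \<Longrightarrow> r < s \<Longrightarrow> y r \<ge> 0" for s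
  proof -
    have inc: "y' r \<ge> y' t0" if r: "t0 \<le> r" "r \<le> s" for r
    proof -
      have "((\<lambda>r. q r * y r) has_integral (y' r - y' t0)) {t0..r}"
        using ode_sol_has_integral(1)[OF sol, of t0 r] r s t0 by simp
      then have "((\<lambda>r. q r * y r) has_integral (y' r - y' t0)) {t0<..<r}"
        by (simp add: has_integral_Icc_iff_Ioo)
      then have "0 \<le> y' r - y' t0"
        by (rule has_integral_nonneg) (use r s p q0 t0 in \<open>auto intro!: mult_nonneg_nonneg\<close>)
      then show ?thesis by simp
    qed
    have "(y' has_integral (y s - y t0)) {t0..s}"
      using ode_sol_has_integral(2)[OF sol, of t0 s] s t0 by simp
    then have "0 \<le> y s - y t0"
      by (rule has_integral_nonneg) (use inc t0 in force)
    then show ?thesis using inc[of s] s by simp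
  qed
  define Z where "Z = {s \<in> {t0..l}. y s \<le> y t0 / 2}"
  have Zc: "compact Z"
  proof -
    have "continuous_on {t0..l} y" using ode_sol_continuous(1)[OF sol] t0 by (auto elim: continuous_on_subset)
    then have "closed Z" unfolding Z_def
      by (rule continuous_on_closed_Collect_le[OF _ continuous_on_const]) auto
    moreover have "bounded Z" by (rule bounded_subset[of "{t0..l}"]) (auto simp: Z_def)
    ultimately show ?thesis by (simp add: compact_eq_bounded_closed)
  qed
  have "Z = {}"
  proof (rule ccontr)
    assume "Z \<noteq> {}"
    then obtain m where m: "m \<in> Z" "\<And>s. s \<in> Z \<Longrightarrow> m \<le> s"
      using compact_attains_inf[OF Zc] by blast
    have "y r \<ge> 0" if "t0 \<le> r" "r < m" for r
    proof -
      have "r \<notin> Z" using m(2)[of r] that by auto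
      then show ?thesis using that m(1) t0 by (auto simp: Z_def)
    qed
    then have "y m \<ge> y t0" using pos[of m] m(1) by (auto simp: Z_def)
    then show False using m(1) t0 by (auto simp: Z_def)
  qed
  then have "y r \<ge> 0" if "t0 \<le> r" "r \<le> l" for r
    using that t0 by (auto simp: Z_def not_le dest!: spec[of _ r])
  then show ?thesis using pos[of t] t by simp
qed

lemma ode_rise_left:
  assumes sol: "ode_sol q l y y'" and t0: "t0 \<le> l" "y t0 > 0" "y' t0 \<le> 0" and t: "0 \<le> t" "t \<le> t0"
  shows "y t \<ge> y t0 \<and> y' t \<le> y' t0"
proof -
  have pos: "y' s \<le> y' t0 \<and> y s \<ge> y t0"
    if s: "0 \<le> s" "s \<le> t0" and p: "\<And>r. s < r \<Longrightarrow> r \<le> t0 \<Longrightarrow> y r \<ge> 0" for s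
  proof -
    have inc: "y' r \<le> y' t0" if r: "s \<le> r" "r \<le> t0" for r
    proof -
      have "((\<lambda>r. q r * y r) has_integral (y' t0 - y' r)) {r..t0}"
        using ode_sol_has_integral(1)[OF sol, of r t0] r s t0 by simp
      then have "((\<lambda>r. q r * y r) has_integral (y' t0 - y' r)) {r<..<t0}"
        by (simp add: has_integral_Icc_iff_Ioo)
      then have "0 \<le> y' t0 - y' r"
        by (rule has_integral_nonneg) (use r s p q0 t0 in \<open>auto intro!: mult_nonneg_nonneg\<close>)
      then show ?thesis by simp
    qed
    have "(y' has_integral (y t0 - y s)) {s..t0}"
      using ode_sol_has_integral(2)[OF sol, of s t0] s t0 by simp
    then have "((\<lambda>r. - y' r) has_integral - (y t0 - y s)) {s..t0}"
      by (rule has_integral_neg)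
    then have "0 \<le> - (y t0 - y s)"
      by (rule has_integral_nonneg) (use inc t0 in force)
    then show ?thesis using inc[of s] s by simp
  qed
  define Z where "Z = {s \<in> {0..t0}. y s \<le> y t0 / 2}"
  have Zc: "compact Z"
  proof -
    have "continuous_on {0..t0} y" using ode_sol_continuous(1)[OF sol] t0 by (auto elim: continuous_on_subset)
    then have "closed Z" unfolding Z_def
      by (rule continuous_on_closed_Collect_le[OF _ continuous_on_const]) auto
    moreover have "bounded Z" by (rule bounded_subset[of "{0..t0}"]) (auto simp: Z_def)
    ultimately show ?thesis by (simp add: compact_eq_bounded_closed)
  qed
  have "Z = {}"
  proof (rule ccontr)
    assume "Z \<noteq> {}"
    then obtain m where m: "m \<in> Z" "\<And>s. s \<in> Z \<Longrightarrow> s \<le> m"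
      using compact_attains_sup[OF Zc] by blast
    have "y r \<ge> 0" if "m < r" "r \<le> t0" for r
    proof -
      have "r \<notin> Z" using m(2)[of r] that by auto
      then show ?thesis using that m(1) t0 by (auto simp: Z_def)
    qed
    then have "y m \<ge> y t0" using pos[of m] m(1) by (auto simp: Z_def)
    then show False using m(1) t0 by (auto simp: Z_def)
  qed
  then have "y r \<ge> 0" if "0 \<le> r" "r \<le> t0" for r
    using that t0 by (auto simp: Z_def not_le dest!: spec[of _ r])
  then show ?thesis using pos[of t] t by simp
qed

text \<open>An interior maximum has slope \<open>0\<close>, so the solution does not sink below it
  on either side; being bounded by the maximum, it is constant.\<close>

lemma ode_interior_max:
  assumes sol: "ode_sol q l y y'" and t0: "0 < t0" "t0 < l" "y t0 > 0"
    and mx: "\<And>t. t \<in> {0..l} \<Longrightarrow> y t \<le> y t0"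
  shows "\<forall>t\<in>{0..l}. y t = y t0"
proof -
  have d: "(y has_real_derivative y' t0) (at t0)" by (rule ode_sol_interior_deriv[OF sol t0(1,2)])
  have "y' t0 = 0"
    by (rule DERIV_local_max[OF d, of "min t0 (l - t0)"]) (use t0 mx in \<open>auto simp: abs_real_def split: if_splits\<close>)
  then show ?thesis
    using ode_rise_right[OF sol, of t0] ode_rise_left[OF sol, of t0] t0 mx
    by (metis atLeastAtMost_iff less_imp_le linear order_antisym order_refl)
qed

lemma ode_le:
  assumes sol: "ode_sol q l y y'" and "M \<ge> 0" "y 0 \<le> M" "y l \<le> M" "t \<in> {0..l}"
  shows "y t \<le> M"
proof (rule ccontr)
  assume n: "\<not> y t \<le> M"
  obtain t0 where m: "t0 \<in> {0..l}" "\<And>s. s \<in> {0..l} \<Longrightarrow> y s \<le> y t0"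
    using continuous_attains_sup[OF _ _ ode_sol_continuous(1)[OF sol]] assms(5) by auto
  then have gt: "y t0 > M" using n assms(5) by force
  then have "t0 \<noteq> 0" "t0 \<noteq> l" using assms by auto
  then have "0 < t0" "t0 < l" using m by auto
  have "\<forall>t\<in>{0..l}. y t = y t0"
    by (rule ode_interior_max[OF sol \<open>0 < t0\<close> \<open>t0 < l\<close> _ m(2)]) (use gt assms(2) in auto)
  then have "y 0 = y t0" using l by auto
  then show False using gt assms by auto
qed

lemma ode_nonneg:
  assumes sol: "ode_sol q l y y'" and "y 0 \<ge> 0" "y l \<ge> 0" "t \<in> {0..l}"
  shows "y t \<ge> 0"
  using ode_le[OF ode_sol_uminus[OF sol], of 0 t] assms by auto

section \<open>Basis solutions, edge energy and Green's formula\<close>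

lemma AE_zero_has_integral_const:
  assumes ac: "abs_continuous_on W 0 l"
    and "AE t in lebesgue_on {0..l}. (W has_real_derivative 0) (at t within {0..l})"
  shows "W l = W 0"
proof -
  have "((\<lambda>_. 0) has_integral (W l - W 0)) {0..l}"
    using abs_continuous_on_has_integral[OF _ assms] l by simp
  then show ?thesis using has_integral_unique[OF _ has_integral_0] by fastforce
qed

text \<open>The same \<open>c\<close> occurs at both ends because the Wronskian of the pair is
  constant; this makes the edge form symmetric. The slopes of \<open>y0 + y1\<close> at the two ends
  are \<open>- k0\<close> and \<open>k1\<close>, so \<open>k0 + k1\<close> is the integral of
  \<open>q * (y0 + y1)\<close>, and \<open>y0 + y1\<close> lies between \<open>0\<close> and
  \<open>1\<close>.\<close>

lemma edge_basis:
  obtains y0 y0' y1 y1' c k0 k1 where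
    "ode_sol q l y0 y0'" "y0 0 = 1" "y0 l = 0" "y0' 0 = - c - k0" "y0' l = - c"
    "ode_sol q l y1 y1'" "y1 0 = 0" "y1 l = 1" "y1' 0 = c" "y1' l = c + k1"
    "c > 0" "k0 \<ge> 0" "k1 \<ge> 0" "k0 + k1 \<le> integral {0..l} q"
    "\<And>t. t \<in> {0..l} \<Longrightarrow> 1 - l * integral {0..l} q \<le> y0 t + y1 t"
proof -
  obtain s s' where s: "ode_sol q l s s'" "s 0 = 0" "s' 0 = 1"
    using ode_sol_exists[of 0 1] by blast
  obtain p p' where p: "ode_sol q l p p'" "p 0 = 1" "p' 0 = 0"
    using ode_sol_exists[of 1 0] by blast
  \<comment> \<open>Otherwise the maximum principle would make \<open>s\<close> nonpositive, against
    its slope \<open>1\<close> at the zero \<open>0\<close>.\<close>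
  have sl: "s l > 0"
  proof (rule ccontr)
    assume "\<not> s l > 0"
    then have le: "s t \<le> 0" if "t \<in> {0..l}" for t
      using ode_le[OF s(1), of 0 t] s(2) that by auto
    have "(s has_real_derivative 1) (at 0 within {0..l})" using ode_solD(1)[OF s(1), of 0] s(3) l by simp
    then obtain d where d: "d > 0" "\<And>h. h > 0 \<Longrightarrow> 0 + h \<in> {0..l} \<Longrightarrow> h < d \<Longrightarrow> s 0 < s (0 + h)"
      using has_real_derivative_pos_inc_right[of s 1 0 "{0..l}"] by auto
    have "s 0 < s (min (d/2) l)" using d(2)[of "min (d/2) l"] d(1) l by auto
    then show False using le[of "min (d/2) l"] s(2) d(1) l by auto
  qed
  define c where "c = 1 / s l"
  have c: "c > 0" using sl by (simp add: c_def)
  define y1 y1' where "y1 t = c * s t + 0 * p t" and "y1' t = c * s' t + 0 * p' t" for t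
  define y0 y0' where "y0 t = 1 * p t + (- p l * c) * s t" and "y0' t = 1 * p' t + (- p l * c) * s' t" for t
  have sol1: "ode_sol q l y1 y1'" unfolding y1_def[abs_def] y1'_def[abs_def] by (rule ode_sol_lincomb[OF s(1) p(1)])
  have sol0: "ode_sol q l y0 y0'" unfolding y0_def[abs_def] y0'_def[abs_def] by (rule ode_sol_lincomb[OF p(1) s(1)])
  have v1: "y1 0 = 0" "y1 l = 1" "y1' 0 = c" using s sl by (auto simp: y1_def y1'_def c_def)
  have v0: "y0 0 = 1" "y0 l = 0" using s p sl by (auto simp: y0_def c_def)
  \<comment> \<open>The Wronskian: its derivative vanishes almost everywhere, and its end values are
    \<open>c\<close> at \<open>0\<close> and \<open>- y0' l\<close> at \<open>l\<close>.\<close>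
  define W where "W t = y0 t * y1' t - y1 t * y0' t" for t
  have "W l = W 0"
  proof (rule AE_zero_has_integral_const)
    show "abs_continuous_on W 0 l" unfolding W_def[abs_def]
      by (intro abs_continuous_on_diff abs_continuous_on_mult ode_solD(2)[OF sol0] ode_solD(2)[OF sol1]
          ode_sol_abs_continuous[OF sol0] ode_sol_abs_continuous[OF sol1])
    have sp: "AE t in lebesgue_on {0..l}. t \<in> {0..l}" by (rule AE_I2) auto
    show "AE t in lebesgue_on {0..l}. (W has_real_derivative 0) (at t within {0..l})"
      using ode_solD(3)[OF sol0] ode_solD(3)[OF sol1] sp unfolding W_def[abs_def]
      by eventually_elim (auto intro!: derivative_eq_intros ode_solD(1)[OF sol0] ode_solD(1)[OF sol1] simp: algebra_simps)
  qed
  then have v0': "y0' l = - c" using v0 v1 by (simp add: W_def)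
  define h h' where "h t = 1 * y0 t + 1 * y1 t" and "h' t = 1 * y0' t + 1 * y1' t" for t
  have solh: "ode_sol q l h h'" unfolding h_def[abs_def] h'_def[abs_def] by (rule ode_sol_lincomb[OF sol0 sol1])
  have hb: "h 0 = 1" "h l = 1" using v0 v1 by (auto simp: h_def)
  have h0: "h t \<ge> 0" if "t \<in> {0..l}" for t using ode_nonneg[OF solh _ _ that] hb by simp
  have h1: "h t \<le> 1" if "t \<in> {0..l}" for t using ode_le[OF solh _ _ _ that, of 1] hb by simp
  have "h' 0 \<le> 0"
  proof (rule ccontr)
    assume "\<not> h' 0 \<le> 0"
    then obtain d where d: "d > 0" "\<And>r. r > 0 \<Longrightarrow> 0 + r \<in> {0..l} \<Longrightarrow> r < d \<Longrightarrow> h 0 < h (0 + r)"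
      using has_real_derivative_pos_inc_right[OF ode_solD(1)[OF solh, of 0]] l by auto
    have "h 0 < h (min (d/2) l)" using d(2)[of "min (d/2) l"] d(1) l by auto
    moreover have "h (min (d/2) l) \<le> 1" by (rule h1) (use d(1) l in auto)
    ultimately show False using hb by simp
  qed
  have "h' l \<ge> 0"
  proof (rule ccontr)
    assume "\<not> h' l \<ge> 0"
    then obtain d where d: "d > 0" "\<And>r. r > 0 \<Longrightarrow> l - r \<in> {0..l} \<Longrightarrow> r < d \<Longrightarrow> h l < h (l - r)"
      using has_real_derivative_neg_dec_left[OF ode_solD(1)[OF solh, of l]] l by auto
    have "h l < h (l - min (d/2) l)" using d(2)[of "min (d/2) l"] d(1) l by auto
    moreover have "h (l - min (d/2) l) \<le> 1" by (rule h1) (use d(1) l in auto)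
    ultimately show False using hb by simp
  qed
  have "((\<lambda>r. q r * h r) has_integral (h' l - h' 0)) {0..l}"
    using ode_sol_has_integral(1)[OF solh, of 0 l] l by simp
  moreover have "(q has_integral integral {0..l} q) {0..l}" using q_integrable by blast
  ultimately have hI: "h' l - h' 0 \<le> integral {0..l} q"
  proof (rule has_integral_le)
    fix t assume "t \<in> {0..l}"
    then show "q t * h t \<le> q t" using q0[of t] h1[of t] by (simp add: mult_left_le)
  qed
  \<comment> \<open>The slope of \<open>h\<close> starts at no less than minus the integral of
    \<open>q\<close> and does not decrease afterwards, as \<open>q * h\<close> is nonnegative; over
    a length of at most \<open>l\<close> this bounds the drop below the initial value
    \<open>1\<close>.\<close>
  have hlow: "1 - l * integral {0..l} q \<le> h t" if t: "t \<in> {0..l}" for t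
  proof -
    have Q0: "integral {0..l} q \<ge> 0" using q0 by (intro integral_nonneg q_integrable) auto
    have slope: "h' r \<ge> - integral {0..l} q" if r: "r \<in> {0..t}" for r
    proof -
      have "((\<lambda>r. q r * h r) has_integral (h' r - h' 0)) {0..r}"
        using ode_sol_has_integral(1)[OF solh, of 0 r] r t by simp
      then have "0 \<le> h' r - h' 0"
        by (rule has_integral_nonneg) (use r t q0 h0 in \<open>auto intro!: mult_nonneg_nonneg\<close>)
      then show ?thesis using hI \<open>h' l \<ge> 0\<close> by linarith
    qed
    have I1: "(h' has_integral (h t - h 0)) {0..t}"
      using ode_sol_has_integral(2)[OF solh, of 0 t] t by simp
    have I2: "((\<lambda>_. - integral {0..l} q) has_integral (t * (- integral {0..l} q))) {0..t}"
      using has_integral_const_real[of "- integral {0..l} q" 0 t] t by simp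
    have "t * (- integral {0..l} q) \<le> h t - h 0"
      by (rule has_integral_le[OF I2 I1 slope])
    moreover have "t * integral {0..l} q \<le> l * integral {0..l} q"
      using t Q0 by (intro mult_right_mono) auto
    ultimately show ?thesis using hb by simp
  qed
  show thesis
  proof (rule that[of y0 y0' c "- h' 0" y1 y1' "h' l"])
    show "- h' 0 + h' l \<le> integral {0..l} q" using hI by simp
  qed (use sol0 sol1 v0 v1 v0' c hlow \<open>h' 0 \<le> 0\<close> \<open>h' l \<ge> 0\<close> in \<open>auto simp: h_def h'_def\<close>)
qed

text \<open>The right side is the integral of \<open>y'^2 + q y^2\<close>. With \<open>m\<close> the
  mean slope, \<open>W\<close> is an antiderivative of \<open>(y' - m)^2 + q y^2\<close>, so its
  increment is nonnegative; this increment is the right side minus the left side.\<close>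

lemma ode_energy_bound:
  assumes sol: "ode_sol q l y y'"
  shows "(y l - y 0)\<^sup>2 / l \<le> y l * y' l - y 0 * y' 0"
proof -
  define m where "m = (y l - y 0) / l"
  define W where "W t = y t * y' t - 2 * m * y t + m\<^sup>2 * t" for t
  have "((\<lambda>t. (y' t - m)\<^sup>2 + q t * (y t)\<^sup>2) has_integral (W l - W 0)) {0..l}"
  proof (rule abs_continuous_on_has_integral)
    show "abs_continuous_on W 0 l" unfolding W_def[abs_def]
      by (intro abs_continuous_on_add abs_continuous_on_diff abs_continuous_on_mult abs_continuous_on_cmult
          ode_solD(2)[OF sol] ode_sol_abs_continuous[OF sol] abs_continuous_on_id)
    have sp: "AE t in lebesgue_on {0..l}. t \<in> {0..l}" by (rule AE_I2) auto
    show "AE t in lebesgue_on {0..l}. (W has_real_derivative (y' t - m)\<^sup>2 + q t * (y t)\<^sup>2) (at t within {0..l})"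
      using ode_solD(3)[OF sol] sp unfolding W_def[abs_def]
      by eventually_elim (auto intro!: derivative_eq_intros ode_solD(1)[OF sol] simp: algebra_simps power2_eq_square)
  qed (use l in simp)
  then have "0 \<le> W l - W 0"
    by (rule has_integral_nonneg) (use q0 in auto)
  also have "W l - W 0 = y l * y' l - y 0 * y' 0 - 2 * (m * (y l - y 0)) + m\<^sup>2 * l"
    by (simp add: W_def algebra_simps)
  finally have "0 \<le> y l * y' l - y 0 * y' 0 - 2 * (m * (y l - y 0)) + m\<^sup>2 * l" .
  moreover have "m\<^sup>2 * l = (y l - y 0)\<^sup>2 / l" "m * (y l - y 0) = (y l - y 0)\<^sup>2 / l"
    using l by (auto simp: m_def power2_eq_square)
  ultimately show ?thesis by linarith
qed

text \<open>Since \<open>\<phi>\<close> is constant near both ends, no term with its derivative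
  survives integration by parts, and only the slopes of \<open>y\<close> at the ends remain.\<close>

lemma ode_green:
  fixes \<phi> :: "real \<Rightarrow> real"
  assumes sol: "ode_sol q l y y'" and c\<phi>: "continuous_on {0..l} \<phi>"
    and diff: "\<And>t n. 0 < t \<Longrightarrow> t < l \<Longrightarrow> ((deriv ^^ n) \<phi>) differentiable (at t)"
    and d: "d > 0" "\<And>t. 0 < t \<Longrightarrow> t < l \<Longrightarrow> t < d \<or> l - d < t \<Longrightarrow> deriv \<phi> t = 0"
  shows "set_integrable lebesgue {0<..<l} (\<lambda>t. y t * (- (deriv ^^ 2) \<phi> t + q t * \<phi> t))"
    and "(LINT t:{0<..<l}|lebesgue. y t * (- (deriv ^^ 2) \<phi> t + q t * \<phi> t)) = y' l * \<phi> l - y' 0 * \<phi> 0"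
proof -
  \<comment> \<open>At the end points \<open>\<phi>\<close> is controlled from inside only, so
    \<open>deriv\<close> carries no information there. Extension by \<open>0\<close> gives versions
    that are regular across the ends, because the derivative vanishes nearby.\<close>
  define \<psi> where "\<psi> t = (if 0 < t \<and> t < l then deriv \<phi> t else 0)" for t
  define \<xi> where "\<xi> t = (if 0 < t \<and> t < l then deriv (deriv \<phi>) t else 0)" for t
  define d' where "d' = min d (l / 2)"
  have d': "d' > 0" "d' \<le> d" "d' \<le> l / 2" using d l by (auto simp: d'_def)
  have D: "((deriv ^^ n) \<phi> has_real_derivative (deriv ^^ Suc n) \<phi> t) (at t)" if "0 < t" "t < l" for t n
    using diff[OF that, of n] DERIV_deriv_iff_real_differentiable by (auto simp: DERIV_deriv_iff_real_differentiable)
  have \<psi>0: "\<psi> t = 0" if "t < d' \<or> l - d' < t" for t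
    using d(2)[of t] that d' by (auto simp: \<psi>_def)
  have \<xi>0: "\<xi> t = 0" if "t < d' \<or> l - d' < t" for t
  proof (cases "0 < t \<and> t < l")
    case True
    define S where "S = {0<..<l} \<inter> ({..<d'} \<union> {l - d'<..})"
    have "(deriv \<phi> has_real_derivative 0) (at t)"
    proof (rule has_field_derivative_transform_within_open[of "\<lambda>_. 0" 0 t S])
      show "open S" unfolding S_def by (intro open_Int open_Un) auto
      show "t \<in> S" using True that by (auto simp: S_def)
      show "0 = deriv \<phi> x" if "x \<in> S" for x using d(2)[of x] that d' by (auto simp: S_def)
    qed auto
    then show ?thesis using True by (simp add: \<xi>_def DERIV_imp_deriv)
  qed (auto simp: \<xi>_def)
  have int\<psi>: "(\<psi> has_real_derivative \<xi> t) (at t)" if "0 < t" "t < l" for t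
    by (rule has_field_derivative_transform_within_open[of "deriv \<phi>" _ t "{0<..<l}"])
      (use D[OF that, of 1] that in \<open>auto simp: \<psi>_def \<xi>_def\<close>)
  have zero_at: "(f has_real_derivative 0) (at t)" if "t < d' \<or> l - d' < t" "\<And>s. s < d' \<or> l - d' < s \<Longrightarrow> f s = (0::real)" for f t
    by (rule has_field_derivative_transform_within_open[of "\<lambda>_. 0" 0 t "{..<d'} \<union> {l - d'<..}"])
      (use that in \<open>auto intro!: open_Un\<close>)
  have der\<psi>: "(\<psi> has_real_derivative \<xi> t) (at t)" for t
  proof (cases "0 < t \<and> t < l")
    case False
    then have t: "t < d' \<or> l - d' < t" using d' by auto
    show ?thesis using zero_at[OF t \<psi>0] \<xi>0[OF t] by simp
  qed (use int\<psi> in auto)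
  have cont\<xi>: "continuous_on {0..l} \<xi>"
  proof (rule continuous_at_imp_continuous_on, rule ballI)
    fix t assume "t \<in> {0..l}"
    show "isCont \<xi> t"
    proof (cases "0 < t \<and> t < l")
      case True
      have "(\<xi> has_real_derivative (deriv ^^ 3) \<phi> t) (at t)"
        by (rule has_field_derivative_transform_within_open[of "deriv (deriv \<phi>)" _ t "{0<..<l}"])
          (use D[of t 2] True in \<open>auto simp: \<xi>_def numeral_2_eq_2 numeral_3_eq_3\<close>)
      then show ?thesis by (rule DERIV_isCont)
    next
      case False
      then have t: "t < d' \<or> l - d' < t" using d' by auto
      show ?thesis using zero_at[OF t \<xi>0] by (rule DERIV_isCont)
    qed
  qed
  have cont\<psi>: "continuous_on {0..l} \<psi>"
    using der\<psi> by (auto intro!: continuous_at_imp_continuous_on DERIV_isCont)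
  have const: "\<phi> t = \<phi> 0" if "t \<in> {0..<d'}" for t
  proof (cases "t = 0")
    case False
    then have "0 < t" using that by simp
    moreover have "continuous_on {0..t} \<phi>" using c\<phi> by (rule continuous_on_subset) (use that d' in auto)
    moreover have "\<phi> differentiable (at x)" if "0 < x" "x < t" for x
      using diff[of x 0] that \<open>t \<in> {0..<d'}\<close> d' by simp
    ultimately obtain L z where z: "0 < z" "z < t" "(\<phi> has_real_derivative L) (at z)" "\<phi> t - \<phi> 0 = (t - 0) * L"
      using MVT by blast
    then have "L = deriv \<phi> z" by (simp add: DERIV_imp_deriv)
    then show ?thesis using d(2)[of z] that d' z by auto
  qed auto
  have const': "\<phi> t = \<phi> l" if "t \<in> {l - d'<..l}" for t
  proof (cases "t = l")
    case False
    then have "t < l" using that by simp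
    moreover have "continuous_on {t..l} \<phi>" using c\<phi> by (rule continuous_on_subset) (use that d' in auto)
    moreover have "\<phi> differentiable (at x)" if "t < x" "x < l" for x
      using diff[of x 0] that \<open>t \<in> {l - d'<..l}\<close> d' by simp
    ultimately obtain L z where z: "t < z" "z < l" "(\<phi> has_real_derivative L) (at z)" "\<phi> l - \<phi> t = (l - t) * L"
      using MVT by blast
    then have "L = deriv \<phi> z" by (simp add: DERIV_imp_deriv)
    then show ?thesis using d(2)[of z] that d' z by auto
  qed auto
  have der\<phi>: "(\<phi> has_real_derivative \<psi> t) (at t within {0..l})" if t: "t \<in> {0..l}" for t
  proof (cases "0 < t \<and> t < l")
    case True
    then show ?thesis using D[of t 0] by (auto simp: \<psi>_def intro: has_field_derivative_at_within)
  next
    case False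
    then have "t = 0 \<or> t = l" using t by auto
    then show ?thesis
    proof
      assume t: "t = 0"
      have "(\<phi> has_real_derivative 0) (at 0 within {0..l})"
      proof (rule has_field_derivative_transform_within[OF DERIV_const d'(1)])
        show "0 \<in> {0..l}" using l by simp
        fix x assume "x \<in> {0..l}" "dist x 0 < d'"
        then have "x \<in> {0..<d'}" by (auto simp: dist_real_def)
        from const[OF this] show "\<phi> 0 = \<phi> x" by (rule sym)
      qed
      then show ?thesis using t \<psi>0[of 0] d' by simp
    next
      assume t: "t = l"
      have "(\<phi> has_real_derivative 0) (at l within {0..l})"
      proof (rule has_field_derivative_transform_within[OF DERIV_const d'(1)])
        show "l \<in> {0..l}" using l by simp
        fix x assume "x \<in> {0..l}" "dist x l < d'"
        then have "x \<in> {l - d'<..l}" by (auto simp: dist_real_def)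
        from const'[OF this] show "\<phi> l = \<phi> x" by (rule sym)
      qed
      then show ?thesis using t \<psi>0[of l] d' by simp
    qed
  qed
  define W where "W t = y' t * \<phi> t - y t * \<psi> t" for t
  have I: "((\<lambda>t. y t * (- \<xi> t + q t * \<phi> t)) has_integral (W l - W 0)) {0..l}"
  proof (rule abs_continuous_on_has_integral)
    show "abs_continuous_on W 0 l" unfolding W_def[abs_def]
      by (intro abs_continuous_on_diff abs_continuous_on_mult ode_solD(2)[OF sol] ode_sol_abs_continuous[OF sol]
          abs_continuous_on_C1[OF der\<phi> cont\<psi>] abs_continuous_on_C1[OF has_field_derivative_at_within[OF der\<psi>] cont\<xi>])
    have sp: "AE t in lebesgue_on {0..l}. t \<in> {0..l}" by (rule AE_I2) auto
    show "AE t in lebesgue_on {0..l}. (W has_real_derivative y t * (- \<xi> t + q t * \<phi> t)) (at t within {0..l})"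
      using ode_solD(3)[OF sol] sp unfolding W_def[abs_def]
      by eventually_elim (auto intro!: derivative_eq_intros ode_solD(1)[OF sol] der\<phi>
         has_field_derivative_at_within[OF der\<psi>] simp: algebra_simps)
  qed (use l in simp)
  have cy: "continuous_on {0..l} y" by (rule ode_sol_continuous(1)[OF sol])
  have "(\<lambda>t. - (y t * \<xi> t) + q t * (y t * \<phi> t)) absolutely_integrable_on {0..l}"
    by (intro set_integral_add(1) absolutely_integrable_continuous_real q_mult_integrable(2)[of _ l] continuous_intros cy cont\<xi> c\<phi>) simp
  then have A: "(\<lambda>t. y t * (- \<xi> t + q t * \<phi> t)) absolutely_integrable_on {0..l}"
    by (simp add: algebra_simps)
  have A': "(\<lambda>t. y t * (- \<xi> t + q t * \<phi> t)) absolutely_integrable_on {0<..<l}"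
    by (rule set_integrable_subset[OF A]) auto
  have eq: "y t * (- (deriv ^^ 2) \<phi> t + q t * \<phi> t) = y t * (- \<xi> t + q t * \<phi> t)" if "t \<in> {0<..<l}" for t
    using that by (simp add: \<xi>_def numeral_2_eq_2)
  show "set_integrable lebesgue {0<..<l} (\<lambda>t. y t * (- (deriv ^^ 2) \<phi> t + q t * \<phi> t))"
    using A' by (subst set_integrable_cong[OF refl refl eq]) auto
  have "(LINT t:{0<..<l}|lebesgue. y t * (- (deriv ^^ 2) \<phi> t + q t * \<phi> t))
      = (LINT t:{0<..<l}|lebesgue. y t * (- \<xi> t + q t * \<phi> t))"
    by (rule set_lebesgue_integral_cong) (use eq in auto)
  also have "\<dots> = integral {0<..<l} (\<lambda>t. y t * (- \<xi> t + q t * \<phi> t))"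
    by (rule set_lebesgue_integral_eq_integral(2)[OF A'])
  also have "\<dots> = W l - W 0"
    using I by (simp add: has_integral_Icc_iff_Ioo integral_unique)
  also have "\<dots> = y' l * \<phi> l - y' 0 * \<phi> 0"
    using \<psi>0[of 0] \<psi>0[of l] d' by (simp add: W_def)
  finally show "(LINT t:{0<..<l}|lebesgue. y t * (- (deriv ^^ 2) \<phi> t + q t * \<phi> t)) = y' l * \<phi> l - y' 0 * \<phi> 0" .
qed

end

section \<open>Energy forms of networks\<close>

locale network =
  fixes Es :: "('v \<times> 'v) set" and c k0 k1 :: "'v \<times> 'v \<Rightarrow> real"
  assumes c_pos: "e \<in> Es \<Longrightarrow> c e > 0" and k0: "e \<in> Es \<Longrightarrow> k0 e \<ge> 0" and k1: "e \<in> Es \<Longrightarrow> k1 e \<ge> 0"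
begin

text \<open>The Dirichlet form of an edge in terms of end values: with the coefficients of
  \<open>edge_basis\<close> it is the integral of \<open>u' w' + q u w\<close> for the edge solution
  \<open>u\<close> with the end values of \<open>f\<close> and any smooth \<open>w\<close> with
  those of \<open>g\<close>. The terms with \<open>k0\<close> and \<open>k1\<close> are the killing
  caused by \<open>q\<close>.\<close>

definition edge_form :: "'v \<times> 'v \<Rightarrow> ('v \<Rightarrow> real) \<Rightarrow> ('v \<Rightarrow> real) \<Rightarrow> real" where
  "edge_form e f g = c e * (f (snd e) - f (fst e)) * (g (snd e) - g (fst e))
     + k0 e * f (fst e) * g (fst e) + k1 e * f (snd e) * g (snd e)"

definition finite_energy :: "('v \<Rightarrow> real) \<Rightarrow> bool" where
  "finite_energy f \<longleftrightarrow> (\<lambda>e. edge_form e f f) summable_on Es"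

definition energy :: "('v \<Rightarrow> real) \<Rightarrow> ('v \<Rightarrow> real) \<Rightarrow> real" where
  "energy f g = (\<Sum>\<^sub>\<infinity>e\<in>Es. edge_form e f g)"

lemma edge_form_sym: "edge_form e f g = edge_form e g f"
  by (simp add: edge_form_def algebra_simps)

lemma edge_form_lin: "edge_form e (\<lambda>v. a * f v + b * g v) h = a * edge_form e f h + b * edge_form e g h"
  by (simp add: edge_form_def algebra_simps)

lemma edge_form_nonneg: "e \<in> Es \<Longrightarrow> edge_form e f f \<ge> 0"
  using c_pos[of e] k0[of e] k1[of e]
  by (simp add: edge_form_def mult.assoc zero_le_mult_iff add_nonneg_nonneg)

lemma edge_form_quad: "edge_form e (\<lambda>v. a * f v + b * g v) (\<lambda>v. a * f v + b * g v)
    = a\<^sup>2 * edge_form e f f + 2 * a * b * edge_form e f g + b\<^sup>2 * edge_form e g g"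
  by (simp add: edge_form_def algebra_simps power2_eq_square)

lemma edge_form_abs_le: "e \<in> Es \<Longrightarrow> \<bar>edge_form e f g\<bar> \<le> (edge_form e f f + edge_form e g g) / 2"
  using edge_form_nonneg[of e "\<lambda>v. 1 * f v + 1 * g v"] edge_form_nonneg[of e "\<lambda>v. 1 * f v + (-1) * g v"]
  unfolding edge_form_quad by auto

lemma summable_edge_form:
  assumes "finite_energy f" "finite_energy g"
  shows "(\<lambda>e. edge_form e f g) summable_on Es"
proof (rule abs_summable_summable)
  have "(\<lambda>e. (edge_form e f f + edge_form e g g) / 2) summable_on Es"
    using summable_on_cmult_right[OF summable_on_add[OF assms[unfolded finite_energy_def]], of "1/2"] by simp
  then show "(\<lambda>e. norm (edge_form e f g)) summable_on Es"
    by (rule summable_on_comparison_test) (use edge_form_abs_le in \<open>simp_all del: split_paired_all split_paired_All\<close>)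
qed

lemma finite_energy_lin:
  assumes "finite_energy f" "finite_energy g"
  shows "finite_energy (\<lambda>v. a * f v + b * g v)"
  unfolding finite_energy_def edge_form_quad
  using assms summable_edge_form[OF assms] unfolding finite_energy_def
  by (intro summable_on_add summable_on_cmult_right)

lemma energy_sym: "energy f g = energy g f"
  by (simp add: energy_def edge_form_sym[of _ f g])

lemma energy_lin:
  assumes "finite_energy f" "finite_energy g" "finite_energy h"
  shows "energy (\<lambda>v. a * f v + b * g v) h = a * energy f h + b * energy g h"
  unfolding energy_def edge_form_lin
  using summable_edge_form[OF assms(1,3)] summable_edge_form[OF assms(2,3)]
  by (simp add: infsum_add infsum_cmult_right' summable_on_cmult_right)

lemma energy_add:
  assumes "finite_energy f" "finite_energy g" "finite_energy h"
  shows "finite_energy (\<lambda>v. f v + g v)" "energy (\<lambda>v. f v + g v) h = energy f h + energy g h"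
    "energy h (\<lambda>v. f v + g v) = energy h f + energy h g"
  using finite_energy_lin[OF assms(1,2), of 1 1] energy_lin[OF assms, of 1 1] by (simp_all add: energy_sym[of h])

lemma energy_diff:
  assumes "finite_energy f" "finite_energy g" "finite_energy h"
  shows "finite_energy (\<lambda>v. f v - g v)" "energy (\<lambda>v. f v - g v) h = energy f h - energy g h"
    "energy h (\<lambda>v. f v - g v) = energy h f - energy h g"
  using finite_energy_lin[OF assms(1,2), of 1 "-1"] energy_lin[OF assms, of 1 "-1"] by (simp_all add: energy_sym[of h])

lemma energy_quad:
  assumes "finite_energy f" "finite_energy g"
  shows "energy (\<lambda>v. a * f v + b * g v) (\<lambda>v. a * f v + b * g v)
    = a\<^sup>2 * energy f f + 2 * a * b * energy f g + b\<^sup>2 * energy g g"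
  unfolding energy_def edge_form_quad
  using summable_edge_form[OF assms] assms[unfolded finite_energy_def]
  by (simp add: infsum_add infsum_cmult_right' summable_on_cmult_right summable_on_add)

lemma energy_nonneg: "energy f f \<ge> 0"
  unfolding energy_def by (intro infsum_nonneg edge_form_nonneg)

lemma energy_mono:
  assumes "finite_energy f" "\<And>e. e \<in> Es \<Longrightarrow> edge_form e f f \<le> E e" "E summable_on Es"
  shows "energy f f \<le> (\<Sum>\<^sub>\<infinity>e\<in>Es. E e)"
  unfolding energy_def using assms by (intro infsum_mono) (auto simp: finite_energy_def)

lemma finite_energyI:
  assumes "\<And>e. e \<in> Es \<Longrightarrow> edge_form e f f \<le> E e" "E summable_on Es"
  shows "finite_energy f"
  unfolding finite_energy_def
  by (rule summable_on_comparison_test[OF assms(2)]) (use assms(1) edge_form_nonneg in auto)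

text \<open>The discriminant argument is stated for plain numbers because it serves twice: for
  Cauchy-Schwarz, and with \<open>A\<close> the defect of a minimizing sequence, where it bounds the
  first variation.\<close>

lemma quadratic_nonneg_imp:
  fixes A B C :: real
  assumes "\<And>t. 0 \<le> A + 2 * t * B + t\<^sup>2 * C" "C \<ge> 0"
  shows "B\<^sup>2 \<le> A * C"
proof (cases "C = 0")
  case True
  have "A \<ge> 0" using assms(1)[of 0] by simp
  have "B = 0"
  proof (rule ccontr)
    assume "B \<noteq> 0"
    then show False using assms(1)[of "- (A + 1) / B"] True \<open>A \<ge> 0\<close> by simp
  qed
  then show ?thesis using True by simp
next
  case False
  then have "C > 0" using assms(2) by simp
  have "0 \<le> A - B\<^sup>2 / C" using assms(1)[of "- B / C"] False by (simp add: power2_eq_square field_simps)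
  then show ?thesis using \<open>C > 0\<close> by (simp add: field_simps)
qed

section \<open>Minimization and completeness\<close>

lemma energy_Cauchy_Schwarz:
  assumes "finite_energy f" "finite_energy g"
  shows "(energy f g)\<^sup>2 \<le> energy f f * energy g g"
proof (rule quadratic_nonneg_imp)
  fix t show "0 \<le> energy f f + 2 * t * energy f g + t\<^sup>2 * energy g g"
    using energy_nonneg[of "\<lambda>v. 1 * f v + t * g v"] energy_quad[OF assms, of 1 t] by simp
qed (rule energy_nonneg)

text \<open>The parallelogram law makes a minimizing sequence in \<open>\<Phi> + D\<close> Cauchy in energy.\<close>

lemma dirichlet_principle:
  assumes fin: "\<And>g. g \<in> D \<Longrightarrow> finite_energy g" and zero: "(\<lambda>_. 0) \<in> D"
    and lin: "\<And>f g a b. f \<in> D \<Longrightarrow> g \<in> D \<Longrightarrow> (\<lambda>v. a * f v + b * g v) \<in> D"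
    and complete: "\<And>g :: nat \<Rightarrow> 'v \<Rightarrow> real. (\<And>n. g n \<in> D) \<Longrightarrow>
      (\<And>\<epsilon>. \<epsilon> > 0 \<Longrightarrow> \<exists>N. \<forall>m\<ge>N. \<forall>n\<ge>N. energy (\<lambda>v. g m v - g n v) (\<lambda>v. g m v - g n v) < \<epsilon>) \<Longrightarrow>
      \<exists>h\<in>D. (\<lambda>n. energy (\<lambda>v. h v - g n v) (\<lambda>v. h v - g n v)) \<longlonglongrightarrow> 0"
    and \<Phi>: "finite_energy \<Phi>"
  shows "\<exists>f. (\<lambda>v. f v - \<Phi> v) \<in> D \<and> finite_energy f \<and> (\<forall>\<psi>\<in>D. energy f \<psi> = 0)"
proof -
  define J where "J g = energy (\<lambda>v. 1 * \<Phi> v + 1 * g v) (\<lambda>v. 1 * \<Phi> v + 1 * g v)" for g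
  define m where "m = Inf (J ` D)"
  have bdd: "bdd_below (J ` D)" unfolding J_def by (intro bdd_belowI2[of _ 0] energy_nonneg)
  have mle: "m \<le> J g" if "g \<in> D" for g unfolding m_def using bdd that by (intro cInf_lower) auto
  define w where "w n = 1 / (real n + 1)" for n
  have "\<exists>g\<in>D. J g < m + w n" for n
    using cInf_lessD[of "J ` D" "m + w n"] zero by (auto simp: m_def w_def)
  then obtain g where g: "\<And>n. g n \<in> D" "\<And>n. J (g n) < m + w n" by metis
  have Jexp: "J h = energy \<Phi> \<Phi> + 2 * energy \<Phi> h + energy h h" if "h \<in> D" for h
    unfolding J_def using energy_quad[OF \<Phi> fin[OF that], of 1 1] by simp
  \<comment> \<open>The midpoint of \<open>g i\<close> and \<open>g j\<close> lies in
    \<open>D\<close> and so cannot have a value below \<open>m\<close>; what remains of the identity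
    is at most twice the sum of the two defects.\<close>
  have par: "energy (\<lambda>v. g i v - g j v) (\<lambda>v. g i v - g j v) \<le> 2 * (w i + w j)" for i j
  proof -
    have fi: "finite_energy (g i)" "finite_energy (g j)" using fin g by auto
    have mid: "(\<lambda>v. 1/2 * g i v + 1/2 * g j v) \<in> D" using lin[OF g(1) g(1)] by blast
    have q: "(1/2 :: real)\<^sup>2 = 1/4" by (simp add: power2_eq_square)
    have e1: "J (\<lambda>v. 1/2 * g i v + 1/2 * g j v) = energy \<Phi> \<Phi> + energy \<Phi> (g i) + energy \<Phi> (g j)
      + (energy (g i) (g i) + 2 * energy (g i) (g j) + energy (g j) (g j)) / 4"
      unfolding Jexp[OF mid] energy_quad[OF fi] energy_sym[of \<Phi> "\<lambda>v. 1/2 * g i v + 1/2 * g j v"] energy_lin[OF fi \<Phi>]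
      unfolding energy_sym[of "g i" \<Phi>] energy_sym[of "g j" \<Phi>] q by argo
    have e2: "energy (\<lambda>v. g i v - g j v) (\<lambda>v. g i v - g j v) = energy (g i) (g i) - 2 * energy (g i) (g j) + energy (g j) (g j)"
      using energy_quad[OF fi, of 1 "-1"] by simp
    show ?thesis
      using mle[OF mid] g(2)[of i] g(2)[of j] unfolding e1 e2 Jexp[OF g(1)] by argo
  qed
  have "\<exists>N. \<forall>i\<ge>N. \<forall>j\<ge>N. energy (\<lambda>v. g i v - g j v) (\<lambda>v. g i v - g j v) < \<epsilon>" if "\<epsilon> > 0" for \<epsilon>
  proof -
    obtain N :: nat where N: "4 / \<epsilon> < real N" using reals_Archimedean2 by blast
    show ?thesis
    proof (intro exI[of _ N] allI impI)
      fix i j assume ij: "i \<ge> N" "j \<ge> N"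
      have h: "w n < \<epsilon> / 4" if "n \<ge> N" for n
      proof -
        have "4 / \<epsilon> < real n + 1" using N that by linarith
        then show ?thesis using \<open>\<epsilon> > 0\<close> by (simp add: w_def field_simps)
      qed
      show "energy (\<lambda>v. g i v - g j v) (\<lambda>v. g i v - g j v) < \<epsilon>"
        using par[of i j] h[OF ij(1)] h[OF ij(2)] by argo
    qed
  qed
  from complete[OF g(1) this] obtain h where h: "h \<in> D"
    "(\<lambda>n. energy (\<lambda>v. h v - g n v) (\<lambda>v. h v - g n v)) \<longlonglongrightarrow> 0" by blast
  define f where "f = (\<lambda>v. \<Phi> v + h v)"
  have finf: "finite_energy f" unfolding f_def using energy_add(1)[OF \<Phi> fin[OF h(1)] \<Phi>] .
  have "energy f \<psi> = 0" if \<psi>: "\<psi> \<in> D" for \<psi>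
  proof -
    have f\<psi>: "finite_energy \<psi>" using fin \<psi> by blast
    define b where "b n = energy (\<lambda>v. 1 * \<Phi> v + 1 * g n v) \<psi>" for n
    have fg: "finite_energy (\<lambda>v. 1 * \<Phi> v + 1 * g n v)" for n by (rule finite_energy_lin[OF \<Phi> fin[OF g(1)]])
    \<comment> \<open>\<open>g n\<close> minimizes only up to \<open>w n\<close>, so the quadratic
      polynomial in \<open>t\<close> becomes nonnegative once \<open>w n\<close> is its constant
      term; the first variation \<open>b n\<close> is then of the order of the square root of
      \<open>w n\<close>.\<close>
    have b: "(b n)\<^sup>2 \<le> w n * energy \<psi> \<psi>" for n
    proof (rule quadratic_nonneg_imp)
      fix t :: real
      have "(\<lambda>v. 1 * g n v + t * \<psi> v) \<in> D" by (rule lin[OF g(1) \<psi>])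
      then have "m \<le> J (\<lambda>v. 1 * g n v + t * \<psi> v)" by (rule mle)
      also have "\<dots> = energy (\<lambda>v. 1 * (1 * \<Phi> v + 1 * g n v) + t * \<psi> v) (\<lambda>v. 1 * (1 * \<Phi> v + 1 * g n v) + t * \<psi> v)"
        by (simp add: J_def add.assoc)
      also have "\<dots> = J (g n) + 2 * t * b n + t\<^sup>2 * energy \<psi> \<psi>"
        unfolding energy_quad[OF fg f\<psi>] b_def J_def by simp
      finally show "0 \<le> w n + 2 * t * b n + t\<^sup>2 * energy \<psi> \<psi>" using g(2)[of n] by linarith
    qed (rule energy_nonneg)
    define d where "d n = energy (\<lambda>v. h v - g n v) \<psi>" for n
    have d: "(d n)\<^sup>2 \<le> energy (\<lambda>v. h v - g n v) (\<lambda>v. h v - g n v) * energy \<psi> \<psi>" for n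
      unfolding d_def
      by (rule energy_Cauchy_Schwarz[OF energy_diff(1)[OF fin[OF h(1)] fin[OF g(1)] \<Phi>] f\<psi>])
    \<comment> \<open>The left side is independent of \<open>n\<close>, while on the right
      \<open>b n\<close> tends to \<open>0\<close> by near minimality and \<open>d n\<close> by
      Cauchy-Schwarz.\<close>
    have sum: "energy f \<psi> = b n + d n" for n
    proof -
      have "energy f \<psi> = energy \<Phi> \<psi> + energy h \<psi>"
        unfolding f_def by (rule energy_add(2)[OF \<Phi> fin[OF h(1)] f\<psi>])
      moreover have "b n = energy \<Phi> \<psi> + energy (g n) \<psi>"
        unfolding b_def energy_lin[OF \<Phi> fin[OF g(1)] f\<psi>] by simp
      moreover have "d n = energy h \<psi> - energy (g n) \<psi>"
        unfolding d_def by (rule energy_diff(2)[OF fin[OF h(1)] fin[OF g(1)] f\<psi>])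
      ultimately show ?thesis by simp
    qed
    have lim: "x \<longlonglongrightarrow> 0" if "\<And>n. (x n)\<^sup>2 \<le> y n" "y \<longlonglongrightarrow> 0" for x y :: "nat \<Rightarrow> real"
    proof -
      have "(\<lambda>n. (x n)\<^sup>2) \<longlonglongrightarrow> 0"
        by (rule tendsto_sandwich[OF _ _ tendsto_const that(2)]) (use that(1) in auto)
      from tendsto_real_sqrt[OF this] show ?thesis by (simp add: tendsto_rabs_zero_iff)
    qed
    have l1: "(\<lambda>n. w n * energy \<psi> \<psi>) \<longlonglongrightarrow> 0"
      using tendsto_mult_left_zero[OF LIMSEQ_inverse_real_of_nat, of "energy \<psi> \<psi>"]
      by (simp add: w_def inverse_eq_divide add.commute)
    have "(\<lambda>n. b n + d n) \<longlonglongrightarrow> 0 + 0"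
      by (intro tendsto_add lim[OF b l1] lim[OF d] tendsto_mult_left_zero h(2))
    then have "(\<lambda>n::nat. energy f \<psi>) \<longlonglongrightarrow> 0" unfolding sum[symmetric] by simp
    then show ?thesis using LIMSEQ_unique tendsto_const by blast
  qed
  moreover have "(\<lambda>v. f v - \<Phi> v) \<in> D" using h(1) by (simp add: f_def)
  ultimately show ?thesis using finf by blast
qed

text \<open>Vanishing on the boundary, seen from the vertices: \<open>Z\<close> will be the set of
  leaves, and the finiteness condition, decay along the vertices, stands for the value
  \<open>0\<close> at the points added by the completion.\<close>

definition dirichlet_space :: "'v set \<Rightarrow> 'v set \<Rightarrow> ('v \<Rightarrow> real) set" where
  "dirichlet_space V Z = {g. finite_energy g \<and> (\<forall>\<epsilon>>0. finite {v \<in> V. \<epsilon> \<le> \<bar>g v\<bar>}) \<and> (\<forall>v\<in>Z. g v = 0)}"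

lemma dirichlet_space_lin:
  assumes f: "f \<in> dirichlet_space V Z" and g: "g \<in> dirichlet_space V Z"
  shows "(\<lambda>v. a * f v + b * g v) \<in> dirichlet_space V Z"
proof -
  have "finite {v \<in> V. \<epsilon> \<le> \<bar>a * f v + b * g v\<bar>}" if "\<epsilon> > 0" for \<epsilon>
  proof -
    define M where "M = \<bar>a\<bar> + \<bar>b\<bar> + 1"
    have M: "M > 0" by (simp add: M_def)
    have "{v \<in> V. \<epsilon> \<le> \<bar>a * f v + b * g v\<bar>} \<subseteq> {v \<in> V. \<epsilon> / M \<le> \<bar>f v\<bar>} \<union> {v \<in> V. \<epsilon> / M \<le> \<bar>g v\<bar>}"
    proof (rule ccontr)
      assume "\<not> ?thesis"
      then obtain v where v: "\<epsilon> \<le> \<bar>a * f v + b * g v\<bar>" "\<bar>f v\<bar> < \<epsilon> / M" "\<bar>g v\<bar> < \<epsilon> / M" by force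
      have "\<bar>a * f v + b * g v\<bar> \<le> \<bar>a\<bar> * \<bar>f v\<bar> + \<bar>b\<bar> * \<bar>g v\<bar>"
        by (metis abs_mult abs_triangle_ineq)
      also have "\<dots> \<le> \<bar>a\<bar> * (\<epsilon> / M) + \<bar>b\<bar> * (\<epsilon> / M)" using v by (intro add_mono mult_left_mono) auto
      also have "\<dots> = (\<bar>a\<bar> + \<bar>b\<bar>) * (\<epsilon> / M)" by (rule distrib_right[symmetric])
      also have "\<dots> < M * (\<epsilon> / M)" using that M by (intro mult_strict_right_mono) (auto simp: M_def)
      also have "\<dots> = \<epsilon>" using M by simp
      finally show False using v by simp
    qed
    moreover have "finite \<dots>" using f g that M by (auto simp: dirichlet_space_def)
    ultimately show ?thesis by (rule finite_subset)
  qed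
  then show ?thesis using f g finite_energy_lin by (auto simp: dirichlet_space_def)
qed

text \<open>The Poincare inequality turns Cauchy in energy into uniformly Cauchy on
  \<open>V\<close>, so a limit exists that keeps the decay condition and the zeros. Convergence in
  energy follows by lower semicontinuity over finite sets of edges.\<close>

lemma dirichlet_space_complete:
  assumes EV: "Es \<subseteq> V \<times> V" and ZV: "Z \<subseteq> V"
    and poincare: "\<And>g v. g \<in> dirichlet_space V Z \<Longrightarrow> v \<in> V \<Longrightarrow> (g v)\<^sup>2 \<le> C * energy g g"
    and g: "\<And>n. g n \<in> dirichlet_space V Z"
    and Cauchy: "\<And>\<epsilon>. \<epsilon> > 0 \<Longrightarrow> \<exists>N. \<forall>m\<ge>N. \<forall>n\<ge>N. energy (\<lambda>v. g m v - g n v) (\<lambda>v. g m v - g n v) < \<epsilon>"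
  shows "\<exists>h\<in>dirichlet_space V Z. (\<lambda>n. energy (\<lambda>v. h v - g n v) (\<lambda>v. h v - g n v)) \<longlonglongrightarrow> 0"
proof -
  have diff: "(\<lambda>v. g i v - g j v) \<in> dirichlet_space V Z" for i j
    using dirichlet_space_lin[OF g g, of 1 i "-1" j] by simp
  have unif: "\<exists>N. \<forall>i\<ge>N. \<forall>j\<ge>N. \<forall>v\<in>V. \<bar>g i v - g j v\<bar> < \<epsilon>" if "\<epsilon> > 0" for \<epsilon>
  proof -
    have e: "\<epsilon>\<^sup>2 / (\<bar>C\<bar> + 1) > 0" using that by (simp add: zero_less_divide_iff)
    from Cauchy[OF e] obtain N where N: "\<forall>i\<ge>N. \<forall>j\<ge>N. energy (\<lambda>v. g i v - g j v) (\<lambda>v. g i v - g j v) < \<epsilon>\<^sup>2 / (\<bar>C\<bar> + 1)"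
      by blast
    show ?thesis
    proof (intro exI[of _ N] allI impI ballI)
      fix i j v assume ij: "i \<ge> N" "j \<ge> N" "v \<in> V"
      have "(g i v - g j v)\<^sup>2 \<le> C * energy (\<lambda>v. g i v - g j v) (\<lambda>v. g i v - g j v)"
        by (rule poincare[OF diff ij(3)])
      also have "\<dots> \<le> (\<bar>C\<bar> + 1) * energy (\<lambda>v. g i v - g j v) (\<lambda>v. g i v - g j v)"
        by (intro mult_right_mono energy_nonneg) simp
      also have "\<dots> < (\<bar>C\<bar> + 1) * (\<epsilon>\<^sup>2 / (\<bar>C\<bar> + 1))"
        using N ij by (intro mult_strict_left_mono) auto
      also have "\<dots> = \<epsilon>\<^sup>2" by simp
      finally show "\<bar>g i v - g j v\<bar> < \<epsilon>"
        using power2_less_imp_less[of "\<bar>g i v - g j v\<bar>" \<epsilon>] that by simp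
    qed
  qed
  have "Cauchy (\<lambda>n. g n v)" if "v \<in> V" for v
    unfolding Cauchy_def dist_real_def using unif that by blast
  then have conv: "convergent (\<lambda>n. g n v)" if "v \<in> V" for v using that by (simp add: Cauchy_convergent_iff)
  define h where "h v = lim (\<lambda>n. g n v)" for v
  have h: "(\<lambda>n. g n v) \<longlonglongrightarrow> h v" if "v \<in> V" for v
    unfolding h_def using conv[OF that] by (simp add: convergent_LIMSEQ_iff)
  have close: "\<exists>N. \<forall>i\<ge>N. \<forall>v\<in>V. \<bar>g i v - h v\<bar> \<le> \<epsilon>" if "\<epsilon> > 0" for \<epsilon>
  proof -
    obtain N where N: "\<forall>i\<ge>N. \<forall>j\<ge>N. \<forall>v\<in>V. \<bar>g i v - g j v\<bar> < \<epsilon>" using unif[OF \<open>\<epsilon> > 0\<close>] by blast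
    have "\<bar>g i v - h v\<bar> \<le> \<epsilon>" if "i \<ge> N" "v \<in> V" for i v
    proof (rule tendsto_upperbound[OF _ _ sequentially_bot])
      show "(\<lambda>j. \<bar>g i v - g j v\<bar>) \<longlonglongrightarrow> \<bar>g i v - h v\<bar>" using h[OF that(2)] by (intro tendsto_intros)
      show "\<forall>\<^sub>F j in sequentially. \<bar>g i v - g j v\<bar> \<le> \<epsilon>"
        using eventually_ge_at_top[of N] by eventually_elim (use N that in \<open>auto intro: less_imp_le\<close>)
    qed
    then show ?thesis by blast
  qed
  have fin: "finite_energy (g n)" for n using g by (auto simp: dirichlet_space_def)
  have ed: "\<exists>N. \<forall>n\<ge>N. finite_energy (\<lambda>v. h v - g n v) \<and> energy (\<lambda>v. h v - g n v) (\<lambda>v. h v - g n v) \<le> \<epsilon>"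
    if "\<epsilon> > 0" for \<epsilon>
  proof -
    obtain N where N: "\<forall>i\<ge>N. \<forall>j\<ge>N. energy (\<lambda>v. g i v - g j v) (\<lambda>v. g i v - g j v) < \<epsilon>"
      using Cauchy[OF \<open>\<epsilon> > 0\<close>] by blast
    show ?thesis
    proof (intro exI[of _ N] allI impI)
      fix n assume n: "n \<ge> N"
      \<comment> \<open>On finitely many edges the form is continuous in the vertex values, so the
        bound for \<open>g i - g n\<close> survives the limit in \<open>i\<close>. Bounded finite
        sums of nonnegative terms then give summability and the same bound for the whole
        sum.\<close>
      have fs: "(\<Sum>e\<in>F. edge_form e (\<lambda>v. h v - g n v) (\<lambda>v. h v - g n v)) \<le> \<epsilon>" if F: "finite F" "F \<subseteq> Es" for F
      proof (rule tendsto_upperbound[OF _ _ sequentially_bot])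
        show "(\<lambda>i. \<Sum>e\<in>F. edge_form e (\<lambda>v. g i v - g n v) (\<lambda>v. g i v - g n v))
          \<longlonglongrightarrow> (\<Sum>e\<in>F. edge_form e (\<lambda>v. h v - g n v) (\<lambda>v. h v - g n v))"
        proof (rule tendsto_sum)
          fix e assume "e \<in> F"
          then have "fst e \<in> V" "snd e \<in> V" using F EV by auto
          then show "(\<lambda>i. edge_form e (\<lambda>v. g i v - g n v) (\<lambda>v. g i v - g n v))
            \<longlonglongrightarrow> edge_form e (\<lambda>v. h v - g n v) (\<lambda>v. h v - g n v)"
            unfolding edge_form_def by (intro tendsto_intros h)
        qed
        show "\<forall>\<^sub>F i in sequentially. (\<Sum>e\<in>F. edge_form e (\<lambda>v. g i v - g n v) (\<lambda>v. g i v - g n v)) \<le> \<epsilon>"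
          using eventually_ge_at_top[of N]
        proof eventually_elim
          case (elim i)
          have "(\<Sum>e\<in>F. edge_form e (\<lambda>v. g i v - g n v) (\<lambda>v. g i v - g n v))
              \<le> energy (\<lambda>v. g i v - g n v) (\<lambda>v. g i v - g n v)"
            unfolding energy_def using F energy_diff(1)[OF fin fin fin, of i n]
            by (intro finite_sum_le_infsum) (auto simp: finite_energy_def edge_form_nonneg)
          then show ?case using N elim n by (meson less_imp_le order_trans)
        qed
      qed
      have S: "(\<lambda>e. edge_form e (\<lambda>v. h v - g n v) (\<lambda>v. h v - g n v)) summable_on Es"
        by (rule nonneg_bdd_above_summable_on) (use fs in \<open>auto intro!: bdd_aboveI2[of _ _ \<epsilon>] edge_form_nonneg\<close>)
      moreover have "energy (\<lambda>v. h v - g n v) (\<lambda>v. h v - g n v) \<le> \<epsilon>"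
        unfolding energy_def by (rule infsum_le_finite_sums[OF S fs])
      ultimately show "finite_energy (\<lambda>v. h v - g n v) \<and> energy (\<lambda>v. h v - g n v) (\<lambda>v. h v - g n v) \<le> \<epsilon>"
        by (simp add: finite_energy_def)
    qed
  qed
  have "finite_energy h"
  proof -
    obtain N where "finite_energy (\<lambda>v. h v - g N v)" using ed[OF zero_less_one] by blast
    from energy_add(1)[OF this fin fin, of N] show ?thesis by simp
  qed
  moreover have "finite {v \<in> V. \<epsilon> \<le> \<bar>h v\<bar>}" if "\<epsilon> > 0" for \<epsilon>
  proof -
    obtain N where N: "\<forall>i\<ge>N. \<forall>v\<in>V. \<bar>g i v - h v\<bar> \<le> \<epsilon> / 2" using close[OF half_gt_zero[OF \<open>\<epsilon> > 0\<close>]] by blast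
    have "\<epsilon> / 2 \<le> \<bar>g N v\<bar>" if "v \<in> V" "\<epsilon> \<le> \<bar>h v\<bar>" for v
    proof -
      have "\<bar>g N v - h v\<bar> \<le> \<epsilon> / 2" using N that(1) by blast
      moreover have "\<bar>h v\<bar> \<le> \<bar>g N v - h v\<bar> + \<bar>g N v\<bar>" by linarith
      ultimately show ?thesis using that(2) by argo
    qed
    then have "{v \<in> V. \<epsilon> \<le> \<bar>h v\<bar>} \<subseteq> {v \<in> V. \<epsilon> / 2 \<le> \<bar>g N v\<bar>}" by blast
    moreover have "finite {v \<in> V. \<epsilon> / 2 \<le> \<bar>g N v\<bar>}"
      using g[of N] half_gt_zero[OF \<open>\<epsilon> > 0\<close>] unfolding dirichlet_space_def by blast
    ultimately show ?thesis by (rule finite_subset)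
  qed
  moreover have "h v = 0" if "v \<in> Z" for v
  proof -
    have "g n v = 0" for n using g[of n] that by (auto simp: dirichlet_space_def)
    then show ?thesis using h[of v] that ZV LIMSEQ_unique[OF _ tendsto_const] by auto
  qed
  ultimately have "h \<in> dirichlet_space V Z" by (auto simp: dirichlet_space_def)
  moreover have "(\<lambda>n. energy (\<lambda>v. h v - g n v) (\<lambda>v. h v - g n v)) \<longlonglongrightarrow> 0"
  proof (rule LIMSEQ_I)
    fix r :: real assume "r > 0"
    then obtain N where "\<forall>n\<ge>N. energy (\<lambda>v. h v - g n v) (\<lambda>v. h v - g n v) \<le> r / 2" using ed[of "r/2"] by auto
    then show "\<exists>N. \<forall>n\<ge>N. norm (energy (\<lambda>v. h v - g n v) (\<lambda>v. h v - g n v) - 0) < r"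
      using \<open>r > 0\<close> energy_nonneg by (intro exI[of _ N]) (force simp: )
  qed
  ultimately show ?thesis by blast
qed

text \<open>Truncating \<open>f\<close> from above by \<open>1 - s \<Phi>\<close> costs only \<open>O(s\<^sup>2)\<close> energy, while the energy is
  stationary at \<open>f\<close>; the first order term is \<open>2 s\<close> times \<open>energy f \<Phi>\<close>.\<close>

lemma energy_nonneg_of_truncation:
  assumes f: "finite_energy f" and \<Phi>: "finite_energy \<Phi>" and "s0 > 0"
    and le: "\<And>s e. 0 < s \<Longrightarrow> s < s0 \<Longrightarrow> e \<in> Es \<Longrightarrow> s * \<Phi> (fst e) \<le> 1 \<and> s * \<Phi> (snd e) \<le> 1"
    and orth: "\<And>s. 0 < s \<Longrightarrow> s < s0 \<Longrightarrow> finite_energy (\<lambda>v. min (s * \<Phi> v) (1 - f v)) \<Longrightarrow>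
       energy f (\<lambda>v. min (s * \<Phi> v) (1 - f v)) = 0"
  shows "energy f \<Phi> \<ge> 0"
proof -
  have key: "energy f \<Phi> \<ge> - (s * energy \<Phi> \<Phi>) / 2" if s: "0 < s" "s < s0" for s
  proof -
    define g where "g v = min (f v) (1 - s * \<Phi> v)" for v
    have eb: "edge_form e g g \<le> edge_form e f f + s\<^sup>2 * edge_form e \<Phi> \<Phi>" if e: "e \<in> Es" for e
    proof -
      let ?a = "fst e" and ?b = "snd e"
      \<comment> \<open>A minimum changes by at most the larger of the two changes, so squared
        increments add up without a cross term.\<close>
      have "(g ?b - g ?a)\<^sup>2 \<le> (f ?b - f ?a)\<^sup>2 + (s * (\<Phi> ?b - \<Phi> ?a))\<^sup>2"
      proof -
        have "\<bar>g ?b - g ?a\<bar> \<le> max \<bar>f ?b - f ?a\<bar> \<bar>s * (\<Phi> ?b - \<Phi> ?a)\<bar>"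
          by (auto simp: g_def min_def max_def right_diff_distrib)
        then have "(g ?b - g ?a)\<^sup>2 \<le> (max \<bar>f ?b - f ?a\<bar> \<bar>s * (\<Phi> ?b - \<Phi> ?a)\<bar>)\<^sup>2"
          by (metis abs_ge_zero power2_abs power_mono)
        also have "\<dots> \<le> (f ?b - f ?a)\<^sup>2 + (s * (\<Phi> ?b - \<Phi> ?a))\<^sup>2" by (simp add: max_def)
        finally show ?thesis .
      qed
      then have "c e * (g ?b - g ?a)\<^sup>2 \<le> c e * ((f ?b - f ?a)\<^sup>2 + (s * (\<Phi> ?b - \<Phi> ?a))\<^sup>2)"
        using c_pos[OF e] by (intro mult_left_mono) auto
      \<comment> \<open>Where the truncation acts, \<open>g v = 1 - s * \<Phi> v\<close> lies
        between \<open>0\<close> and \<open>f v\<close>; the bound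
        \<open>s * \<Phi> v \<le> 1\<close> secures the sign, without which the square could
        grow.\<close>
      moreover have sq: "(g v)\<^sup>2 \<le> (f v)\<^sup>2 + (s * \<Phi> v)\<^sup>2" if "s * \<Phi> v \<le> 1" for v
      proof (cases "f v \<le> 1 - s * \<Phi> v")
        case False
        then have "(1 - s * \<Phi> v)\<^sup>2 \<le> (f v)\<^sup>2" using that by (intro power_mono) auto
        then show ?thesis using False by (simp add: g_def min_def add_increasing2)
      qed (simp add: g_def min_def)
      have "k0 e * (g ?a)\<^sup>2 \<le> k0 e * ((f ?a)\<^sup>2 + (s * \<Phi> ?a)\<^sup>2)" "k1 e * (g ?b)\<^sup>2 \<le> k1 e * ((f ?b)\<^sup>2 + (s * \<Phi> ?b)\<^sup>2)"
        using k0[OF e] k1[OF e] sq le[OF s e] by (auto intro!: mult_left_mono)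
      ultimately show ?thesis
        by (simp add: edge_form_def power2_eq_square algebra_simps)
    qed
    have sm: "(\<lambda>e. edge_form e f f + s\<^sup>2 * edge_form e \<Phi> \<Phi>) summable_on Es"
      using f \<Phi> by (intro summable_on_add summable_on_cmult_right) (auto simp: finite_energy_def)
    have g: "finite_energy g" by (rule finite_energyI[OF eb sm])
    have "energy g g \<le> (\<Sum>\<^sub>\<infinity>e\<in>Es. edge_form e f f + s\<^sup>2 * edge_form e \<Phi> \<Phi>)"
      by (rule energy_mono[OF g eb sm])
    also have "\<dots> = energy f f + s\<^sup>2 * energy \<Phi> \<Phi>"
      using f \<Phi> unfolding energy_def finite_energy_def
      by (subst infsum_add) (auto intro!: summable_on_cmult_right infsum_cmult_right)
    finally have gg: "energy g g \<le> energy f f + s\<^sup>2 * energy \<Phi> \<Phi>" .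
    define \<psi> where "\<psi> v = min (s * \<Phi> v) (1 - f v)" for v
    have g_eq: "g = (\<lambda>v. 1 * (1 * f v + (- s) * \<Phi> v) + 1 * \<psi> v)" by (auto simp: g_def \<psi>_def min_def)
    have \<psi>_eq: "\<psi> = (\<lambda>v. 1 * (1 * g v + (-1) * f v) + s * \<Phi> v)" by (auto simp: g_def \<psi>_def min_def)
    have f1: "finite_energy (\<lambda>v. 1 * f v + (- s) * \<Phi> v)" by (rule finite_energy_lin[OF f \<Phi>])
    have f\<psi>: "finite_energy \<psi>" unfolding \<psi>_eq by (intro finite_energy_lin f \<Phi> g)
    have "energy f \<psi> = 0" using orth[OF s] f\<psi> unfolding \<psi>_def[abs_def] by blast
    then have "energy \<psi> f = 0" by (simp add: energy_sym)
    \<comment> \<open>\<open>g\<close> is \<open>f - s \<Phi>\<close> up to the test function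
      \<open>\<psi>\<close>, so orthogonality evaluates \<open>energy g f\<close>. Expanding the
      nonnegative energy of \<open>g - f\<close> and inserting the bound on
      \<open>energy g g\<close> leaves one term of order \<open>s\<close> and one of order
      \<open>s^2\<close>.\<close>
    then have "energy g f = energy f f - s * energy \<Phi> f"
      unfolding g_eq energy_lin[OF f1 f\<psi> f] energy_lin[OF f \<Phi> f] by simp
    moreover have "0 \<le> energy g g - 2 * energy g f + energy f f"
      using energy_nonneg[of "\<lambda>v. 1 * g v + (-1) * f v"] energy_quad[OF g f, of 1 "-1"] by simp
    ultimately have "0 \<le> s\<^sup>2 * energy \<Phi> \<Phi> + 2 * s * energy f \<Phi>" using gg by (simp add: energy_sym[of \<Phi> f])
    then have "0 \<le> s * (s * energy \<Phi> \<Phi> + 2 * energy f \<Phi>)" by (simp add: algebra_simps power2_eq_square)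
    then have "0 \<le> s * energy \<Phi> \<Phi> + 2 * energy f \<Phi>" using s by (simp add: zero_le_mult_iff)
    then show ?thesis by simp
  qed
  show ?thesis
  proof (rule tendsto_upperbound)
    show "((\<lambda>s. - (s * energy \<Phi> \<Phi>) / 2) \<longlongrightarrow> 0) (at_right 0)" by (auto intro!: tendsto_eq_intros)
    show "\<forall>\<^sub>F s in at_right 0. - (s * energy \<Phi> \<Phi>) / 2 \<le> energy f \<Phi>"
      using key \<open>s0 > 0\<close> by (auto simp: eventually_at_right_field intro!: exI[of _ s0])
  qed auto
qed

text \<open>Dual to the preceding argument, with \<open>f\<close> raised to
  \<open>max f (s \<Phi>)\<close>: the square of a maximum is at most the sum of the squares, and
  \<open>min f (s \<Phi>)\<close> is the test function by which this maximum falls short of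
  \<open>f + s \<Phi>\<close>.\<close>

lemma energy_nonpos_of_truncation:
  assumes f: "finite_energy f" and \<Phi>: "finite_energy \<Phi>"
    and orth: "\<And>s. 0 < s \<Longrightarrow> finite_energy (\<lambda>v. min (f v) (s * \<Phi> v)) \<Longrightarrow>
       energy f (\<lambda>v. min (f v) (s * \<Phi> v)) = 0"
  shows "energy f \<Phi> \<le> 0"
proof -
  have key: "energy f \<Phi> \<le> (s * energy \<Phi> \<Phi>) / 2" if s: "0 < s" for s
  proof -
    define g where "g v = max (f v) (s * \<Phi> v)" for v
    have eb: "edge_form e g g \<le> edge_form e f f + s\<^sup>2 * edge_form e \<Phi> \<Phi>" if e: "e \<in> Es" for e
    proof -
      let ?a = "fst e" and ?b = "snd e"
      have "(g ?b - g ?a)\<^sup>2 \<le> (f ?b - f ?a)\<^sup>2 + (s * (\<Phi> ?b - \<Phi> ?a))\<^sup>2"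
      proof -
        have "\<bar>g ?b - g ?a\<bar> \<le> max \<bar>f ?b - f ?a\<bar> \<bar>s * (\<Phi> ?b - \<Phi> ?a)\<bar>"
          by (auto simp: g_def max_def right_diff_distrib)
        then have "(g ?b - g ?a)\<^sup>2 \<le> (max \<bar>f ?b - f ?a\<bar> \<bar>s * (\<Phi> ?b - \<Phi> ?a)\<bar>)\<^sup>2"
          by (metis abs_ge_zero power2_abs power_mono)
        also have "\<dots> \<le> (f ?b - f ?a)\<^sup>2 + (s * (\<Phi> ?b - \<Phi> ?a))\<^sup>2" by (simp add: max_def)
        finally show ?thesis .
      qed
      then have "c e * (g ?b - g ?a)\<^sup>2 \<le> c e * ((f ?b - f ?a)\<^sup>2 + (s * (\<Phi> ?b - \<Phi> ?a))\<^sup>2)"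
        using c_pos[OF e] by (intro mult_left_mono) auto
      moreover have sq: "(g v)\<^sup>2 \<le> (f v)\<^sup>2 + (s * \<Phi> v)\<^sup>2" for v
        by (simp add: g_def max_def)
      have "k0 e * (g ?a)\<^sup>2 \<le> k0 e * ((f ?a)\<^sup>2 + (s * \<Phi> ?a)\<^sup>2)" "k1 e * (g ?b)\<^sup>2 \<le> k1 e * ((f ?b)\<^sup>2 + (s * \<Phi> ?b)\<^sup>2)"
        using k0[OF e] k1[OF e] sq by (auto intro!: mult_left_mono)
      ultimately show ?thesis
        by (simp add: edge_form_def power2_eq_square algebra_simps)
    qed
    have sm: "(\<lambda>e. edge_form e f f + s\<^sup>2 * edge_form e \<Phi> \<Phi>) summable_on Es"
      using f \<Phi> by (intro summable_on_add summable_on_cmult_right) (auto simp: finite_energy_def)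
    have g: "finite_energy g" by (rule finite_energyI[OF eb sm])
    have "energy g g \<le> (\<Sum>\<^sub>\<infinity>e\<in>Es. edge_form e f f + s\<^sup>2 * edge_form e \<Phi> \<Phi>)"
      by (rule energy_mono[OF g eb sm])
    also have "\<dots> = energy f f + s\<^sup>2 * energy \<Phi> \<Phi>"
      using f \<Phi> unfolding energy_def finite_energy_def
      by (subst infsum_add) (auto intro!: summable_on_cmult_right infsum_cmult_right)
    finally have gg: "energy g g \<le> energy f f + s\<^sup>2 * energy \<Phi> \<Phi>" .
    define \<psi> where "\<psi> v = min (f v) (s * \<Phi> v)" for v
    have g_eq: "g = (\<lambda>v. 1 * (1 * f v + s * \<Phi> v) + (-1) * \<psi> v)" by (auto simp: g_def \<psi>_def min_def max_def)
    have \<psi>_eq: "\<psi> = (\<lambda>v. 1 * (1 * f v + s * \<Phi> v) + (-1) * g v)" by (auto simp: g_def \<psi>_def min_def max_def)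
    have f1: "finite_energy (\<lambda>v. 1 * f v + s * \<Phi> v)" by (rule finite_energy_lin[OF f \<Phi>])
    have f\<psi>: "finite_energy \<psi>" unfolding \<psi>_eq by (intro finite_energy_lin f \<Phi> g)
    have "energy f \<psi> = 0" using orth[OF s] f\<psi> unfolding \<psi>_def[abs_def] by blast
    then have "energy \<psi> f = 0" by (simp add: energy_sym)
    then have "energy g f = energy f f + s * energy \<Phi> f"
      unfolding g_eq energy_lin[OF f1 f\<psi> f] energy_lin[OF f \<Phi> f] by simp
    moreover have "0 \<le> energy g g - 2 * energy g f + energy f f"
      using energy_nonneg[of "\<lambda>v. 1 * g v + (-1) * f v"] energy_quad[OF g f, of 1 "-1"] by simp
    ultimately have "0 \<le> s\<^sup>2 * energy \<Phi> \<Phi> - 2 * s * energy f \<Phi>" using gg by (simp add: energy_sym[of \<Phi> f])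
    then have "0 \<le> s * (s * energy \<Phi> \<Phi> - 2 * energy f \<Phi>)" by (simp add: algebra_simps power2_eq_square)
    then have "0 \<le> s * energy \<Phi> \<Phi> - 2 * energy f \<Phi>" using s by (simp add: zero_le_mult_iff)
    then show ?thesis by simp
  qed
  show ?thesis
  proof (rule tendsto_lowerbound)
    show "((\<lambda>s. (s * energy \<Phi> \<Phi>) / 2) \<longlongrightarrow> 0) (at_right 0)" by (auto intro!: tendsto_eq_intros)
    show "\<forall>\<^sub>F s in at_right 0. energy f \<Phi> \<le> (s * energy \<Phi> \<Phi>) / 2"
      using key by (auto simp: eventually_at_right_field intro!: exI[of _ 1])
  qed auto
qed

end

section \<open>Finitely additive functions on clopen sets\<close>

text \<open>Compactness is used twice: the clopen sets around a point of \<open>P\<close> have no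
  common point in \<open>K - T\<close>, so finitely many of them already have none; and finitely
  many of the resulting clopen neighbourhoods cover \<open>P\<close>.\<close>

lemma compact_subset_clopen:
  fixes K :: "'p::metric_space set"
  assumes K: "compact K"
    and sep: "\<And>x y. x \<in> K \<Longrightarrow> y \<in> K \<Longrightarrow> x \<noteq> y \<Longrightarrow> \<exists>E. clopen_in K E \<and> x \<in> E \<and> y \<notin> E"
    and P: "compact P" "P \<subseteq> K" and O': "open T" "P \<subseteq> T"
  shows "\<exists>C. clopen_in K C \<and> P \<subseteq> C \<and> C \<subseteq> T"
proof -
  have closed: "closed E" if "clopen_in K E" for E
    using that K by (auto simp: clopen_in_def closedin_closed_eq compact_imp_closed)
  have clopen_Inter: "clopen_in K (K \<inter> \<Inter>F)" if "finite F" "\<And>E. E \<in> F \<Longrightarrow> clopen_in K E" for F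
    using that
  proof (induction F rule: finite_induct)
    case (insert E F)
    then have "clopen_in K (E \<inter> (K \<inter> \<Inter>F))" by (auto simp: clopen_in_def)
    then show ?case by (simp add: Int_ac)
  qed (simp add: clopen_in_def)
  have clopen_Union: "clopen_in K (\<Union>F)" if "finite F" "\<And>E. E \<in> F \<Longrightarrow> clopen_in K E" for F
    using that by (auto simp: clopen_in_def intro!: closedin_Union)
  have KT: "compact (K - T)" using K O' by (simp add: compact_diff)
  have "\<exists>C. clopen_in K C \<and> x \<in> C \<and> C \<subseteq> T" if x: "x \<in> P" for x
  proof -
    define F where "F = {E. clopen_in K E \<and> x \<in> E}"
    have "(K - T) \<inter> \<Inter>F = {}"
    proof (rule ccontr)
      assume "(K - T) \<inter> \<Inter>F \<noteq> {}"
      then obtain y where y: "y \<in> K - T" "y \<in> \<Inter>F" by blast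
      then have "x \<noteq> y" "x \<in> K" using x O' P by auto
      with sep[of x y] y show False by (auto simp: F_def)
    qed
    then obtain F' where F': "finite F'" "F' \<subseteq> F" "(K - T) \<inter> \<Inter>F' = {}"
      using compact_imp_fip[OF KT, of F] closed by (auto simp: F_def)
    then show ?thesis using x P clopen_Inter[of F']
      by (intro exI[of _ "K \<inter> \<Inter>F'"]) (auto simp: F_def)
  qed
  then obtain C where C: "\<And>x. x \<in> P \<Longrightarrow> clopen_in K (C x) \<and> x \<in> C x \<and> C x \<subseteq> T" by metis
  have "\<exists>U. open U \<and> C x = K \<inter> U" if "x \<in> P" for x
    using C[OF that] by (auto simp: clopen_in_def openin_open)
  then obtain U where U: "\<And>x. x \<in> P \<Longrightarrow> open (U x) \<and> C x = K \<inter> U x" by metis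
  have op: "\<And>x. x \<in> P \<Longrightarrow> open (U x)" and cov: "P \<subseteq> (\<Union>x\<in>P. U x)" using U C by blast+
  obtain X where X: "X \<subseteq> P" "finite X" "P \<subseteq> (\<Union>x\<in>X. U x)"
    using compactE_image[OF P(1) op cov] by blast
  have "clopen_in K (\<Union>(C ` X))" by (rule clopen_Union) (use X C in auto)
  moreover have "P \<subseteq> \<Union>(C ` X)" using X P U by blast
  moreover have "\<Union>(C ` X) \<subseteq> T" using X C by blast
  ultimately show ?thesis by blast
qed

text \<open>Countable additivity on clopen sets is automatic by compactness, and the clopen sets
  generate the Borel sets, so Caratheodory's theorem applies.\<close>

lemma clopen_measure_extension:
  fixes K :: "'p::metric_space set" and m :: "'p set \<Rightarrow> real"
  assumes K: "compact K"
    and sep: "\<And>x y. x \<in> K \<Longrightarrow> y \<in> K \<Longrightarrow> x \<noteq> y \<Longrightarrow> \<exists>E. clopen_in K E \<and> x \<in> E \<and> y \<notin> E"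
    and nonneg: "\<And>E. clopen_in K E \<Longrightarrow> m E \<ge> 0"
    and add: "\<And>E F. clopen_in K E \<Longrightarrow> clopen_in K F \<Longrightarrow> E \<inter> F = {} \<Longrightarrow> m (E \<union> F) = m E + m F"
  shows "\<exists>\<mu>. finite_measure \<mu> \<and> sets \<mu> = sets (restrict_space borel K) \<and>
    (\<forall>E. clopen_in K E \<longrightarrow> measure \<mu> E = m E)"
proof -
  define A where "A = {E. clopen_in K E}"
  have sub: "E \<subseteq> K" and closed: "closed E" if "clopen_in K E" for E
    using that K by (auto simp: clopen_in_def closedin_closed_eq compact_imp_closed dest: openin_imp_subset)
  have "algebra K A"
    unfolding algebra_iff_Un
  proof (intro conjI ballI)
    show "A \<subseteq> Pow K" using sub by (auto simp: A_def)
    show "{} \<in> A" by (simp add: A_def clopen_in_def)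
    show "K - a \<in> A" if "a \<in> A" for a
      using that unfolding A_def clopen_in_def by (auto intro: openin_diff closedin_diff)
    show "a \<union> b \<in> A" if "a \<in> A" "b \<in> A" for a b
      using that unfolding A_def clopen_in_def by auto
  qed
  then interpret algebra K A .
  have m0: "m {} = 0" using add[of "{}" "{}"] by (simp add: clopen_in_def)
  have "\<exists>\<mu>::'p set \<Rightarrow> ennreal. (\<forall>s\<in>A. \<mu> s = ennreal (m s)) \<and> measure_space K (sigma_sets K A) \<mu>"
  proof (rule caratheodory_empty_continuous)
    show "positive A (\<lambda>E. ennreal (m E))" using m0 by (simp add: positive_def)
    show "additive A (\<lambda>E. ennreal (m E))"
      unfolding additive_def using add nonneg by (auto simp: A_def ennreal_plus)
    show "(\<lambda>i. ennreal (m (E i))) \<longlonglongrightarrow> 0" if E: "range E \<subseteq> A" "decseq E" "(\<Inter>i. E i) = {}" for E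
    proof -
      \<comment> \<open>Clopen subsets of \<open>K\<close> are closed, so a decreasing sequence with
        empty intersection reaches the empty set; continuity at the empty set is then
        immediate.\<close>
      have "\<exists>i. E i = {}"
      proof (rule ccontr)
        assume ne: "\<not> ?thesis"
        have "K \<inter> \<Inter>(range E) \<noteq> {}"
        proof (rule compact_imp_fip[OF K])
          show "closed T" if "T \<in> range E" for T using that E(1) closed by (auto simp: A_def)
          fix F' assume "finite F'" "F' \<subseteq> range E"
          then obtain J where J: "finite J" "F' = E ` J" by (meson finite_subset_image)
          define n where "n = Max (insert 0 J)"
          have "E n \<subseteq> E j" if "j \<in> J" for j
          proof -
            have "j \<le> n" using J(1) that by (simp add: n_def)
            then show ?thesis using E(2) by (simp add: decseq_def)
          qed
          moreover have "E n \<subseteq> K" using E(1) sub by (auto simp: A_def)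
          ultimately have "E n \<subseteq> K \<inter> \<Inter>F'" using J by blast
          then show "K \<inter> \<Inter>F' \<noteq> {}" using ne by blast
        qed
        then show False using E(3) by blast
      qed
      then obtain i where i: "E i = {}" by blast
      have "\<forall>\<^sub>F j in sequentially. ennreal (m (E j)) = 0"
        using eventually_ge_at_top[of i]
      proof eventually_elim
        case (elim j)
        then have "E j = {}" using E(2) i by (auto simp: decseq_def)
        then show ?case by (simp add: m0)
      qed
      then show ?thesis by (rule tendsto_eventually)
    qed
  qed auto
  then obtain \<mu> where \<mu>: "\<forall>s\<in>A. \<mu> s = ennreal (m s)" "measure_space K (sigma_sets K A) \<mu>" by blast
  define M where "M = measure_of K A \<mu>"
  have AP: "A \<subseteq> Pow K" using sub by (auto simp: A_def)
  have setsM: "sets M = sigma_sets K A" and spaceM: "space M = K"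
    unfolding M_def using AP by auto
  have emM: "emeasure M E = ennreal (m E)" if "E \<in> A" for E
    unfolding M_def
    by (subst emeasure_measure_of[OF refl AP]) (use \<mu> that AP in \<open>auto simp: measure_space_def\<close>)
  have "sets M = sets (restrict_space borel K)"
  proof (rule antisym)
    show "sets M \<subseteq> sets (restrict_space borel K)"
    proof -
      have "K \<inter> E \<in> sets (restrict_space borel K)" if "E \<in> A" for E
        unfolding sets_restrict_space using closed that by (intro imageI borel_closed) (auto simp: A_def)
      then have "A \<subseteq> sets (restrict_space borel K)"
        using AP by (metis Int_absorb1 Pow_iff subset_eq)
      then show ?thesis unfolding setsM
        using sets.sigma_sets_subset[of A "restrict_space borel K"] by (simp add: space_restrict_space)
    qed
    have "(\<lambda>x. x) \<in> measurable M borel"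
    proof (rule borel_measurableI)
      fix T :: "'p set" assume T: "open T"
      \<comment> \<open>The compact sets \<open>P n\<close> exhaust \<open>T \<inter> K\<close>; a
        clopen set squeezed between \<open>P n\<close> and \<open>T\<close> for every
        \<open>n\<close> makes \<open>T \<inter> K\<close> a countable union of clopen sets.\<close>
      define P where "P n = {x \<in> K. \<forall>y\<in>K - T. 1 / (real n + 1) \<le> dist x y}" for n :: nat
      have "\<exists>C. clopen_in K C \<and> P n \<subseteq> C \<and> C \<subseteq> T" for n
      proof (rule compact_subset_clopen[OF K sep _ _ T])
        have "P n = K \<inter> (\<Inter>y\<in>K - T. {x. 1 / (real n + 1) \<le> dist x y})" by (auto simp: P_def)
        moreover have "closed (\<Inter>y\<in>K - T. {x. 1 / (real n + 1) \<le> dist x y})"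
          by (intro closed_INT ballI closed_Collect_le continuous_intros)
        ultimately show "compact (P n)" using K by (simp add: compact_Int_closed)
        show "P n \<subseteq> K" by (auto simp: P_def)
        show "P n \<subseteq> T"
        proof
          fix x assume x: "x \<in> P n"
          show "x \<in> T"
          proof (rule ccontr)
            assume "x \<notin> T"
            then have "x \<in> K - T" using x by (simp add: P_def)
            then have "1 / (real n + 1) \<le> dist x x" using x unfolding P_def by blast
            then show False by (simp add: field_simps)
          qed
        qed
      qed auto
      then obtain C where C: "\<And>n. clopen_in K (C n) \<and> P n \<subseteq> C n \<and> C n \<subseteq> T" by metis
      have "T \<inter> K = (\<Union>n. C n)"
      proof
        show "(\<Union>n. C n) \<subseteq> T \<inter> K" using C sub by blast
        show "T \<inter> K \<subseteq> (\<Union>n. C n)"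
        proof
          fix x assume x: "x \<in> T \<inter> K"
          then obtain r where r: "r > 0" "ball x r \<subseteq> T" using T open_contains_ball by blast
          obtain n :: nat where n: "1 / (real n + 1) < r"
            using reals_Archimedean[OF \<open>r > 0\<close>] by (auto simp: inverse_eq_divide add.commute)
          have "r \<le> dist x y" if "y \<in> K - T" for y
            using r(2) that by (force simp: not_less[symmetric])
          then have "x \<in> P n" using x n unfolding P_def by force
          then show "x \<in> (\<Union>n. C n)" using C by blast
        qed
      qed
      moreover have "C n \<in> sets M" for n unfolding setsM using C by (auto simp: A_def)
      ultimately show "(\<lambda>x. x) -` T \<inter> space M \<in> sets M" by (simp add: spaceM)
    qed
    then show "sets (restrict_space borel K) \<subseteq> sets M"
      by (auto simp: sets_restrict_space spaceM Int_commute dest: measurable_sets)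
  qed
  moreover have "finite_measure M"
  proof (rule finite_measureI)
    have "K \<in> A" by (simp add: A_def clopen_in_def)
    from emM[OF this] show "emeasure M (space M) \<noteq> \<infinity>" by (simp add: spaceM)
  qed
  moreover have "measure M E = m E" if "clopen_in K E" for E
    using emM[of E] nonneg[OF that] that by (simp add: A_def measure_def)
  ultimately show ?thesis by blast
qed

section \<open>The metric completion of a graph\<close>

declare split_paired_All [simp del] split_paired_Ex [simp del]

locale metric_graph_completion =
  fixes G :: "'v metric_graph" and \<iota> :: "'v point \<Rightarrow> 'p::complete_space"
  assumes graph: "is_metric_graph G" and conn: "graph_connected G"
    and completion: "is_completion G \<iota>" and compact_UNIV: "compact (UNIV :: 'p set)"
begin

section \<open>Points, paths and the graph distance\<close>

lemma edgeD:
  assumes "e \<in> edges G"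
  shows "fst e \<in> verts G" "snd e \<in> verts G" "fst e \<noteq> snd e" "len G e > 0"
  using graph assms by (cases e; auto simp: is_metric_graph_def)+

lemma finite_incident: "v \<in> verts G \<Longrightarrow> finite (incident G v)"
  using graph by (auto simp: is_metric_graph_def)

lemma edge_point_simps:
  assumes "e \<in> edges G"
  shows "edge_point G e 0 = Vertex (fst e)" "edge_point G e (len G e) = Vertex (snd e)"
    "0 < t \<Longrightarrow> t < len G e \<Longrightarrow> edge_point G e t = Inner e t"
  using edgeD[OF assms] by (auto simp: edge_point_def)

lemma edge_point_in: "e \<in> edges G \<Longrightarrow> edge_point G e t \<in> points G"
  using edgeD[of e] by (auto simp: edge_point_def points_def)

lemma pointsE:
  assumes "x \<in> points G"
  obtains v where "v \<in> verts G" "x = Vertex v"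
  | e t where "e \<in> edges G" "0 < t" "t < len G e" "x = Inner e t"
  using assms unfolding points_def by blast

lemma Vertex_in: "v \<in> verts G \<Longrightarrow> Vertex v \<in> points G"
  by (simp add: points_def)

lemma path_length_nonneg: "path_length G x r y \<Longrightarrow> r \<ge> 0"
  by (induction rule: path_length.induct) auto

lemma path_length_lipschitz:
  assumes "path_length G x r y"
    and "\<And>e s t. e \<in> edges G \<Longrightarrow> s \<in> {0..len G e} \<Longrightarrow> t \<in> {0..len G e} \<Longrightarrow>
      \<bar>g (edge_point G e s) - g (edge_point G e t)\<bar> \<le> \<bar>s - t\<bar>"
  shows "\<bar>g x - g y\<bar> \<le> r"
  using assms(1)
proof (induction rule: path_length.induct)
  case (extend x r e s t)
  have "\<bar>g (edge_point G e s) - g (edge_point G e t)\<bar> \<le> \<bar>s - t\<bar>" by (rule assms(2)) (use extend in auto)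
  then show ?case using extend.IH by linarith
qed simp

text \<open>Lower bounds for an infimum over all paths come from test functions: if \<open>g\<close>
  is 1-Lipschitz on each closed edge, no path can be shorter than the difference of its end
  values.\<close>

lemma graph_dist_ge:
  assumes "x \<in> points G" "y \<in> points G"
    and "\<And>e s t. e \<in> edges G \<Longrightarrow> s \<in> {0..len G e} \<Longrightarrow> t \<in> {0..len G e} \<Longrightarrow>
      \<bar>g (edge_point G e s) - g (edge_point G e t)\<bar> \<le> \<bar>s - t\<bar>"
  shows "\<bar>g x - g y\<bar> \<le> graph_dist G x y"
  unfolding graph_dist_def
proof (rule cInf_greatest)
  show "{r. path_length G x r y} \<noteq> {}" using conn assms(1,2) by (auto simp: graph_connected_def)
qed (use path_length_lipschitz[OF _ assms(3)] in auto)

lemma graph_dist_le: "path_length G x r y \<Longrightarrow> graph_dist G x y \<le> r"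
  unfolding graph_dist_def by (rule cInf_lower) (auto intro!: bdd_belowI[of _ 0] path_length_nonneg)

lemma dist_eq: "x \<in> points G \<Longrightarrow> y \<in> points G \<Longrightarrow> dist (\<iota> x) (\<iota> y) = graph_dist G x y"
  using completion by (auto simp: is_completion_def)

lemma dist_edge_point:
  assumes "e \<in> edges G" "s \<in> {0..len G e}" "t \<in> {0..len G e}"
  shows "dist (\<iota> (edge_point G e s)) (\<iota> (edge_point G e t)) \<le> \<bar>s - t\<bar>"
proof -
  have "path_length G (edge_point G e s) (0 + \<bar>t - s\<bar>) (edge_point G e t)"
    by (intro path_length.extend path_length.trivial edge_point_in assms)
  from graph_dist_le[OF this] show ?thesis
    using assms(1) by (simp add: dist_eq edge_point_in abs_minus_commute)
qed

lemma continuous_on_edge: "e \<in> edges G \<Longrightarrow> continuous_on {0..len G e} (\<lambda>t. \<iota> (edge_point G e t))"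
  unfolding continuous_on_iff
proof (intro ballI allI impI)
  fix s \<epsilon> :: real assume e: "e \<in> edges G" and s: "s \<in> {0..len G e}" and "\<epsilon> > 0"
  show "\<exists>d>0. \<forall>t\<in>{0..len G e}. dist t s < d \<longrightarrow> dist (\<iota> (edge_point G e t)) (\<iota> (edge_point G e s)) < \<epsilon>"
    using dist_edge_point[OF e _ s] \<open>\<epsilon> > 0\<close> by (intro exI[of _ \<epsilon>]) (force simp: dist_real_def)
qed

section \<open>Neighbourhoods of graph points in the completion\<close>

definition closed_edge :: "'v edge \<Rightarrow> 'p set" where
  "closed_edge e = (\<lambda>t. \<iota> (edge_point G e t)) ` {0..len G e}"

lemma compact_closed_edge: "e \<in> edges G \<Longrightarrow> compact (closed_edge e)"
  unfolding closed_edge_def by (intro compact_continuous_image continuous_on_edge) auto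

lemma closed_closed_edge: "e \<in> edges G \<Longrightarrow> closed (closed_edge e)"
  by (rule compact_imp_closed[OF compact_closed_edge])

lemma Inner_in_closed_edge:
  "e \<in> edges G \<Longrightarrow> 0 < s \<Longrightarrow> s < len G e \<Longrightarrow> \<iota> (Inner e s) \<in> closed_edge e"
  unfolding closed_edge_def by (rule image_eqI[of _ _ s]) (simp_all add: edge_point_simps(3))

lemma closed_edge_cases:
  "e \<in> edges G \<Longrightarrow> y \<in> closed_edge e \<Longrightarrow> \<exists>x\<in>points G. y = \<iota> x"
  using edge_point_in unfolding closed_edge_def by blast

text \<open>Local finiteness gives a positive radius not exceeding any incident length. The test
  function is the distance to \<open>v\<close> along the incident edges cut off at
  \<open>\<rho>\<close>; it has the value \<open>\<rho>\<close> at every other vertex and so fits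
  together with the constant \<open>\<rho>\<close> on the remaining edges.\<close>

lemma vertex_ball:
  assumes v: "v \<in> verts G"
  shows "\<exists>\<rho>>0. \<forall>x\<in>points G. graph_dist G (Vertex v) x < \<rho> \<longrightarrow> x = Vertex v \<or>
    (\<exists>e s. e \<in> incident G v \<and> x = Inner e s \<and> 0 < s \<and> s < len G e \<and>
       (fst e = v \<and> s \<le> graph_dist G (Vertex v) x \<or> snd e = v \<and> len G e - s \<le> graph_dist G (Vertex v) x))"
proof -
  \<comment> \<open>The entry \<open>1\<close> keeps the minimum meaningful for a vertex without
    incident edges.\<close>
  define \<rho> where "\<rho> = Min (insert 1 (len G ` incident G v))"
  have fin: "finite (insert 1 (len G ` incident G v))" using finite_incident[OF v] by simp
  have inc: "e \<in> edges G" if "e \<in> incident G v" for e using that by (auto simp: incident_def)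
  have \<rho>: "\<rho> > 0" unfolding \<rho>_def using fin inc edgeD(4) by (subst Min_gr_iff) auto
  have \<rho>_le: "\<rho> \<le> len G e" if "e \<in> incident G v" for e
    unfolding \<rho>_def using fin that by (intro Min_le) auto
  define g where "g x = (case x of Vertex w \<Rightarrow> if w = v then 0 else \<rho> |
     Inner e s \<Rightarrow> if fst e = v then min s \<rho> else if snd e = v then min (len G e - s) \<rho> else \<rho>)" for x
  have on: "g (edge_point G e t) = (if fst e = v then min t \<rho> else if snd e = v then min (len G e - t) \<rho> else \<rho>)"
    if "e \<in> edges G" "t \<in> {0..len G e}" for e t
    using that edgeD[of e] \<rho> \<rho>_le[of e] by (auto simp: g_def edge_point_def incident_def)
  have lip: "\<bar>g (edge_point G e s) - g (edge_point G e t)\<bar> \<le> \<bar>s - t\<bar>"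
    if "e \<in> edges G" "s \<in> {0..len G e}" "t \<in> {0..len G e}" for e s t
    unfolding on[OF that(1,2)] on[OF that(1,3)] by auto
  show ?thesis
  proof (intro exI[of _ \<rho>] conjI ballI impI \<rho>)
    fix x assume x: "x \<in> points G" "graph_dist G (Vertex v) x < \<rho>"
    have "\<bar>g (Vertex v) - g x\<bar> \<le> graph_dist G (Vertex v) x"
      by (rule graph_dist_ge[OF Vertex_in[OF v] x(1) lip])
    then have gx: "\<bar>g x\<bar> \<le> graph_dist G (Vertex v) x" by (simp add: g_def)
    show "x = Vertex v \<or>
    (\<exists>e s. e \<in> incident G v \<and> x = Inner e s \<and> 0 < s \<and> s < len G e \<and>
       (fst e = v \<and> s \<le> graph_dist G (Vertex v) x \<or> snd e = v \<and> len G e - s \<le> graph_dist G (Vertex v) x))"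
      using x(1)
    proof (cases rule: pointsE)
      case (1 w)
      then show ?thesis using gx x(2) by (auto simp: g_def split: if_splits)
    next
      case (2 e t)
      then show ?thesis using gx x(2) by (auto simp: g_def incident_def split: if_splits)
    qed
  qed
qed

lemma inner_ball:
  assumes e0: "e0 \<in> edges G" "0 < t0" "t0 < len G e0"
  shows "\<exists>\<rho>>0. \<forall>x\<in>points G. graph_dist G (Inner e0 t0) x < \<rho> \<longrightarrow>
    (\<exists>s. x = Inner e0 s \<and> 0 < s \<and> s < len G e0 \<and> \<bar>s - t0\<bar> \<le> graph_dist G (Inner e0 t0) x)"
proof -
  define \<rho> where "\<rho> = min t0 (len G e0 - t0)"
  have \<rho>: "\<rho> > 0" "\<rho> \<le> t0" "\<rho> \<le> len G e0 - t0" using e0 by (auto simp: \<rho>_def)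
  define g where "g x = (case x of Vertex w \<Rightarrow> \<rho> | Inner e s \<Rightarrow> if e = e0 then min \<bar>s - t0\<bar> \<rho> else \<rho>)" for x :: "'v point"
  have on: "g (edge_point G e t) = (if e = e0 then min \<bar>t - t0\<bar> \<rho> else \<rho>)"
    if "e \<in> edges G" "t \<in> {0..len G e}" for e t
    using that \<rho> e0 by (auto simp: g_def edge_point_def)
  have lip: "\<bar>g (edge_point G e s) - g (edge_point G e t)\<bar> \<le> \<bar>s - t\<bar>"
    if "e \<in> edges G" "s \<in> {0..len G e}" "t \<in> {0..len G e}" for e s t
    unfolding on[OF that(1,2)] on[OF that(1,3)] by auto
  have p: "Inner e0 t0 \<in> points G" using e0 by (auto simp: points_def)
  show ?thesis
  proof (rule exI[of _ \<rho>], intro conjI ballI impI \<rho>(1))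
    fix x assume x: "x \<in> points G" "graph_dist G (Inner e0 t0) x < \<rho>"
    have "\<bar>g (Inner e0 t0) - g x\<bar> \<le> graph_dist G (Inner e0 t0) x"
      by (rule graph_dist_ge[OF p x(1) lip])
    then have gx: "\<bar>g x\<bar> \<le> graph_dist G (Inner e0 t0) x" using \<rho> by (simp add: g_def)
    show "\<exists>s. x = Inner e0 s \<and> 0 < s \<and> s < len G e0 \<and> \<bar>s - t0\<bar> \<le> graph_dist G (Inner e0 t0) x"
      using x(1)
    proof (cases rule: pointsE)
      case (1 w)
      then show ?thesis using gx x(2) by (auto simp: g_def split: if_splits)
    next
      case (2 e t)
      then show ?thesis using gx x(2) by (auto simp: g_def split: if_splits)
    qed
  qed
qed

lemma iota_inj:
  assumes "x \<in> points G" "y \<in> points G" "\<iota> x = \<iota> y"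
  shows "x = y"
proof -
  have d: "graph_dist G x y = 0" using dist_eq[OF assms(1,2)] assms(3) by simp
  show ?thesis using assms(1)
  proof (cases rule: pointsE)
    case (1 v)
    then show ?thesis using vertex_ball[OF 1(1)] assms(2) d by force
  next
    case (2 e t)
    then show ?thesis using inner_ball[OF 2(1-3)] assms(2) d by force
  qed
qed

lemma point_ball:
  assumes "p \<in> points G"
  shows "\<exists>\<rho>>0. \<exists>F. finite F \<and> F \<subseteq> edges G \<and> (\<forall>x\<in>points G. graph_dist G p x < \<rho> \<longrightarrow>
     x = p \<or> (\<exists>e\<in>F. \<exists>s. 0 < s \<and> s < len G e \<and> x = Inner e s))"
  using assms
proof (cases rule: pointsE)
  case (1 v)
  obtain \<rho> where \<rho>: "\<rho> > 0" "\<forall>x\<in>points G. graph_dist G (Vertex v) x < \<rho> \<longrightarrow> x = Vertex v \<or>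
    (\<exists>e s. e \<in> incident G v \<and> x = Inner e s \<and> 0 < s \<and> s < len G e \<and>
       (fst e = v \<and> s \<le> graph_dist G (Vertex v) x \<or> snd e = v \<and> len G e - s \<le> graph_dist G (Vertex v) x))"
    using vertex_ball[OF 1(1)] by blast
  have "finite (incident G v)" "incident G v \<subseteq> edges G" using finite_incident[OF 1(1)] by (auto simp: incident_def)
  then show ?thesis using \<rho> 1(2) by (intro exI[of _ \<rho>] conjI exI[of _ "incident G v"]) blast+
next
  case (2 e t)
  obtain \<rho> where "\<rho> > 0" "\<forall>x\<in>points G. graph_dist G (Inner e t) x < \<rho> \<longrightarrow>
    (\<exists>s. x = Inner e s \<and> 0 < s \<and> s < len G e \<and> \<bar>s - t\<bar> \<le> graph_dist G (Inner e t) x)"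
    using inner_ball[OF 2(1-3)] by blast
  then show ?thesis using 2 by (intro exI[of _ \<rho>] conjI exI[of _ "{e}"]) auto
qed

text \<open>The completion adds nothing near a graph point: the graph points close to
  \<open>p\<close> are \<open>p\<close> itself or lie on finitely many closed edges, and this union
  is compact, hence contains its limits.\<close>

lemma local_structure:
  assumes p: "p \<in> points G"
  obtains \<rho> F where "\<rho> > 0" "finite F" "F \<subseteq> edges G"
    "\<And>y. dist (\<iota> p) y < \<rho> \<Longrightarrow> \<exists>x\<in>points G. y = \<iota> x \<and> (x = p \<or> (\<exists>e\<in>F. \<exists>s. 0 < s \<and> s < len G e \<and> x = Inner e s))"
proof -
  obtain \<rho> F where \<rho>: "\<rho> > 0" and F: "finite F" "F \<subseteq> edges G" and
    st': "\<forall>x\<in>points G. graph_dist G p x < \<rho> \<longrightarrow>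
     x = p \<or> (\<exists>e\<in>F. \<exists>s. 0 < s \<and> s < len G e \<and> x = Inner e s)"
    using point_ball[OF p] by blast
  have st: "x = p \<or> (\<exists>e\<in>F. \<exists>s. 0 < s \<and> s < len G e \<and> x = Inner e s)"
    if "x \<in> points G" "graph_dist G p x < \<rho>" for x
    using st' that by blast
  have "\<exists>x\<in>points G. y = \<iota> x \<and> (x = p \<or> (\<exists>e\<in>F. \<exists>s. 0 < s \<and> s < len G e \<and> x = Inner e s))"
    if y: "dist (\<iota> p) y < \<rho>" for y
  proof -
    define C where "C = insert (\<iota> p) (\<Union>e\<in>F. closed_edge e)"
    have "compact C" unfolding C_def using F compact_closed_edge by (intro compact_insert compact_UN) auto
    have "y \<in> closure (\<iota> ` points G \<inter> ball (\<iota> p) \<rho>)"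
    proof -
      have "y \<in> closure (\<iota> ` points G)" using completion by (auto simp: is_completion_def)
      moreover have "y \<in> ball (\<iota> p) \<rho>" using y by simp
      ultimately show ?thesis
        using open_Int_closure_subset[OF open_ball, of "\<iota> p" \<rho> "\<iota> ` points G"] by (auto simp: Int_commute)
    qed
    moreover have "\<iota> ` points G \<inter> ball (\<iota> p) \<rho> \<subseteq> C"
    proof clarsimp
      fix x assume x: "x \<in> points G" "dist (\<iota> p) (\<iota> x) < \<rho>"
      then have "x = p \<or> (\<exists>e\<in>F. \<exists>s. 0 < s \<and> s < len G e \<and> x = Inner e s)"
        using st dist_eq[OF p x(1)] by simp
      then show "\<iota> x \<in> C"
      proof (elim disjE bexE exE conjE)
        fix e s assume e: "e \<in> F" "0 < s" "s < len G e" "x = Inner e s"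
        then have "\<iota> x \<in> closed_edge e" using F(2) Inner_in_closed_edge[of e s] by blast
        then show "\<iota> x \<in> C" using e(1) unfolding C_def by blast
      qed (simp add: C_def)
    qed
    ultimately have "y \<in> C" using \<open>compact C\<close> compact_imp_closed closure_minimal by blast
    then have "\<exists>x\<in>points G. y = \<iota> x"
      using p F(2) closed_edge_cases unfolding C_def by blast
    then obtain x where x: "x \<in> points G" "y = \<iota> x" by blast
    then show ?thesis using st[OF x(1)] y dist_eq[OF p x(1)] by auto
  qed
  with that[OF \<rho> F] show thesis by blast
qed

section \<open>The boundary\<close>

lemma bdry_cases:
  "x \<in> points G \<Longrightarrow> \<iota> x \<in> bdry G \<iota> \<longleftrightarrow> (\<exists>v\<in>verts G. degree G v = 1 \<and> x = Vertex v)"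
  using iota_inj Vertex_in by (auto simp: bdry_def)

lemma not_point_bdry: "y \<notin> \<iota> ` points G \<Longrightarrow> y \<in> bdry G \<iota>"
  by (auto simp: bdry_def)

lemma closed_bdry: "closed (bdry G \<iota>)"
proof -
  have "open (- bdry G \<iota>)"
    unfolding open_dist
  proof (intro ballI)
    fix y assume y: "y \<in> - bdry G \<iota>"
    then obtain p where p: "p \<in> points G" "y = \<iota> p" using not_point_bdry by blast
    obtain \<rho> F where \<rho>: "\<rho> > 0" "\<And>y. dist (\<iota> p) y < \<rho> \<Longrightarrow>
       \<exists>x\<in>points G. y = \<iota> x \<and> (x = p \<or> (\<exists>e\<in>F. \<exists>s. 0 < s \<and> s < len G e \<and> x = Inner e s))"
      using local_structure[OF p(1)] by metis
    have "y' \<notin> bdry G \<iota>" if "dist y' y < \<rho>" for y'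
    proof -
      have "dist (\<iota> p) y' < \<rho>" using that p(2) by (simp add: dist_commute)
      from \<rho>(2)[OF this] obtain x where x: "x \<in> points G" "y' = \<iota> x" "x = p \<or> (\<exists>e s. x = Inner e s)"
        by blast
      then show ?thesis using bdry_cases[OF x(1)] bdry_cases[OF p(1)] y p(2) by auto
    qed
    then show "\<exists>\<rho>>0. \<forall>y'. dist y' y < \<rho> \<longrightarrow> y' \<in> - bdry G \<iota>" using \<rho>(1) by auto
  qed
  then show ?thesis by (simp add: closed_def)
qed

lemma compact_bdry: "compact (bdry G \<iota>)"
  using compact_UNIV closed_bdry compact_Int_closed[of UNIV "bdry G \<iota>"] by simp

text \<open>In particular a leaf is an isolated point of the boundary. This handles leaves that
  happen to lie in a finite separating set when boundary points are separated by clopen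
  sets.\<close>

lemma vertex_isolated:
  assumes v: "v \<in> verts G"
  shows "\<exists>\<rho>>0. \<forall>y. dist (\<iota> (Vertex v)) y < \<rho> \<longrightarrow> y = \<iota> (Vertex v) \<or> y \<notin> bdry G \<iota>"
proof -
  obtain \<rho> F where \<rho>: "\<rho> > 0" "\<And>y. dist (\<iota> (Vertex v)) y < \<rho> \<Longrightarrow>
     \<exists>x\<in>points G. y = \<iota> x \<and> (x = Vertex v \<or> (\<exists>e\<in>F. \<exists>s. 0 < s \<and> s < len G e \<and> x = Inner e s))"
    using local_structure[OF Vertex_in[OF v]] by metis
  have "y = \<iota> (Vertex v) \<or> y \<notin> bdry G \<iota>" if d: "dist (\<iota> (Vertex v)) y < \<rho>" for y
  proof -
    obtain x where "x \<in> points G" "y = \<iota> x" "x = Vertex v \<or> (\<exists>e s. x = Inner e s)"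
      using \<rho>(2)[OF d] by blast
    then show ?thesis using bdry_cases[of x] by auto
  qed
  with \<rho>(1) show ?thesis by blast
qed

section \<open>Continuity on the completion\<close>

lemma edge_point_inj: "e \<in> edges G \<Longrightarrow> inj_on (edge_point G e) {0..len G e}"
  using edgeD[of e] by (auto simp: inj_on_def edge_point_def split: if_splits)

text \<open>The parametrization of a closed edge is a continuous injection of a compact interval,
  hence a homeomorphism onto its image, and continuity can be tested in the coordinate.\<close>

lemma continuous_on_closed_edge:
  fixes f :: "'p \<Rightarrow> real"
  assumes e: "e \<in> edges G" and f: "continuous_on {0..len G e} (\<lambda>t. f (\<iota> (edge_point G e t)))"
  shows "continuous_on (closed_edge e) f"
proof -
  define \<gamma> where "\<gamma> t = \<iota> (edge_point G e t)" for t
  have inj: "inj_on \<gamma> {0..len G e}"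
    using edge_point_inj[OF e] iota_inj edge_point_in[OF e] unfolding inj_on_def \<gamma>_def by metis
  define h where "h = the_inv_into {0..len G e} \<gamma>"
  have c\<gamma>: "continuous_on {0..len G e} \<gamma>" unfolding \<gamma>_def by (rule continuous_on_edge[OF e])
  have "continuous_on (\<gamma> ` {0..len G e}) h"
    by (rule continuous_on_inv[OF c\<gamma>]) (auto simp: h_def the_inv_into_f_f[OF inj])
  then have "continuous_on (\<gamma> ` {0..len G e}) (\<lambda>y. f (\<gamma> (h y)))"
    by (rule continuous_on_compose2[OF f[folded \<gamma>_def]]) (auto simp: h_def the_inv_into_f_f[OF inj])
  moreover have "f (\<gamma> (h y)) = f y" if "y \<in> \<gamma> ` {0..len G e}" for y
    using that by (simp add: h_def f_the_inv_into_f[OF inj])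
  ultimately show ?thesis unfolding closed_edge_def \<gamma>_def[symmetric]
    by (subst continuous_on_cong[OF refl, of _ f "\<lambda>y. f (\<gamma> (h y))"]) auto
qed

text \<open>A ball around \<open>p\<close> is covered by \<open>p\<close> and finitely many closed
  edges; these are closed sets, so continuity on the pieces gives continuity on their union.\<close>

lemma isCont_point:
  fixes f :: "'p \<Rightarrow> real"
  assumes p: "p \<in> points G"
    and f: "\<And>e. e \<in> edges G \<Longrightarrow> continuous_on {0..len G e} (\<lambda>t. f (\<iota> (edge_point G e t)))"
  shows "isCont f (\<iota> p)"
proof -
  obtain \<rho> F where \<rho>: "\<rho> > 0" and F: "finite F" "F \<subseteq> edges G" and st: "\<And>y. dist (\<iota> p) y < \<rho> \<Longrightarrow>
     \<exists>x\<in>points G. y = \<iota> x \<and> (x = p \<or> (\<exists>e\<in>F. \<exists>s. 0 < s \<and> s < len G e \<and> x = Inner e s))"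
    using local_structure[OF p] by metis
  define C where "C = {\<iota> p} \<union> (\<Union>e\<in>F. closed_edge e)"
  have "continuous_on (\<Union>e\<in>F. closed_edge e) f"
  proof (rule continuous_on_closed_Union[OF F(1)])
    fix e assume "e \<in> F"
    then have e: "e \<in> edges G" using F(2) by blast
    show "closed (closed_edge e)" by (rule closed_closed_edge[OF e])
    show "continuous_on (closed_edge e) f" by (rule continuous_on_closed_edge[OF e f[OF e]])
  qed
  then have "continuous_on C f" unfolding C_def
    using F closed_closed_edge by (intro continuous_on_closed_Un closed_UN ballI) auto
  moreover have "ball (\<iota> p) \<rho> \<subseteq> C"
  proof
    fix y assume "y \<in> ball (\<iota> p) \<rho>"
    then obtain x where x: "y = \<iota> x" "x = p \<or> (\<exists>e\<in>F. \<exists>s. 0 < s \<and> s < len G e \<and> x = Inner e s)"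
      using st[of y] by auto
    show "y \<in> C"
    proof (cases "x = p")
      case False
      then obtain e s where e: "e \<in> F" "0 < s" "s < len G e" "x = Inner e s" using x by blast
      then have "y \<in> closed_edge e" using F(2) Inner_in_closed_edge[of e s] x(1) by blast
      then show ?thesis using e(1) unfolding C_def by blast
    qed (use x in \<open>simp add: C_def\<close>)
  qed
  ultimately have "continuous_on (ball (\<iota> p) \<rho>) f" by (rule continuous_on_subset)
  then show ?thesis using \<rho> by (simp add: continuous_on_eq_continuous_at)
qed

text \<open>At an added point the only control is smallness outside finitely many closed edges.
  Their union is closed and does not contain the point, so a whole ball avoids it.\<close>

lemma continuous_extension_by_zero:
  fixes w :: "'v point \<Rightarrow> real"
  assumes w: "\<And>e. e \<in> edges G \<Longrightarrow> continuous_on {0..len G e} (\<lambda>t. w (edge_point G e t))"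
    and small: "\<And>\<epsilon>. \<epsilon> > 0 \<Longrightarrow> \<exists>F. finite F \<and> F \<subseteq> edges G \<and>
      (\<forall>x\<in>points G. (\<forall>e\<in>F. \<forall>t\<in>{0..len G e}. x \<noteq> edge_point G e t) \<longrightarrow> \<bar>w x\<bar> < \<epsilon>)"
  shows "\<exists>W. continuous_on UNIV W \<and> (\<forall>x\<in>points G. W (\<iota> x) = w x) \<and> (\<forall>y. y \<notin> \<iota> ` points G \<longrightarrow> W y = 0)"
proof -
  define W where "W y = (if y \<in> \<iota> ` points G then w (the_inv_into (points G) \<iota> y) else 0)" for y
  have inj: "inj_on \<iota> (points G)" using iota_inj by (auto simp: inj_on_def)
  have Wi: "W (\<iota> x) = w x" if "x \<in> points G" for x
    using that by (simp add: W_def the_inv_into_f_f[OF inj])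
  have "isCont W y" for y
  proof (cases "y \<in> \<iota> ` points G")
    case True
    then obtain p where p: "p \<in> points G" "y = \<iota> p" by blast
    show ?thesis unfolding p(2)
      by (rule isCont_point[OF p(1)]) (use w Wi edge_point_in in simp)
  next
    case False
    show ?thesis unfolding continuous_at_eps_delta
    proof (intro allI impI)
      fix \<epsilon> :: real assume "\<epsilon> > 0"
      from small[OF this] obtain F where F: "finite F" "F \<subseteq> edges G"
        "\<And>x. x \<in> points G \<Longrightarrow> (\<forall>e\<in>F. \<forall>t\<in>{0..len G e}. x \<noteq> edge_point G e t) \<Longrightarrow> \<bar>w x\<bar> < \<epsilon>" by blast
      have "closed (\<Union>e\<in>F. closed_edge e)"
        using F(1,2) closed_closed_edge by (intro closed_UN ballI) auto
      moreover have "y \<notin> (\<Union>e\<in>F. closed_edge e)"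
        using False F(2) closed_edge_cases by blast
      ultimately obtain d where d: "d > 0" "ball y d \<subseteq> - (\<Union>e\<in>F. closed_edge e)"
        by (metis ComplI open_Compl open_contains_ball)
      show "\<exists>d>0. \<forall>x. dist x y < d \<longrightarrow> dist (W x) (W y) < \<epsilon>"
      proof (intro exI[of _ d] conjI allI impI d(1))
        fix y' assume y': "dist y' y < d"
        then have "y' \<in> ball y d" by (simp add: dist_commute)
        then have nF: "y' \<notin> (\<Union>e\<in>F. closed_edge e)" using d(2) by blast
        show "dist (W y') (W y) < \<epsilon>"
        proof (cases "y' \<in> \<iota> ` points G")
          case True
          then obtain x where x: "x \<in> points G" "y' = \<iota> x" by blast
          have "\<forall>e\<in>F. \<forall>t\<in>{0..len G e}. x \<noteq> edge_point G e t"
            using nF x by (auto simp: closed_edge_def)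
          from F(3)[OF x(1) this] show ?thesis using False x Wi by (simp add: W_def dist_real_def)
        qed (use False \<open>\<epsilon> > 0\<close> in \<open>simp add: W_def\<close>)
      qed
    qed
  qed
  then have "continuous_on UNIV W" by (simp add: continuous_on_eq_continuous_at)
  moreover have "\<forall>y. y \<notin> \<iota> ` points G \<longrightarrow> W y = 0" by (simp add: W_def)
  ultimately show ?thesis using Wi by blast
qed

section \<open>Consequences of compactness\<close>

lemma dist_bounded: "\<exists>D>0. \<forall>x y::'p. dist x y \<le> D"
proof -
  have "bounded (UNIV :: 'p set)" by (rule compact_imp_bounded[OF compact_UNIV])
  then obtain a :: 'p and B where "\<forall>x\<in>UNIV. dist a x \<le> B" unfolding bounded_def by blast
  then have B: "dist a x \<le> B" for x by simp
  show ?thesis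
  proof (intro exI[of _ "2 * \<bar>B\<bar> + 1"] conjI allI)
    fix x y :: 'p show "dist x y \<le> 2 * \<bar>B\<bar> + 1"
      using B[of x] B[of y] dist_triangle[of x y a] by (auto simp: dist_commute)
  qed simp
qed

text \<open>The tent over a single edge, with half the length as its height and \<open>0\<close>
  elsewhere, is an admissible test function, so half of every length is bounded by the bound on
  distances.\<close>

lemma len_bounded: "\<exists>D>0. \<forall>e\<in>edges G. len G e \<le> D"
proof -
  obtain D where D: "D > 0" "\<And>x y::'p. dist x y \<le> D" using dist_bounded by blast
  have "len G e0 \<le> 2 * D" if e0: "e0 \<in> edges G" for e0
  proof -
    define g where "g x = (case x of Vertex w \<Rightarrow> 0 | Inner e s \<Rightarrow> if e = e0 then min s (len G e - s) else 0)" for x :: "'v point"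
    have on: "g (edge_point G e t) = (if e = e0 then min t (len G e - t) else 0)"
      if "e \<in> edges G" "t \<in> {0..len G e}" for e t
      using that by (auto simp: g_def edge_point_def)
    have lip: "\<bar>g (edge_point G e s) - g (edge_point G e t)\<bar> \<le> \<bar>s - t\<bar>"
      if "e \<in> edges G" "s \<in> {0..len G e}" "t \<in> {0..len G e}" for e s t
      unfolding on[OF that(1,2)] on[OF that(1,3)] by auto
    let ?x = "edge_point G e0 (len G e0 / 2)" and ?y = "edge_point G e0 0"
    have "\<bar>g ?x - g ?y\<bar> \<le> graph_dist G ?x ?y"
      by (rule graph_dist_ge[OF _ _ lip]) (use edge_point_in[OF e0] in auto)
    also have "\<dots> = dist (\<iota> ?x) (\<iota> ?y)" using e0 by (simp add: dist_eq edge_point_in)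
    also have "\<dots> \<le> D" by (rule D)
    finally show ?thesis using edgeD(4)[OF e0] on[OF e0, of 0] on[OF e0, of "len G e0 / 2"] by simp
  qed
  then show ?thesis using D(1) by (intro exI[of _ "2 * D"]) auto
qed

text \<open>Finitely many vertices and closed edges form a closed set, so the completion adds no
  point. Used through its contrapositive: a nonempty boundary without leaves forces infinitely many
  vertices.\<close>

lemma bdry_empty_if_finite:
  assumes "finite (verts G)" "\<And>v. v \<in> verts G \<Longrightarrow> degree G v \<noteq> 1"
  shows "bdry G \<iota> = {}"
proof -
  have "finite (edges G)"
    by (rule finite_subset[of _ "verts G \<times> verts G"]) (use assms graph in \<open>auto simp: is_metric_graph_def\<close>)
  have eq: "\<iota> ` points G = \<iota> ` Vertex ` verts G \<union> (\<Union>e\<in>edges G. closed_edge e)"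
  proof
    show "\<iota> ` points G \<subseteq> \<iota> ` Vertex ` verts G \<union> (\<Union>e\<in>edges G. closed_edge e)"
    proof clarify
      fix x assume "x \<in> points G" "\<iota> x \<notin> (\<Union>e\<in>edges G. closed_edge e)"
      then show "\<iota> x \<in> \<iota> ` Vertex ` verts G"
      proof (cases rule: pointsE)
        case (2 e t)
        then have "\<iota> x \<in> closed_edge e" using Inner_in_closed_edge by blast
        then show ?thesis using 2 \<open>\<iota> x \<notin> (\<Union>e\<in>edges G. closed_edge e)\<close> by blast
      qed auto
    qed
  qed (use edge_point_in Vertex_in in \<open>auto simp: closed_edge_def\<close>)
  have "closed (\<iota> ` points G)"
    unfolding eq using assms(1) \<open>finite (edges G)\<close> closed_closed_edge
    by (intro closed_Un closed_UN ballI) (auto intro: finite_imp_closed)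
  then have "\<iota> ` points G = UNIV" using completion by (simp add: is_completion_def closure_closed)
  then show ?thesis using assms(2) by (auto simp: bdry_def)
qed

section \<open>Energy along paths\<close>

definition linear_interpolation :: "('v \<Rightarrow> real) \<Rightarrow> 'v point \<Rightarrow> real" where
  "linear_interpolation g x = (case x of Vertex v \<Rightarrow> g v |
     Inner e t \<Rightarrow> g (fst e) + t / len G e * (g (snd e) - g (fst e)))"

lemma linear_interpolation_edge_point:
  "e \<in> edges G \<Longrightarrow> t \<in> {0..len G e} \<Longrightarrow>
     linear_interpolation g (edge_point G e t) = ((g (snd e) - g (fst e)) / len G e) *\<^sub>R t + g (fst e)"
  using edgeD[of e] by (auto simp: linear_interpolation_def edge_point_def)

text \<open>A path may run through the same piece of an edge several times, so it is replaced by the sets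
  of points that it meets on the edges.\<close>

lemma path_cover:
  assumes "path_length G x r y"
  shows "\<exists>F T. finite F \<and> F \<subseteq> edges G \<and> (\<forall>e\<in>F. compact (T e) \<and> T e \<subseteq> {0..len G e}) \<and>
     (\<Sum>e\<in>F. measure lebesgue (T e)) \<le> r \<and>
     closed_segment (linear_interpolation g x) (linear_interpolation g y) \<subseteq>
       {linear_interpolation g x} \<union> (\<Union>e\<in>F. (\<lambda>t. linear_interpolation g (edge_point G e t)) ` T e)"
  using assms
proof (induction rule: path_length.induct)
  case (trivial x)
  then show ?case by (intro exI[of _ "{}"]) auto
next
  case (extend x r e s t)
  let ?u = "linear_interpolation g"
  obtain F T where FT: "finite F" "F \<subseteq> edges G" "\<And>e. e \<in> F \<Longrightarrow> compact (T e) \<and> T e \<subseteq> {0..len G e}"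
     "(\<Sum>e\<in>F. measure lebesgue (T e)) \<le> r"
     "closed_segment (?u x) (?u (edge_point G e s)) \<subseteq> {?u x} \<union> (\<Union>e\<in>F. (\<lambda>t. ?u (edge_point G e t)) ` T e)"
    using extend.IH by blast
  \<comment> \<open>The union counts an overlap with an earlier piece of the same edge once, so the
    recorded set never exceeds the edge, while its measure grows by at most the length of the new
    piece.\<close>
  define T' where "T' e' = (if e' \<in> F then T e' else {}) \<union> (if e' = e then closed_segment s t else {})" for e'
  define F' where "F' = insert e F"
  have seg: "closed_segment s t \<subseteq> {0..len G e}" using extend by (intro closed_segment_subset) auto
  have mseg: "measure lebesgue (closed_segment s t) = \<bar>t - s\<bar>"
    by (auto simp: closed_segment_eq_real_ivl)
  have T'e: "compact (T' e')" "T' e' \<subseteq> {0..len G e'}" if "e' \<in> F'" for e'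
    using that FT(3)[of e'] seg by (auto simp: T'_def F'_def intro!: compact_Un)
  have lm: "A \<in> lmeasurable" if "compact A" for A :: "real set" using that by (rule lmeasurable_compact)
  have "(\<Sum>e'\<in>F'. measure lebesgue (T' e')) \<le>
     (\<Sum>e'\<in>F'. measure lebesgue (if e' \<in> F then T e' else {}) + measure lebesgue (if e' = e then closed_segment s t else {}))"
    unfolding T'_def
    by (intro sum_mono measure_Un_le) (use FT(3) lm fmeasurableD in auto)
  also have "\<dots> = (\<Sum>e'\<in>F'. measure lebesgue (if e' \<in> F then T e' else {})) + (\<Sum>e'\<in>F'. measure lebesgue (if e' = e then closed_segment s t else {}))"
    by (rule sum.distrib)
  also have "(\<Sum>e'\<in>F'. measure lebesgue (if e' \<in> F then T e' else {})) = (\<Sum>e'\<in>F. measure lebesgue (T e'))"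
    unfolding F'_def using FT(1) by (intro sum.mono_neutral_cong_right) auto
  also have "(\<Sum>e'\<in>F'. measure lebesgue (if e' = e then closed_segment s t else {})) = (\<Sum>e'\<in>{e}. \<bar>t - s\<bar>)"
    unfolding F'_def using FT(1) mseg by (intro sum.mono_neutral_cong_right) auto
  finally have m: "(\<Sum>e'\<in>F'. measure lebesgue (T' e')) \<le> r + \<bar>t - s\<bar>" using FT(4) by simp
  have "continuous_on (closed_segment s t) (\<lambda>t. ((g (snd e) - g (fst e)) / len G e) *\<^sub>R t + g (fst e))"
    by (intro continuous_intros)
  then have "continuous_on (closed_segment s t) (\<lambda>t. ?u (edge_point G e t))"
    by (rule continuous_on_eq) (use seg linear_interpolation_edge_point[OF extend.hyps(2)] in auto)
  then have "connected ((\<lambda>t. ?u (edge_point G e t)) ` closed_segment s t)"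
    by (rule connected_continuous_image) (simp add: connected_segment)
  then have "convex ((\<lambda>t. ?u (edge_point G e t)) ` closed_segment s t)"
    by (simp add: is_interval_convex_1[symmetric] is_interval_connected_1)
  then have seg2: "closed_segment (?u (edge_point G e s)) (?u (edge_point G e t))
      \<subseteq> (\<lambda>t. ?u (edge_point G e t)) ` closed_segment s t"
    by (intro closed_segment_subset) auto
  have tri: "closed_segment a c \<subseteq> closed_segment a b \<union> closed_segment b c" for a b c :: real
    by (auto simp: closed_segment_eq_real_ivl split: if_splits)
  have "closed_segment (?u x) (?u (edge_point G e t)) \<subseteq>
      {?u x} \<union> (\<Union>e\<in>F. (\<lambda>t. ?u (edge_point G e t)) ` T e) \<union> (\<lambda>t. ?u (edge_point G e t)) ` closed_segment s t"
    using tri[of "?u x" "?u (edge_point G e t)" "?u (edge_point G e s)"] seg2 FT(5) by blast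
  also have "\<dots> \<subseteq> {?u x} \<union> (\<Union>e\<in>F'. (\<lambda>t. ?u (edge_point G e t)) ` T' e)"
    unfolding F'_def T'_def by auto
  finally show ?case
    using m T'e FT(1,2) extend.hyps unfolding F'_def by (intro exI[of _ F'] exI[of _ T']) (auto simp: F'_def)
qed

text \<open>The segment between the two values is covered, up to a point, by affine images of the
  sets \<open>T e\<close>, so its length is at most the sum of slope times measure. Cauchy-Schwarz
  separates the measures, with sum at most \<open>r\<close>, from the edge energies.\<close>

lemma path_energy_bound:
  assumes "path_length G x r y"
  shows "\<exists>F. finite F \<and> F \<subseteq> edges G \<and> (linear_interpolation g x - linear_interpolation g y)\<^sup>2
     \<le> r * (\<Sum>e\<in>F. (g (snd e) - g (fst e))\<^sup>2 / len G e)"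
proof -
  let ?u = "linear_interpolation g"
  obtain F T where FT: "finite F" "F \<subseteq> edges G" "\<And>e. e \<in> F \<Longrightarrow> compact (T e) \<and> T e \<subseteq> {0..len G e}"
     "(\<Sum>e\<in>F. measure lebesgue (T e)) \<le> r"
     "closed_segment (?u x) (?u y) \<subseteq> {?u x} \<union> (\<Union>e\<in>F. (\<lambda>t. ?u (edge_point G e t)) ` T e)"
    using path_cover[OF assms, of g] by blast
  have r: "r \<ge> 0" by (rule path_length_nonneg[OF assms])
  define \<tau> where "\<tau> e = measure lebesgue (T e)" for e
  define \<Delta> where "\<Delta> e = \<bar>g (snd e) - g (fst e)\<bar>" for e
  have \<tau>: "0 \<le> \<tau> e" "\<tau> e \<le> len G e" if "e \<in> F" for e
  proof -
    show "0 \<le> \<tau> e" by (simp add: \<tau>_def)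
    have "T e \<in> sets lebesgue" using FT(3)[OF that] lmeasurable_compact fmeasurableD by blast
    then have "\<tau> e \<le> measure lebesgue {0..len G e}" unfolding \<tau>_def
      using FT(3)[OF that] by (intro measure_mono_fmeasurable) auto
    then show "\<tau> e \<le> len G e" using edgeD(4)[of e] FT(2) that by auto
  qed
  have img: "(\<lambda>t. ?u (edge_point G e t)) ` T e = (\<lambda>t. ((g (snd e) - g (fst e)) / len G e) *\<^sub>R t + g (fst e)) ` T e"
    if "e \<in> F" for e
  proof (intro image_cong refl linear_interpolation_edge_point)
    show "e \<in> edges G" using that FT(2) by blast
    show "t \<in> {0..len G e}" if "t \<in> T e" for t using FT(3)[OF \<open>e \<in> F\<close>] that by blast
  qed
  have mi: "(\<lambda>t. ?u (edge_point G e t)) ` T e \<in> lmeasurable"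
    "measure lebesgue ((\<lambda>t. ?u (edge_point G e t)) ` T e) = \<Delta> e / len G e * \<tau> e" if "e \<in> F" for e
  proof -
    have "compact ((\<lambda>t. ?u (edge_point G e t)) ` T e)"
      unfolding img[OF that] using FT(3)[OF that] by (intro compact_continuous_image continuous_intros) auto
    then show "(\<lambda>t. ?u (edge_point G e t)) ` T e \<in> lmeasurable" by (rule lmeasurable_compact)
    show "measure lebesgue ((\<lambda>t. ?u (edge_point G e t)) ` T e) = \<Delta> e / len G e * \<tau> e"
      unfolding img[OF that] measure_lebesgue_affine \<Delta>_def \<tau>_def using edgeD(4)[of e] FT(2) that
      by (auto simp: abs_divide)
  qed
  have sg: "{?u x} \<in> lmeasurable" by (rule lmeasurable_compact) simp
  have un: "(\<Union>e\<in>F. (\<lambda>t. ?u (edge_point G e t)) ` T e) \<in> lmeasurable"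
    using FT(1) mi(1) by (intro fmeasurable.finite_UN) auto
  have "\<bar>?u x - ?u y\<bar> = measure lebesgue (closed_segment (?u x) (?u y))"
    by (auto simp: closed_segment_eq_real_ivl)
  also have "\<dots> \<le> measure lebesgue ({?u x} \<union> (\<Union>e\<in>F. (\<lambda>t. ?u (edge_point G e t)) ` T e))"
    using FT(5) sg un by (intro measure_mono_fmeasurable fmeasurable.Un) (auto simp: closed_segment_eq_real_ivl)
  also have "\<dots> \<le> measure lebesgue {?u x} + measure lebesgue (\<Union>e\<in>F. (\<lambda>t. ?u (edge_point G e t)) ` T e)"
    by (intro measure_Un_le fmeasurableD sg un)
  also have "measure lebesgue {?u x} = 0" by simp
  also have "measure lebesgue (\<Union>e\<in>F. (\<lambda>t. ?u (edge_point G e t)) ` T e) \<le> (\<Sum>e\<in>F. measure lebesgue ((\<lambda>t. ?u (edge_point G e t)) ` T e))"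
    using FT(1) mi(1) by (intro measure_UNION_le fmeasurableD) auto
  \<comment> \<open>One factor \<open>sqrt (\<tau> e)\<close> goes into the path length; the other,
    squared, is at most \<open>len G e\<close> and cancels one of the two lengths in the
    denominator.\<close>
  also have "\<dots> = (\<Sum>e\<in>F. sqrt (\<tau> e) * (sqrt (\<tau> e) * (\<Delta> e / len G e)))"
    using mi(2) \<tau>(1) by (intro sum.cong) (auto simp flip: mult.assoc)
  finally have "\<bar>?u x - ?u y\<bar> \<le> (\<Sum>e\<in>F. sqrt (\<tau> e) * (sqrt (\<tau> e) * (\<Delta> e / len G e)))" by simp
  then have "\<bar>?u x - ?u y\<bar>\<^sup>2 \<le> (\<Sum>e\<in>F. sqrt (\<tau> e) * (sqrt (\<tau> e) * (\<Delta> e / len G e)))\<^sup>2"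
    by (intro power_mono) auto
  also have "\<dots> \<le> (\<Sum>e\<in>F. (sqrt (\<tau> e))\<^sup>2) * (\<Sum>e\<in>F. (sqrt (\<tau> e) * (\<Delta> e / len G e))\<^sup>2)"
    by (rule Cauchy_Schwarz_ineq_sum)
  also have "\<dots> \<le> r * (\<Sum>e\<in>F. (g (snd e) - g (fst e))\<^sup>2 / len G e)"
  proof (rule mult_mono)
    show "(\<Sum>e\<in>F. (sqrt (\<tau> e))\<^sup>2) \<le> r" using FT(4) \<tau>(1) by (simp add: \<tau>_def)
    show "(\<Sum>e\<in>F. (sqrt (\<tau> e) * (\<Delta> e / len G e))\<^sup>2) \<le> (\<Sum>e\<in>F. (g (snd e) - g (fst e))\<^sup>2 / len G e)"
    proof (rule sum_mono)
      fix e assume e: "e \<in> F"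
      have l: "len G e > 0" using edgeD(4)[of e] FT(2) e by auto
      have "(sqrt (\<tau> e) * (\<Delta> e / len G e))\<^sup>2 = \<tau> e * (\<Delta> e / len G e)\<^sup>2"
        using \<tau>(1)[OF e] by (subst power_mult_distrib) simp
      also have "\<dots> \<le> len G e * (\<Delta> e / len G e)\<^sup>2" by (intro mult_right_mono \<tau>(2)[OF e]) auto
      also have "\<dots> = (g (snd e) - g (fst e))\<^sup>2 / len G e" using l by (simp add: \<Delta>_def power_divide power2_eq_square)
      finally show "(sqrt (\<tau> e) * (\<Delta> e / len G e))\<^sup>2 \<le> (g (snd e) - g (fst e))\<^sup>2 / len G e" .
    qed
  qed (auto intro!: r sum_nonneg)
  finally show ?thesis using FT(1,2) by auto
qed

text \<open>With distances bounded by \<open>D\<close>, any two vertices are joined by a path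
  shorter than \<open>D + 1\<close>; this makes the constant independent of the vertices and of
  \<open>g\<close>.\<close>

lemma vertex_energy_bound:
  "\<exists>R>0. \<forall>g. \<forall>v\<in>verts G. \<forall>z\<in>verts G. \<exists>F. finite F \<and> F \<subseteq> edges G \<and>
     (g v - g z)\<^sup>2 \<le> R * (\<Sum>e\<in>F. (g (snd e) - g (fst e))\<^sup>2 / len G e)"
proof -
  obtain D where D: "D > 0" "\<And>x y::'p. dist x y \<le> D" using dist_bounded by blast
  have "\<exists>F. finite F \<and> F \<subseteq> edges G \<and>
     (g v - g z)\<^sup>2 \<le> (D + 1) * (\<Sum>e\<in>F. (g (snd e) - g (fst e))\<^sup>2 / len G e)"
    if vz: "v \<in> verts G" "z \<in> verts G" for g v z
  proof -
    have "graph_dist G (Vertex v) (Vertex z) \<le> D" using D(2)[of "\<iota> (Vertex v)" "\<iota> (Vertex z)"] vz by (simp add: dist_eq Vertex_in)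
    then have "Inf {r. path_length G (Vertex v) r (Vertex z)} < D + 1" by (simp add: graph_dist_def)
    moreover have "{r. path_length G (Vertex v) r (Vertex z)} \<noteq> {}"
      using conn vz Vertex_in by (auto simp: graph_connected_def)
    ultimately obtain r where r: "path_length G (Vertex v) r (Vertex z)" "r < D + 1"
      using cInf_lessD[of "{r. path_length G (Vertex v) r (Vertex z)}" "D + 1"] by auto
    obtain F where F: "finite F" "F \<subseteq> edges G"
      "(linear_interpolation g (Vertex v) - linear_interpolation g (Vertex z))\<^sup>2 \<le> r * (\<Sum>e\<in>F. (g (snd e) - g (fst e))\<^sup>2 / len G e)"
      using path_energy_bound[OF r(1)] by blast
    have "0 \<le> (\<Sum>e\<in>F. (g (snd e) - g (fst e))\<^sup>2 / len G e)"
      using F(2) edgeD(4) by (intro sum_nonneg divide_nonneg_pos) auto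
    then have "r * (\<Sum>e\<in>F. (g (snd e) - g (fst e))\<^sup>2 / len G e) \<le> (D + 1) * (\<Sum>e\<in>F. (g (snd e) - g (fst e))\<^sup>2 / len G e)"
      using r(2) by (intro mult_right_mono) auto
    then show ?thesis using F by (intro exI[of _ F]) (auto simp: linear_interpolation_def)
  qed
  then show ?thesis using D(1) by (intro exI[of _ "D + 1"]) auto
qed

end

section \<open>A smooth step function\<close>

text \<open>A family in which every member has its derivative in the family consists of smooth
  functions; this reduces claims on all iterated derivatives to a single differentiation.\<close>

lemma funpow_deriv_closed:
  assumes f: "f \<in> S" and S: "\<And>g. g \<in> S \<Longrightarrow> \<exists>g'\<in>S. \<forall>t::real. (g has_real_derivative g' t) (at t)"
  shows "(deriv ^^ n) f \<in> S \<and> (deriv ^^ n) f differentiable (at t)"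
proof -
  have d: "deriv g \<in> S" if "g \<in> S" for g
  proof -
    obtain g' where "g' \<in> S" "\<And>t. (g has_real_derivative g' t) (at t)" using S[OF \<open>g \<in> S\<close>] by blast
    moreover then have "deriv g = g'" using DERIV_imp_deriv by blast
    ultimately show ?thesis by simp
  qed
  have "(deriv ^^ n) f \<in> S" by (induction n) (auto intro: f d)
  moreover obtain g' where "((deriv ^^ n) f has_real_derivative g' t) (at t)" using S[OF calculation] by blast
  ultimately show ?thesis using real_differentiable_def by blast
qed

lemma funpow_deriv_cong_open:
  fixes f g :: "real \<Rightarrow> real"
  assumes "open S" "\<And>t. t \<in> S \<Longrightarrow> f t = g t" "t \<in> S"
  shows "(deriv ^^ n) f t = (deriv ^^ n) g t"
  using assms(3)
proof (induction n arbitrary: t)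
  case (Suc n)
  have "\<forall>\<^sub>F x in nhds t. (deriv ^^ n) f x = (deriv ^^ n) g x"
    by (rule eventually_mono[OF eventually_nhds_in_open[OF assms(1) Suc.prems] Suc.IH])
  then show ?case by (simp add: deriv_cong_ev)
qed (use assms(2) in simp)

lemma differentiable_funpow_deriv_cong_open:
  fixes f g :: "real \<Rightarrow> real"
  assumes "open S" "\<And>t. t \<in> S \<Longrightarrow> f t = g t" "t \<in> S" "(deriv ^^ n) g differentiable (at t)"
  shows "(deriv ^^ n) f differentiable (at t)"
proof -
  obtain D where "((deriv ^^ n) g has_real_derivative D) (at t)" using assms(4) real_differentiable_def by blast
  then have "((deriv ^^ n) f has_real_derivative D) (at t)"
    by (rule has_field_derivative_transform_within_open[OF _ assms(1,3)])
      (use funpow_deriv_cong_open[OF assms(1,2)] in auto)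
  then show ?thesis using real_differentiable_def by blast
qed

text \<open>All derivatives of \<open>exp (- 1 / (s (1 - s)))\<close> on the unit interval have this form.\<close>

definition bump :: "real poly \<Rightarrow> nat \<Rightarrow> real \<Rightarrow> real" where
  "bump p k s = (if 0 < s \<and> s < 1 then poly p s / (s * (1 - s)) ^ k * exp (- 1 / (s * (1 - s))) else 0)"

text \<open>The numerator after one differentiation: \<open>[:0, 1, -1:]\<close> is
  \<open>s (1 - s)\<close>, \<open>[:1, -2:]\<close> is its derivative, and the common denominator
  gains two powers.\<close>

definition bump_deriv :: "real poly \<Rightarrow> nat \<Rightarrow> real poly" where
  "bump_deriv p k = pderiv p * [:0, 1, -1:]\<^sup>2 - of_nat k * p * [:1, -2:] * [:0, 1, -1:] + p * [:1, -2:]"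

text \<open>The term of index \<open>k + 2\<close> in the exponential series bounds
  \<open>exp (- 1 / w)\<close> by a multiple of \<open>w ^ (k + 2)\<close>, where
  \<open>w = s (1 - s)\<close>. Division by \<open>w ^ k\<close> leaves two powers of
  \<open>w\<close>, enough for derivative \<open>0\<close> at both \<open>0\<close> and
  \<open>1\<close>.\<close>

lemma bump_bound: "\<exists>C. \<forall>s. \<bar>bump p k s\<bar> \<le> C * s\<^sup>2 \<and> \<bar>bump p k s\<bar> \<le> C * (s - 1)\<^sup>2"
proof -
  have "bounded (poly p ` {0..1})"
    by (intro compact_imp_bounded compact_continuous_image continuous_intros) auto
  then obtain B where B: "\<And>s. s \<in> {0..1} \<Longrightarrow> \<bar>poly p s\<bar> \<le> B" unfolding bounded_real by blast
  define C where "C = B * fact (k + 2)"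
  have B0: "B \<ge> 0" using B[of 0] by auto
  have C: "C \<ge> 0" using B0 by (simp add: C_def)
  have "\<bar>bump p k s\<bar> \<le> C * s\<^sup>2 \<and> \<bar>bump p k s\<bar> \<le> C * (s - 1)\<^sup>2" for s
  proof (cases "0 < s \<and> s < 1")
    case True
    define w where "w = s * (1 - s)"
    have w: "w > 0" using True by (simp add: w_def)
    define n where "n = k + 2"
    have "(1 / w) ^ n / fact n \<le> exp (1 / w)"
    proof -
      have "(\<Sum>i\<in>{n}. (1 / w) ^ i /\<^sub>R fact i) \<le> (\<Sum>i. (1 / w) ^ i /\<^sub>R fact i)"
        using w by (intro sum_le_suminf summable_exp_generic) auto
      then show ?thesis by (simp add: exp_def divide_inverse mult.commute)
    qed
    then have "inverse (exp (1 / w)) \<le> inverse ((1 / w) ^ n / fact n)"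
      using w by (intro le_imp_inverse_le) (auto intro!: divide_pos_pos)
    also have "inverse ((1 / w) ^ n / fact n) = fact n * w ^ n"
      using w by (simp add: power_one_over divide_inverse power_inverse mult.commute)
    finally have ex: "exp (- (1 / w)) \<le> fact n * w ^ n"
      by (simp add: exp_minus)
    have "\<bar>bump p k s\<bar> = \<bar>poly p s\<bar> / w ^ k * exp (- (1 / w))"
      using True w by (simp add: bump_def w_def[symmetric] abs_mult power_abs)
    also have "\<dots> \<le> B / w ^ k * (fact n * w ^ n)"
      using B[of s] True w ex B0 by (intro mult_mono divide_right_mono) auto
    also have "\<dots> = C * w\<^sup>2" using w by (simp add: C_def n_def power_add power2_eq_square)
    finally have le: "\<bar>bump p k s\<bar> \<le> C * w\<^sup>2" .
    have "w\<^sup>2 \<le> s\<^sup>2" "w\<^sup>2 \<le> (1 - s)\<^sup>2"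
      unfolding w_def using True by (intro power_mono; simp add: mult_left_le mult_left_le_one_le)+
    then show ?thesis using le C by (auto simp: power2_commute[of s 1] intro: order_trans mult_left_mono)
  qed (use C in \<open>auto simp: bump_def\<close>)
  then show ?thesis by blast
qed

lemma DERIV_zero_of_quadratic_bound:
  fixes f :: "real \<Rightarrow> real"
  assumes "\<And>x. \<bar>f x\<bar> \<le> C * (x - a)\<^sup>2"
  shows "(f has_real_derivative 0) (at a)"
proof -
  have fa: "f a = 0" using assms[of a] by simp
  have "((\<lambda>h. f (a + h) / h) \<longlongrightarrow> 0) (at 0)"
  proof (rule Lim_null_comparison)
    show "((\<lambda>h. C * \<bar>h\<bar>) \<longlongrightarrow> 0) (at 0)" by (auto intro!: tendsto_eq_intros)
    show "\<forall>\<^sub>F h in at 0. norm (f (a + h) / h) \<le> C * \<bar>h\<bar>"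
    proof (rule eventually_at_filter[THEN iffD2, OF always_eventually], intro allI impI)
      fix h :: real assume "h \<noteq> 0"
      have "\<bar>f (a + h)\<bar> \<le> C * \<bar>h\<bar> * \<bar>h\<bar>" using assms[of "a + h"] by (simp add: power2_eq_square flip: abs_mult)
      then show "norm (f (a + h) / h) \<le> C * \<bar>h\<bar>" using \<open>h \<noteq> 0\<close> by (simp add: divide_le_eq)
    qed
  qed
  then show ?thesis by (simp add: DERIV_def fa)
qed

lemma bump_has_deriv: "(bump p k has_real_derivative bump (bump_deriv p k) (k + 2) s) (at s)"
proof -
  obtain C where C: "\<And>s. \<bar>bump p k s\<bar> \<le> C * s\<^sup>2" "\<And>s. \<bar>bump p k s\<bar> \<le> C * (s - 1)\<^sup>2"
    using bump_bound by blast
  have z: "bump p' j t = 0" if "\<not> (0 < t \<and> t < 1)" for p' j t using that unfolding bump_def by (rule if_not_P)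
  consider "s = 0 \<or> s = 1" | "s < 0 \<or> s > 1" | "0 < s \<and> s < 1" by linarith
  then show ?thesis
  proof cases
    case 1
    then show ?thesis
      using DERIV_zero_of_quadratic_bound[of "bump p k" C 0] DERIV_zero_of_quadratic_bound[of "bump p k" C 1] C
        z[of s "bump_deriv p k" "k + 2"] by auto
  next
    case 2
    have "(bump p k has_real_derivative 0) (at s)"
    proof (rule has_field_derivative_transform_within_open[OF DERIV_const])
      show "open ({..<0} \<union> {1<..} :: real set)" by (intro open_Un) auto
    qed (use 2 in \<open>auto simp: bump_def\<close>)
    then show ?thesis using 2 z[of s "bump_deriv p k" "k + 2"] by auto
  next
    case 3
    define w where "w = (\<lambda>s::real. s * (1 - s))"
    have w: "w s > 0" using 3 by (simp add: w_def)
    have dw: "(w has_real_derivative (1 - 2 * s)) (at s)"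
      unfolding w_def by (auto intro!: derivative_eq_intros)
    have dp: "(poly p has_real_derivative poly (pderiv p) s) (at s)" by (rule poly_DERIV)
    have A: "((\<lambda>s. poly p s / w s ^ k) has_real_derivative
        (poly (pderiv p) s * w s ^ k - poly p s * (real k * w s ^ (k - 1) * (1 - 2 * s))) / (w s ^ k * w s ^ k)) (at s)"
      using w by (auto intro!: derivative_eq_intros dp dw)
    have B: "((\<lambda>s. exp (- 1 / w s)) has_real_derivative exp (- 1 / w s) * ((1 - 2 * s) / (w s * w s))) (at s)"
      using w by (auto intro!: derivative_eq_intros dw simp: algebra_simps diff_divide_distrib)
    have "((\<lambda>s. poly p s / w s ^ k * exp (- 1 / w s)) has_real_derivative
        (poly (pderiv p) s * w s ^ k - poly p s * (real k * w s ^ (k - 1) * (1 - 2 * s))) / (w s ^ k * w s ^ k) * exp (- 1 / w s)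
        + exp (- 1 / w s) * ((1 - 2 * s) / (w s * w s)) * (poly p s / w s ^ k)) (at s)"
      by (rule DERIV_mult[OF A B])
    also have "(poly (pderiv p) s * w s ^ k - poly p s * (real k * w s ^ (k - 1) * (1 - 2 * s))) / (w s ^ k * w s ^ k) * exp (- 1 / w s)
        + exp (- 1 / w s) * ((1 - 2 * s) / (w s * w s)) * (poly p s / w s ^ k)
      = (poly (pderiv p) s * (w s)\<^sup>2 - real k * poly p s * (1 - 2 * s) * w s + poly p s * (1 - 2 * s)) / w s ^ (k + 2) * exp (- 1 / w s)"
      using w by (cases k) (simp_all add: field_simps power2_eq_square)
    also have "\<dots> = bump (bump_deriv p k) (k + 2) s"
      using 3 by (simp add: bump_def bump_deriv_def w_def algebra_simps)
    finally show ?thesis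
    proof (rule has_field_derivative_transform_within_open)
      show "open {0<..<1::real}" by simp
    qed (use 3 in \<open>auto simp: bump_def w_def\<close>)
  qed
qed

text \<open>The normalized antiderivative of a bump: it is constant where the bump vanishes, and its
  derivatives are again bumps.\<close>

lemma smooth_step:
  "\<exists>S. (\<forall>t\<le>0. S t = 0) \<and> (\<forall>t\<ge>1. S t = 1) \<and> (\<forall>n t. (deriv ^^ n) S differentiable (at (t::real)))"
proof -
  define b where "b = bump 1 0"
  have bd: "\<exists>b'. (b has_real_derivative b') (at t)" for t unfolding b_def using bump_has_deriv by blast
  \<comment> \<open>The interval exceeds the unit interval on both sides, so the antiderivative has
    two-sided derivatives at \<open>0\<close> and \<open>1\<close>.\<close>
  then have "continuous_on {-2..3} b" by (meson DERIV_isCont continuous_at_imp_continuous_on)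
  then obtain g where g: "\<And>x. x \<in> {-2..3} \<Longrightarrow> (g has_vector_derivative b x) (at x within {-2..3})"
    using antiderivative_continuous by blast
  have dg: "(g has_real_derivative b x) (at x)" if "-2 < x" "x < 3" for x
    using g[of x] that by (simp add: has_real_derivative_iff_has_vector_derivative at_within_Icc_at)
  have b0: "b x = 0" if "x \<le> 0 \<or> 1 \<le> x" for x using that by (auto simp: b_def bump_def)
  have cg: "continuous_on {u..v} g" if "-2 < u" "v < 3" for u v
    by (intro continuous_at_imp_continuous_on ballI DERIV_isCont[OF dg]) (use that in auto)
  have g0: "g x = g 0" if x: "-2 < x" "x \<le> 0" for x
  proof (cases "x = 0")
    case False
    have "(g has_real_derivative 0) (at y)" if "x < y" "y < 0" for y using dg[of y] b0[of y] x that by simp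
    then have "g 0 = g x" using DERIV_isconst_end[of x 0 g] cg[of x 0] x False by auto
    then show ?thesis by simp
  qed simp
  have g1: "g x = g 1" if x: "1 \<le> x" "x < 3" for x
  proof (cases "x = 1")
    case False
    have "(g has_real_derivative 0) (at y)" if "1 < y" "y < x" for y using dg[of y] b0[of y] x that by simp
    then show ?thesis using DERIV_isconst_end[of 1 x g] cg[of 1 x] x False by auto
  qed simp
  have "\<exists>y. (g has_real_derivative y) (at x) \<and> 0 < y" if "0 < x" "x < 1" for x
    using dg[of x] that by (intro exI[of _ "b x"]) (auto simp: b_def bump_def)
  then have "g 0 < g 1" using DERIV_pos_imp_increasing_open[of 0 1 g] cg[of 0 1] by auto
  define c where "c = g 1 - g 0"
  have c: "c > 0" using \<open>g 0 < g 1\<close> by (simp add: c_def)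
  define S where "S t = (if t < -1 then 0 else if t > 2 then 1 else (g t - g 0) / c)" for t
  have c1: "(g 1 - g 0) / c = 1" using c by (simp add: c_def)
  have Sg: "S t = (g t - g 0) / c" if "-2 < t" "t < 3" for t
  proof (cases "t > 2")
    case True
    then have gt: "g t = g 1" using g1[of t] that by simp
    have "(g t - g 0) / c = 1" by (simp only: gt c1)
    then show ?thesis using True by (simp add: S_def)
  next
    case False
    then show ?thesis using that g0[of t] by (simp add: S_def)
  qed
  have dS: "(S has_real_derivative bump [:1 / c:] 0 t) (at t)" for t
  proof -
    consider "-2 < t \<and> t < 3" | "t < -1" | "t > 2" by linarith
    then show ?thesis
    proof cases
      case 1
      have "((\<lambda>t. (g t - g 0) / c) has_real_derivative b t / c) (at t)"
        using 1 c by (auto intro!: derivative_eq_intros dg)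
      then have "(S has_real_derivative b t / c) (at t)"
        by (rule has_field_derivative_transform_within_open[of _ _ _ "{-2<..<3}"]) (use 1 Sg in auto)
      moreover have "b t / c = bump [:1 / c:] 0 t" by (simp add: b_def bump_def)
      ultimately show ?thesis by simp
    next
      case 2
      have "(S has_real_derivative 0) (at t)"
      proof (rule has_field_derivative_transform_within_open[OF DERIV_const[of 0]])
        show "open {..< -1 :: real}" by simp
      qed (use 2 in \<open>auto simp: S_def\<close>)
      then show ?thesis using 2 by (simp add: bump_def)
    next
      case 3
      have "(S has_real_derivative 0) (at t)"
      proof (rule has_field_derivative_transform_within_open[OF DERIV_const[of 1]])
        show "open {2 :: real <..}" by simp
      qed (use 3 in \<open>auto simp: S_def\<close>)
      then show ?thesis using 3 by (simp add: bump_def)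
    qed
  qed
  have "(deriv ^^ n) S differentiable (at t)" for n t
  proof -
    have "\<exists>g'\<in>insert S {bump p k |p k. True}. \<forall>t. (g has_real_derivative g' t) (at t)"
      if "g \<in> insert S {bump p k |p k. True}" for g
      using that dS bump_has_deriv by blast
    from funpow_deriv_closed[OF insertI1 this] show ?thesis by blast
  qed
  moreover have "S t = 0" if "t \<le> 0" for t using that Sg[of t] g0[of t] by (auto simp: S_def)
  moreover have "S t = 1" if "t \<ge> 1" for t using that Sg[of t] g1[of t] c1 by (auto simp: S_def)
  ultimately show ?thesis by blast
qed

lemma smooth_affine_comp:
  assumes S: "\<And>n t. (deriv ^^ n) S differentiable (at (t::real))"
  shows "(deriv ^^ n) (\<lambda>t. A + B * S (m * t + k)) differentiable (at t)"
proof -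
  define \<F> where "\<F> = {f. \<exists>A B n. f = (\<lambda>t. A + B * (deriv ^^ n) S (m * t + k))}"
  have 1: "(\<lambda>t. A + B * S (m * t + k)) \<in> \<F>" unfolding \<F>_def by (intro CollectI exI[of _ A] exI[of _ B] exI[of _ 0]) simp
  have 2: "\<exists>g'\<in>\<F>. \<forall>t. (g has_real_derivative g' t) (at t)" if g: "g \<in> \<F>" for g
  proof -
    obtain A B n where g: "g = (\<lambda>t. A + B * (deriv ^^ n) S (m * t + k))" using g by (auto simp: \<F>_def)
    have D: "((deriv ^^ n) S has_real_derivative (deriv ^^ Suc n) S t) (at t)" for t
      using S[of n t] by (simp add: DERIV_deriv_iff_real_differentiable)
    have d: "(g has_real_derivative 0 + (B * m) * (deriv ^^ Suc n) S (m * t + k)) (at t)" for t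
    proof -
      have "((\<lambda>t. (deriv ^^ n) S (m * t + k)) has_real_derivative (deriv ^^ Suc n) S (m * t + k) * m) (at t)"
        by (rule DERIV_chain2[OF D]) (auto intro!: derivative_eq_intros)
      then show ?thesis unfolding g by (auto intro!: derivative_eq_intros)
    qed
    have m: "(\<lambda>t. 0 + (B * m) * (deriv ^^ Suc n) S (m * t + k)) \<in> \<F>" unfolding \<F>_def by blast
    show ?thesis
    proof (rule bexI[OF _ m], rule allI)
      fix t show "(g has_real_derivative 0 + (B * m) * (deriv ^^ Suc n) S (m * t + k)) (at t)" by (rule d)
    qed
  qed
  from funpow_deriv_closed[OF 1 2] show ?thesis by blast
qed

section \<open>Cutoff functions\<close>

locale weakly_connected_graph = metric_graph_completion +
  assumes weak: "weakly_connected G \<iota>"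
begin

text \<open>The two compactness passes familiar from Hausdorff spaces, over \<open>R\<close> for a
  fixed point of \<open>P\<close> and then over \<open>P\<close>. Only finite unions of exceptional
  sets are formed, so the final one stays finite and inside the graph.\<close>

lemma weak_separation:
  assumes P: "compact P" and R: "compact R" and PR: "P \<inter> R = {}"
  obtains W U V where "finite W" "W \<subseteq> \<iota> ` points G" "open U" "open V" "U \<inter> V = {}" "P \<subseteq> U" "R \<subseteq> V"
    "W = UNIV - (U \<union> V)"
proof -
  define sp where "sp x y W U V \<longleftrightarrow> finite W \<and> W \<subseteq> \<iota> ` points G \<and> open U \<and> open V \<and>
      U \<inter> V = {} \<and> UNIV - W = U \<union> V \<and> x \<in> U \<and> y \<in> V" for x y W U V
  have "\<exists>T. x \<noteq> y \<longrightarrow> sp x y (fst T) (fst (snd T)) (snd (snd T))" for x y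
  proof (cases "x = y")
    case False
    have "\<exists>W U V. sp x y W U V"
      unfolding sp_def by (rule weak[unfolded weakly_connected_def, rule_format, OF False])
    then obtain W U V where "sp x y W U V" by blast
    then show ?thesis by (intro exI[of _ "(W, U, V)"]) simp
  qed simp
  then obtain T where T: "\<And>x y. x \<noteq> y \<Longrightarrow> sp x y (fst (T x y)) (fst (snd (T x y))) (snd (snd (T x y)))" by metis
  define W U V where "W x y = fst (T x y)" and "U x y = fst (snd (T x y))" and "V x y = snd (snd (T x y))" for x y
  have W: "finite (W x y) \<and> W x y \<subseteq> \<iota> ` points G \<and> open (U x y) \<and> open (V x y) \<and>
      U x y \<inter> V x y = {} \<and> UNIV - W x y = U x y \<union> V x y \<and> x \<in> U x y \<and> y \<in> V x y" if "x \<noteq> y" for x y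
    using T[OF that] unfolding sp_def W_def U_def V_def .
  \<comment> \<open>Only an inclusion is required here, since a point of one exceptional set may lie
    in the \<open>V\<close> of another pair; the exact complement is taken at the end.\<close>
  define sp' where "sp' x W' U' V' \<longleftrightarrow> finite W' \<and> W' \<subseteq> \<iota> ` points G \<and> open U' \<and> open V' \<and>
      U' \<inter> V' = {} \<and> UNIV - W' \<subseteq> U' \<union> V' \<and> x \<in> U' \<and> R \<subseteq> V'" for x W' U' V'
  have step: "sp' x (\<Union>y\<in>Y. W x y) (\<Inter>y\<in>Y. U x y) (\<Union>y\<in>Y. V x y)"
    if x: "x \<in> P" and Y: "Y \<subseteq> R" "finite Y" "R \<subseteq> (\<Union>y\<in>Y. V x y)" for x Y
  proof -
    have ne: "x \<noteq> y" if "y \<in> R" for y using x PR that by auto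
    have WY: "finite (W x y) \<and> W x y \<subseteq> \<iota> ` points G \<and> open (U x y) \<and> open (V x y) \<and>
      U x y \<inter> V x y = {} \<and> UNIV - W x y = U x y \<union> V x y \<and> x \<in> U x y \<and> y \<in> V x y" if "y \<in> Y" for y
      using W[OF ne] Y(1) that by blast
    show ?thesis unfolding sp'_def
    proof (intro conjI)
      show "finite (\<Union>y\<in>Y. W x y)" using Y(2) WY by blast
      show "(\<Union>y\<in>Y. W x y) \<subseteq> \<iota> ` points G" using WY by blast
      show "open (\<Inter>y\<in>Y. U x y)" using Y(2) WY by (intro open_INT) blast+
      show "open (\<Union>y\<in>Y. V x y)" using WY by (intro open_UN) blast
      show "(\<Inter>y\<in>Y. U x y) \<inter> (\<Union>y\<in>Y. V x y) = {}" using WY by blast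
      show "UNIV - (\<Union>y\<in>Y. W x y) \<subseteq> (\<Inter>y\<in>Y. U x y) \<union> (\<Union>y\<in>Y. V x y)" using WY by blast
      show "x \<in> (\<Inter>y\<in>Y. U x y)" using WY by blast
      show "R \<subseteq> (\<Union>y\<in>Y. V x y)" by (rule Y)
    qed
  qed
  have "\<exists>Y. Y \<subseteq> R \<and> finite Y \<and> R \<subseteq> (\<Union>y\<in>Y. V x y)" if x: "x \<in> P" for x
  proof -
    have ne: "x \<noteq> y" if "y \<in> R" for y using x PR that by auto
    have op: "\<And>y. y \<in> R \<Longrightarrow> open (V x y)" and cov: "R \<subseteq> (\<Union>y\<in>R. V x y)" using W[OF ne] by blast+
    obtain Y where "Y \<subseteq> R" "finite Y" "R \<subseteq> (\<Union>y\<in>Y. V x y)" using compactE_image[OF R op cov] by blast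
    then show ?thesis by (intro exI[of _ Y] conjI)
  qed
  then obtain Y where Y: "\<And>x. x \<in> P \<Longrightarrow> Y x \<subseteq> R \<and> finite (Y x) \<and> R \<subseteq> (\<Union>y\<in>Y x. V x y)" by metis
  define W' U' V' where "W' x = (\<Union>y\<in>Y x. W x y)" and "U' x = (\<Inter>y\<in>Y x. U x y)" and "V' x = (\<Union>y\<in>Y x. V x y)" for x
  have W': "finite (W' x) \<and> W' x \<subseteq> \<iota> ` points G \<and> open (U' x) \<and> open (V' x) \<and>
      U' x \<inter> V' x = {} \<and> UNIV - W' x \<subseteq> U' x \<union> V' x \<and> x \<in> U' x \<and> R \<subseteq> V' x" if "x \<in> P" for x
  proof -
    have "sp' x (W' x) (U' x) (V' x)"
      unfolding W'_def U'_def V'_def by (rule step[OF that]) (use Y[OF that] in simp_all)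
    then show ?thesis unfolding sp'_def .
  qed
  have op: "\<And>x. x \<in> P \<Longrightarrow> open (U' x)" and cov: "P \<subseteq> (\<Union>x\<in>P. U' x)" using W' by blast+
  obtain X where X: "X \<subseteq> P" "finite X" "P \<subseteq> (\<Union>x\<in>X. U' x)"
    using compactE_image[OF P op cov] by blast
  have WX: "finite (W' x) \<and> W' x \<subseteq> \<iota> ` points G \<and> open (U' x) \<and> open (V' x) \<and>
      U' x \<inter> V' x = {} \<and> UNIV - W' x \<subseteq> U' x \<union> V' x \<and> R \<subseteq> V' x" if "x \<in> X" for x
    using W' X(1) that by blast
  let ?U = "\<Union>x\<in>X. U' x" and ?V = "\<Inter>x\<in>X. V' x"
  have sub: "UNIV - (?U \<union> ?V) \<subseteq> (\<Union>x\<in>X. W' x)" using WX by blast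
  show thesis
  proof (rule that[of "UNIV - (?U \<union> ?V)" ?U ?V])
    show "finite (UNIV - (?U \<union> ?V))" by (rule finite_subset[OF sub]) (use X(2) WX in blast)
    show "UNIV - (?U \<union> ?V) \<subseteq> \<iota> ` points G" by (rule order_trans[OF sub]) (use WX in blast)
    show "open ?U" using WX by (intro open_UN) blast
    show "open ?V" using X(2) WX by (intro open_INT) blast+
    show "?U \<inter> ?V = {}" using WX by blast
    show "P \<subseteq> ?U" by (rule X)
    show "R \<subseteq> ?V" using WX by blast
  qed simp
qed

text \<open>\<open>U\<close> cuts out a relatively open part of the boundary. The rest of the
  boundary is covered by \<open>V\<close> and finitely many points of \<open>W\<close>; the latter
  are leaves, hence isolated in the boundary, so the rest is relatively open too.\<close>

lemma bdry_clopen_separation: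
  assumes "x \<in> bdry G \<iota>" "y \<in> bdry G \<iota>" "x \<noteq> y"
  shows "\<exists>E. clopen_in (bdry G \<iota>) E \<and> x \<in> E \<and> y \<notin> E"
proof -
  obtain W U V where W: "finite W" "W \<subseteq> \<iota> ` points G" "open U" "open V" "U \<inter> V = {}" "{x} \<subseteq> U" "{y} \<subseteq> V"
    "W = UNIV - (U \<union> V)"
    using weak_separation[of "{x}" "{y}"] assms(3) by (metis compact_sing Int_insert_left_if0 Int_empty_left singletonD)
  have "\<exists>\<rho>>0. \<forall>z. dist w z < \<rho> \<longrightarrow> z = w \<or> z \<notin> bdry G \<iota>" if w: "w \<in> W \<inter> bdry G \<iota>" for w
  proof -
    obtain p where p: "p \<in> points G" "w = \<iota> p" using W(2) w by blast
    then obtain v where "v \<in> verts G" "p = Vertex v" using w bdry_cases[OF p(1)] by blast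
    then show ?thesis using vertex_isolated p(2) by blast
  qed
  then obtain \<rho> where \<rho>: "\<And>w. w \<in> W \<inter> bdry G \<iota> \<Longrightarrow> \<rho> w > 0 \<and> (\<forall>z. dist w z < \<rho> w \<longrightarrow> z = w \<or> z \<notin> bdry G \<iota>)"
    by metis
  define T where "T = V \<union> (\<Union>w\<in>W \<inter> bdry G \<iota>. ball w (\<rho> w))"
  have "bdry G \<iota> - U = bdry G \<iota> \<inter> T"
  proof
    show "bdry G \<iota> - U \<subseteq> bdry G \<iota> \<inter> T"
    proof
      fix z assume z: "z \<in> bdry G \<iota> - U"
      show "z \<in> bdry G \<iota> \<inter> T"
      proof (cases "z \<in> V")
        case False
        then have "z \<in> W \<inter> bdry G \<iota>" using z W(8) by blast
        moreover then have "z \<in> ball z (\<rho> z)" using \<rho> by simp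
        ultimately show ?thesis using z unfolding T_def by blast
      qed (use z in \<open>auto simp: T_def\<close>)
    qed
    show "bdry G \<iota> \<inter> T \<subseteq> bdry G \<iota> - U"
    proof
      fix z assume z: "z \<in> bdry G \<iota> \<inter> T"
      have "z \<notin> U"
      proof (cases "z \<in> V")
        case False
        then obtain w where w: "w \<in> W \<inter> bdry G \<iota>" "z \<in> ball w (\<rho> w)" using z by (auto simp: T_def)
        then have "z = w" using \<rho>[OF w(1)] z by auto
        then show ?thesis using w(1) W(8) by blast
      qed (use W(5) in blast)
      then show "z \<in> bdry G \<iota> - U" using z by blast
    qed
  qed
  moreover have "open T" using W(4) by (auto simp: T_def)
  ultimately have "openin (top_of_set (bdry G \<iota>)) (bdry G \<iota> - U)" by (auto simp: openin_open)
  then have "closedin (top_of_set (bdry G \<iota>)) (bdry G \<iota> \<inter> U)"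
    by (simp add: closedin_def Diff_Int)
  moreover have "openin (top_of_set (bdry G \<iota>)) (bdry G \<iota> \<inter> U)" using W(3) by (simp add: openin_open_Int)
  moreover have "x \<in> bdry G \<iota> \<inter> U" "y \<notin> bdry G \<iota> \<inter> U" using assms W by auto
  ultimately show ?thesis unfolding clopen_in_def by blast
qed

text \<open>A closed edge that misses \<open>W\<close> is connected and so lies entirely in
  \<open>U\<close> or in \<open>V\<close>; the indicator of \<open>U\<close> is constant on it. Only
  the finitely many edges meeting \<open>W\<close> need a smooth transition between their vertex
  values.\<close>

lemma cutoff_exists:
  assumes E: "clopen_in (bdry G \<iota>) E"
  shows "\<exists>\<phi>. is_cutoff G \<iota> E \<phi>"
proof -
  have Esub: "E \<subseteq> bdry G \<iota>" using E by (auto simp: clopen_in_def dest: openin_imp_subset)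
  have "closedin (top_of_set (bdry G \<iota>)) E" "closedin (top_of_set (bdry G \<iota>)) (bdry G \<iota> - E)"
    using E by (auto simp: clopen_in_def intro: closedin_diff)
  then have cE: "compact E" "compact (bdry G \<iota> - E)" using closedin_compact[OF compact_bdry] by auto
  obtain W U V where W: "finite W" "W \<subseteq> \<iota> ` points G" and U: "open U" and V: "open V" and UV: "U \<inter> V = {}"
    and EU: "E \<subseteq> U" and RV: "bdry G \<iota> - E \<subseteq> V" and Weq: "W = UNIV - (U \<union> V)"
    by (rule weak_separation[OF cE]) auto
  define F where "F = {e \<in> edges G. closed_edge e \<inter> W \<noteq> {}}"
  \<comment> \<open>By local finiteness every point of the finite set \<open>W\<close> lies on only
    finitely many closed edges.\<close>
  have finF: "finite F"
  proof -
    have "finite {e \<in> edges G. w \<in> closed_edge e}" if w: "w \<in> W" for w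
    proof -
      obtain p where p: "p \<in> points G" "w = \<iota> p" using W(2) w by blast
      have on: "\<exists>t\<in>{0..len G e}. p = edge_point G e t" if eh: "e \<in> edges G" "w \<in> closed_edge e" for e
      proof -
        obtain t where t: "t \<in> {0..len G e}" "w = \<iota> (edge_point G e t)"
          using eh(2) unfolding closed_edge_def by blast
        then have "p = edge_point G e t" using iota_inj[OF p(1) edge_point_in[OF eh(1)]] p(2) by simp
        then show ?thesis using t(1) by blast
      qed
      show ?thesis using p(1)
      proof (cases rule: pointsE)
        case (1 v)
        have "{e \<in> edges G. w \<in> closed_edge e} \<subseteq> incident G v"
        proof
          fix e assume "e \<in> {e \<in> edges G. w \<in> closed_edge e}"
          then have e: "e \<in> edges G" "w \<in> closed_edge e" by auto
          from on[OF this] obtain t where "e \<in> edges G" "Vertex v = edge_point G e t" using e(1) 1(2) by metis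
          then show "e \<in> incident G v" by (auto simp: incident_def edge_point_def split: if_splits)
        qed
        then show ?thesis using finite_incident[OF 1(1)] finite_subset by blast
      next
        case (2 e0 s)
        have "{e \<in> edges G. w \<in> closed_edge e} \<subseteq> {e0}"
        proof
          fix e assume "e \<in> {e \<in> edges G. w \<in> closed_edge e}"
          then have "e \<in> edges G" "w \<in> closed_edge e" by auto
          from on[OF this] obtain t where "Inner e0 s = edge_point G e t" using 2(4) by metis
          then show "e \<in> {e0}" by (auto simp: edge_point_def split: if_splits)
        qed
        then show ?thesis using finite_subset by blast
      qed
    qed
    then have "finite (\<Union>w\<in>W. {e \<in> edges G. w \<in> closed_edge e})" using W(1) by blast
    then show ?thesis by (rule rev_finite_subset) (auto simp: F_def)
  qed
  obtain S where S: "\<And>t. t \<le> 0 \<Longrightarrow> S t = 0" "\<And>t. t \<ge> 1 \<Longrightarrow> S t = 1" "\<And>n t. (deriv ^^ n) S differentiable (at (t::real))"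
    using smooth_step by blast
  have contS: "isCont S t" for t using S(3)[of 0 t] by (simp add: differentiable_imp_continuous_within)
  define \<Phi> where "\<Phi> v = (if \<iota> (Vertex v) \<in> U then 1 else 0 :: real)" for v
  \<comment> \<open>The argument of \<open>S\<close> runs from \<open>-1\<close> to \<open>2\<close>
    along the edge, so the transition takes place in the middle third and the function is constant
    near both vertices.\<close>
  define w where "w x = (case x of Vertex v \<Rightarrow> \<Phi> v | Inner e s \<Rightarrow>
    if e \<in> F then \<Phi> (fst e) + (\<Phi> (snd e) - \<Phi> (fst e)) * S (3 / len G e * s + (-1))
    else if \<iota> x \<in> U then 1 else 0)" for x
  define \<phi> where "\<phi> y = (if y \<in> \<iota> ` points G then w (the_inv_into (points G) \<iota> y) else if y \<in> U then 1 else 0)" for y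
  have inj: "inj_on \<iota> (points G)" using iota_inj by (auto simp: inj_on_def)
  have \<phi>i: "\<phi> (\<iota> x) = w x" if "x \<in> points G" for x using that by (simp add: \<phi>_def the_inv_into_f_f[OF inj])
  have onF: "\<phi> (\<iota> (edge_point G e t)) = \<Phi> (fst e) + (\<Phi> (snd e) - \<Phi> (fst e)) * S (3 / len G e * t + (-1))"
    if e: "e \<in> F" and t: "t \<in> {0..len G e}" for e t
  proof -
    have eG: "e \<in> edges G" using e by (simp add: F_def)
    have l: "len G e > 0" by (rule edgeD(4)[OF eG])
    have "\<phi> (\<iota> (edge_point G e t)) = w (edge_point G e t)" by (rule \<phi>i[OF edge_point_in[OF eG]])
    also have "\<dots> = \<Phi> (fst e) + (\<Phi> (snd e) - \<Phi> (fst e)) * S (3 / len G e * t + (-1))"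
      using t l e by (auto simp: w_def edge_point_def S)
    finally show ?thesis .
  qed
  have off: "\<phi> (\<iota> (edge_point G e t)) = \<Phi> (fst e)"
    if e: "e \<in> edges G - F" and t: "t \<in> {0..len G e}" for e t
  proof -
    have eG: "e \<in> edges G" and l: "len G e > 0" using e edgeD(4) by auto
    have cn: "connected (closed_edge e)"
      unfolding closed_edge_def by (intro connected_continuous_image continuous_on_edge eG) simp
    have sub: "closed_edge e \<subseteq> U \<union> V" using e Weq by (auto simp: F_def)
    have mem: "\<iota> (edge_point G e t) \<in> closed_edge e" using t by (auto simp: closed_edge_def)
    have mem0: "\<iota> (Vertex (fst e)) \<in> closed_edge e"
      using edge_point_simps(1)[OF eG] l unfolding closed_edge_def by (intro image_eqI[of _ _ 0]) auto
    have or: "U \<inter> closed_edge e = {} \<or> V \<inter> closed_edge e = {}"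
      using connectedD[OF cn U V] UV sub by blast
    have iff: "\<iota> (edge_point G e t) \<in> U \<longleftrightarrow> \<iota> (Vertex (fst e)) \<in> U"
      using or sub mem mem0 UV by blast
    have "\<phi> (\<iota> (edge_point G e t)) = w (edge_point G e t)" by (rule \<phi>i[OF edge_point_in[OF eG]])
    also have "\<dots> = (if \<iota> (edge_point G e t) \<in> U then 1 else 0)"
      using e by (auto simp: w_def \<Phi>_def edge_point_def)
    finally show ?thesis using iff by (simp add: \<Phi>_def)
  qed
  have cont_edge: "continuous_on {0..len G e} (\<lambda>t. \<phi> (\<iota> (edge_point G e t)))" if e: "e \<in> edges G" for e
  proof (cases "e \<in> F")
    case True
    have "continuous_on {0..len G e} (\<lambda>t. \<Phi> (fst e) + (\<Phi> (snd e) - \<Phi> (fst e)) * S (3 / len G e * t + (-1)))"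
    proof (intro continuous_on_add continuous_on_mult continuous_on_const)
      have "continuous_on UNIV S" using contS by (intro continuous_at_imp_continuous_on) simp
      then show "continuous_on {0..len G e} (\<lambda>t. S (3 / len G e * t + (-1)))"
        by (rule continuous_on_compose2) (use edgeD(4)[OF e] in \<open>auto intro!: continuous_intros\<close>)
    qed
    then show ?thesis by (rule continuous_on_eq) (simp add: onF[OF True])
  next
    case False
    have "continuous_on {0..len G e} (\<lambda>_. \<Phi> (fst e))" by (rule continuous_on_const)
    then show ?thesis by (rule continuous_on_eq) (use False e off in simp)
  qed
  have "isCont \<phi> y" for y
  proof (cases "y \<in> \<iota> ` points G")
    case True
    then obtain p where p: "p \<in> points G" "y = \<iota> p" by blast
    show ?thesis unfolding p(2) by (rule isCont_point[OF p(1) cont_edge])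
  next
    case False
    then have yb: "y \<in> bdry G \<iota>" by (rule not_point_bdry)
    \<comment> \<open>Off the closed edges in \<open>F\<close> the function is the indicator of
      \<open>U\<close>, and an added point lies in the open set \<open>U\<close> or in the open set
      \<open>V\<close>; so the function is constant near it.\<close>
    define N where "N = - (\<Union>e\<in>F. closed_edge e)"
    have "closed (\<Union>e\<in>F. closed_edge e)"
      using finF closed_closed_edge by (intro closed_UN ballI) (auto simp: F_def)
    then have N: "open N" unfolding N_def by (rule open_Compl)
    have yN: "y \<in> N"
    proof -
      have "y \<notin> closed_edge e" if "e \<in> F" for e
        using that False closed_edge_cases[of e y] by (auto simp: F_def)
      then show ?thesis by (simp add: N_def)
    qed
    have val: "\<phi> z = (if z \<in> U then 1 else 0)" if "z \<in> N" for z
    proof (cases "z \<in> \<iota> ` points G")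
      case True
      then obtain x where x: "x \<in> points G" "z = \<iota> x" by blast
      show ?thesis using x(1)
      proof (cases rule: pointsE)
        case (1 v)
        then show ?thesis using x \<phi>i[OF x(1)] by (simp add: w_def \<Phi>_def)
      next
        case (2 e s)
        have "e \<notin> F"
        proof
          assume "e \<in> F"
          then have "z \<notin> closed_edge e" using \<open>z \<in> N\<close> by (simp add: N_def)
          then show False using Inner_in_closed_edge[OF 2(1-3)] 2(4) x(2) by simp
        qed
        then show ?thesis using x \<phi>i[OF x(1)] 2 by (simp add: w_def)
      qed
    qed (simp add: \<phi>_def)
    have "y \<in> U \<or> y \<in> V" using yb EU RV by blast
    then obtain c T where T: "open T" "y \<in> T" "\<And>z. z \<in> T \<Longrightarrow> c = \<phi> z"
    proof
      assume "y \<in> U"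
      then show thesis using that[of "U \<inter> N" 1] U N yN val by auto
    next
      assume "y \<in> V"
      moreover have "z \<notin> U" if "z \<in> V" for z using UV that by blast
      ultimately show thesis using that[of "V \<inter> N" 0] V N yN val by auto
    qed
    have "continuous_on T \<phi>" by (rule continuous_on_eq[OF continuous_on_const T(3)])
    then show ?thesis using T(1,2) by (simp add: continuous_on_eq_continuous_at)
  qed
  then have cont: "continuous_on UNIV \<phi>" by (simp add: continuous_on_eq_continuous_at)
  have oe: "on_edge G (\<phi> \<circ> \<iota>) e t = \<phi> (\<iota> (edge_point G e t))" for e t by (simp add: on_edge_def)
  have smooth: "(deriv ^^ n) (on_edge G (\<phi> \<circ> \<iota>) e) differentiable (at t)"
    if e: "e \<in> edges G" and t: "t \<in> {0<..<len G e}" for e t n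
  proof (cases "e \<in> F")
    case True
    show ?thesis
      by (rule differentiable_funpow_deriv_cong_open[OF open_greaterThanLessThan _ t
           smooth_affine_comp[where S = S and A = "\<Phi> (fst e)" and B = "\<Phi> (snd e) - \<Phi> (fst e)" and m = "3 / len G e" and k = "-1"]])
        (use S(3) onF[OF True] in \<open>auto simp: oe\<close>)
  next
    case False
    have "(\<lambda>t. \<Phi> (fst e) + 0 * S (0 * t + 0)) = (\<lambda>t. \<Phi> (fst e))" by simp
    show ?thesis
      by (rule differentiable_funpow_deriv_cong_open[OF open_greaterThanLessThan _ t
           smooth_affine_comp[where S = S and A = "\<Phi> (fst e)" and B = 0 and m = 0 and k = 0]])
        (use S(3) off[of e] False e in \<open>auto simp: oe\<close>)
  qed
  have der0: "deriv (on_edge G (\<phi> \<circ> \<iota>) e) t = 0"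
    if e: "e \<in> edges G" and t: "t \<in> T" and T: "open T" "T \<subseteq> {0<..<len G e}" "\<And>s. s \<in> T \<Longrightarrow> on_edge G (\<phi> \<circ> \<iota>) e s = c" for e t T c
  proof -
    have "(on_edge G (\<phi> \<circ> \<iota>) e has_real_derivative 0) (at t)"
      by (rule has_field_derivative_transform_within_open[OF DERIV_const T(1) t]) (simp add: T(3))
    then show ?thesis by (rule DERIV_imp_deriv)
  qed
  have offder: "deriv (on_edge G (\<phi> \<circ> \<iota>) e) t = 0" if "e \<in> edges G - F" "t \<in> {0<..<len G e}" for e t
    by (rule der0[of e t "{0<..<len G e}"]) (use that off[of e] in \<open>auto simp: oe\<close>)
  have near: "\<exists>N. open N \<and> \<iota> (Vertex v) \<in> N \<and>
     (\<forall>e\<in>edges G. \<forall>t\<in>{0<..<len G e}. \<iota> (Inner e t) \<in> N \<longrightarrow> deriv (on_edge G (\<phi> \<circ> \<iota>) e) t = 0)"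
    if v: "v \<in> verts G" for v
  proof -
    obtain \<rho> where \<rho>: "\<rho> > 0" "\<forall>x\<in>points G. graph_dist G (Vertex v) x < \<rho> \<longrightarrow> x = Vertex v \<or>
      (\<exists>e s. e \<in> incident G v \<and> x = Inner e s \<and> 0 < s \<and> s < len G e \<and>
       (fst e = v \<and> s \<le> graph_dist G (Vertex v) x \<or> snd e = v \<and> len G e - s \<le> graph_dist G (Vertex v) x))"
      using vertex_ball[OF v] by blast
    \<comment> \<open>A ball of this radius meets an edge only in its outer thirds, where the
      transition function is constant.\<close>
    define r where "r = Min (insert \<rho> ((\<lambda>e. len G e / 3) ` incident G v))"
    have fin: "finite (insert \<rho> ((\<lambda>e. len G e / 3) ` incident G v))" using finite_incident[OF v] by simp
    have r: "r > 0" unfolding r_def using fin \<rho>(1) edgeD(4) by (subst Min_gr_iff) (auto simp: incident_def)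
    have r\<rho>: "r \<le> \<rho>" unfolding r_def using fin by (intro Min_le) auto
    have rl: "r \<le> len G e / 3" if "e \<in> incident G v" for e unfolding r_def using fin that by (intro Min_le) auto
    show ?thesis
    proof (intro exI[of _ "ball (\<iota> (Vertex v)) r"] conjI ballI impI)
      fix e t assume e: "e \<in> edges G" and t: "t \<in> {0<..<len G e}" and b: "\<iota> (Inner e t) \<in> ball (\<iota> (Vertex v)) r"
      show "deriv (on_edge G (\<phi> \<circ> \<iota>) e) t = 0"
      proof (cases "e \<in> F")
        case True
        have l: "len G e > 0" by (rule edgeD(4)[OF e])
        have p: "Inner e t \<in> points G" using e t by (auto simp: points_def)
        have d: "graph_dist G (Vertex v) (Inner e t) < r" using b dist_eq[OF Vertex_in[OF v] p] by simp
        then have "e \<in> incident G v \<and> (t < len G e / 3 \<or> len G e - t < len G e / 3)"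
          using \<rho>(2)[rule_format, OF p] r\<rho> rl[of e] by auto
        then consider "t < len G e / 3" | "len G e * 2 / 3 < t" by argo
        then show ?thesis
        proof cases
          case 1
          show ?thesis
          proof (rule der0[OF e, of t "{0<..<len G e / 3}" "\<Phi> (fst e)"])
            fix s assume s: "s \<in> {0<..<len G e / 3}"
            then have "3 / len G e * s + (-1) \<le> 0" using l by (simp add: field_simps)
            then show "on_edge G (\<phi> \<circ> \<iota>) e s = \<Phi> (fst e)" using onF[OF True, of s] s l by (simp add: oe S(1))
          qed (use 1 t l in auto)
        next
          case 2
          show ?thesis
          proof (rule der0[OF e, of t "{len G e * 2 / 3<..<len G e}" "\<Phi> (snd e)"])
            fix s assume s: "s \<in> {len G e * 2 / 3<..<len G e}"
            then have "3 / len G e * s + (-1) \<ge> 1" using l by (simp add: field_simps)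
            moreover have "0 \<le> s" using s l by auto
            ultimately show "on_edge G (\<phi> \<circ> \<iota>) e s = \<Phi> (snd e)" using onF[OF True, of s] s by (simp add: oe S(2))
          qed (use 2 t l in auto)
        qed
      qed (use offder e t in auto)
    qed (use r in auto)
  qed
  have "\<phi> \<in> test_algebra G \<iota>"
    unfolding test_algebra_def using cont smooth offder near finF
    by (intro CollectI conjI ballI allI exI[of _ F]) (auto simp: F_def)
  moreover have "\<phi> y = (if y \<in> U then 1 else 0)" if y: "y \<in> bdry G \<iota>" for y
  proof (cases "y \<in> \<iota> ` points G")
    case True
    then obtain p where p: "p \<in> points G" "y = \<iota> p" by blast
    then obtain v where "p = Vertex v" using bdry_cases[OF p(1)] y by auto
    then show ?thesis using p \<phi>i[OF p(1)] by (simp add: w_def \<Phi>_def)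
  qed (simp add: \<phi>_def)
  moreover have "x \<in> U" "x \<in> bdry G \<iota>" if "x \<in> E" for x using that EU Esub by blast+
  moreover have "x \<notin> U" "x \<in> bdry G \<iota>" if "x \<in> bdry G \<iota> - E" for x using that RV UV by blast+
  ultimately have "is_cutoff G \<iota> E \<phi>" unfolding is_cutoff_def by simp
  then show ?thesis by blast
qed

end

section \<open>Integration over a graph\<close>

lemma integral_count_space_infsum:
  fixes f :: "'a \<Rightarrow> real"
  assumes "(\<lambda>x. \<bar>f x\<bar>) summable_on A"
  shows "integrable (count_space A) f" "(\<integral>x. f x \<partial>count_space A) = (\<Sum>\<^sub>\<infinity>x\<in>A. f x)"
proof -
  have *: "Infinite_Set_Sum.abs_summable_on f A"
    using assms by (simp add: abs_summable_equivalent[symmetric])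
  then show "integrable (count_space A) f" by (simp add: Infinite_Set_Sum.abs_summable_on_def)
  show "(\<integral>x. f x \<partial>count_space A) = (\<Sum>\<^sub>\<infinity>x\<in>A. f x)"
    using infsetsum_infsum[OF *] by (simp add: infsetsum_def)
qed

lemma summable_on_of_integrable_count_space:
  fixes f :: "'a \<Rightarrow> real"
  assumes "integrable (count_space A) f"
  shows "f summable_on A"
proof -
  have "Infinite_Set_Sum.abs_summable_on f A" using assms by (simp add: Infinite_Set_Sum.abs_summable_on_def)
  then have "(\<lambda>x. norm (f x)) summable_on A" by (simp add: abs_summable_equivalent[symmetric])
  then show ?thesis by (rule abs_summable_summable)
qed

lemma sigma_finite_lebesgue: "sigma_finite_measure (lebesgue :: real measure)"
proof
  obtain A :: "real set set" where A: "countable A" "A \<subseteq> sets lborel" "\<Union>A = space lborel" "\<forall>a\<in>A. emeasure lborel a \<noteq> \<infinity>"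
    using lborel.sigma_finite_countable by blast
  show "\<exists>A :: real set set. countable A \<and> A \<subseteq> sets lebesgue \<and> \<Union>A = space lebesgue \<and> (\<forall>a\<in>A. emeasure lebesgue a \<noteq> \<infinity>)"
    using A by (intro exI[of _ A] conjI ballI) auto
qed

lemma finite_large_terms:
  fixes f :: "'a \<Rightarrow> real"
  assumes "f summable_on A" "\<And>x. x \<in> A \<Longrightarrow> f x \<ge> 0" "\<epsilon> > 0"
  shows "finite {x \<in> A. \<epsilon> \<le> f x}"
proof (rule ccontr)
  assume inf: "infinite {x \<in> A. \<epsilon> \<le> f x}"
  obtain n :: nat where n: "infsum f A / \<epsilon> < real n" using reals_Archimedean2 by blast
  obtain B where B: "B \<subseteq> {x \<in> A. \<epsilon> \<le> f x}" "finite B" "card B = n"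
    using infinite_arbitrarily_large[OF inf] by blast
  have "real n * \<epsilon> = (\<Sum>x\<in>B. \<epsilon>)" using B by simp
  also have "\<dots> \<le> sum f B" using B by (intro sum_mono) auto
  also have "\<dots> \<le> infsum f A" using assms B by (intro finite_sum_le_infsum) auto
  finally show False using n assms(3) by (simp add: divide_less_eq)
qed

text \<open>Fubini for counting measure on the edges times Lebesgue measure. Summation over the
  edges is unconditional, so the second part asks for summable integrals of the absolute
  value.\<close>

lemma integrable_graph_measure:
  fixes h :: "'v edge \<Rightarrow> real \<Rightarrow> real"
  assumes E: "countable (edges G)"
  shows "integrable (graph_measure G) (\<lambda>(e, t). h e t) \<Longrightarrow>
      (\<lambda>e. LINT t:{0<..<len G e}|lebesgue. h e t) summable_on edges G"
    and "(\<And>e. e \<in> edges G \<Longrightarrow> set_integrable lebesgue {0<..<len G e} (h e)) \<Longrightarrow>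
      (\<lambda>e. LINT t:{0<..<len G e}|lebesgue. \<bar>h e t\<bar>) summable_on edges G \<Longrightarrow>
      (\<integral>(e, t). h e t \<partial>graph_measure G) = (\<Sum>\<^sub>\<infinity>e\<in>edges G. LINT t:{0<..<len G e}|lebesgue. h e t)"
proof -
  let ?C = "count_space (edges G)" and ?L = "lebesgue :: real measure"
  interpret C: sigma_finite_measure ?C by (rule sigma_finite_measure_count_space_countable[OF E])
  interpret L: sigma_finite_measure ?L by (rule sigma_finite_lebesgue)
  interpret pair_sigma_finite ?C ?L ..
  define A where "A = (SIGMA e:edges G. {0<..<len G e})"
  have A: "A \<in> sets (?C \<Otimes>\<^sub>M ?L)"
  proof -
    have "A = (\<Union>e\<in>edges G. {e} \<times> {0<..<len G e})" by (auto simp: A_def)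
    also have "\<dots> \<in> sets (?C \<Otimes>\<^sub>M ?L)" using E by (intro sets.countable_UN' pair_measureI) auto
    finally show ?thesis .
  qed
  then have A': "A \<inter> space (?C \<Otimes>\<^sub>M ?L) \<in> sets (?C \<Otimes>\<^sub>M ?L)" by (intro sets.Int sets.top)
  define H where "H p = indicat_real A p *\<^sub>R (case p of (e, t) \<Rightarrow> h e t)" for p
  have He: "H (e, t) = indicat_real {0<..<len G e} t *\<^sub>R h e t" if "e \<in> edges G" for e t
    using that by (auto simp: H_def A_def indicator_def)
  have Hint: "(\<integral>t. H (e, t) \<partial>?L) = (LINT t:{0<..<len G e}|lebesgue. h e t)" if "e \<in> edges G" for e
    by (simp add: set_lebesgue_integral_def He[OF that])
  have gm: "graph_measure G = restrict_space (?C \<Otimes>\<^sub>M ?L) A" by (simp add: graph_measure_def A_def)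
  {
    assume "integrable (graph_measure G) (\<lambda>(e, t). h e t)"
    then have "integrable (?C \<Otimes>\<^sub>M ?L) H"
      unfolding gm integrable_restrict_space[OF A'] H_def[abs_def] .
    from integrable_fst'[OF this] have "(\<lambda>e. \<integral>t. H (e, t) \<partial>?L) summable_on edges G"
      by (rule summable_on_of_integrable_count_space)
    then show "(\<lambda>e. LINT t:{0<..<len G e}|lebesgue. h e t) summable_on edges G"
      using summable_on_cong[of "edges G" "\<lambda>e. \<integral>t. H (e, t) \<partial>?L", OF Hint] by blast
  }
  assume h: "\<And>e. e \<in> edges G \<Longrightarrow> set_integrable lebesgue {0<..<len G e} (h e)"
    and s: "(\<lambda>e. LINT t:{0<..<len G e}|lebesgue. \<bar>h e t\<bar>) summable_on edges G"
  have sec: "integrable ?L (\<lambda>t. H (e, t))" if "e \<in> edges G" for e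
    using h[OF that] by (simp add: set_integrable_def He[OF that])
  have nrm: "(\<integral>t. norm (H (e, t)) \<partial>?L) = (LINT t:{0<..<len G e}|lebesgue. \<bar>h e t\<bar>)" if "e \<in> edges G" for e
    by (simp add: set_lebesgue_integral_def He[OF that] abs_mult)
  have I: "integrable (?C \<Otimes>\<^sub>M ?L) H"
  proof (rule Fubini_integrable)
    show "H \<in> borel_measurable (?C \<Otimes>\<^sub>M ?L)"
      by (rule measurable_pair_measure_countable1[OF E]) (use sec in auto)
    have "(\<lambda>e. \<integral>t. norm (H (e, t)) \<partial>?L) summable_on edges G"
      using s summable_on_cong[of "edges G" "\<lambda>e. \<integral>t. norm (H (e, t)) \<partial>?L", OF nrm] by blast
    then have "(\<lambda>e. \<bar>\<integral>t. norm (H (e, t)) \<partial>?L\<bar>) summable_on edges G"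
      by simp
    then show "integrable ?C (\<lambda>e. \<integral>t. norm (H (e, t)) \<partial>?L)" by (rule integral_count_space_infsum(1))
    show "AE e in ?C. integrable ?L (\<lambda>t. H (e, t))" using sec by (intro AE_I2) auto
  qed
  have sm: "(\<lambda>e. \<bar>\<integral>t. H (e, t) \<partial>?L\<bar>) summable_on edges G"
  proof (rule summable_on_comparison_test[OF s])
    fix e assume e: "e \<in> edges G"
    show "\<bar>\<integral>t. H (e, t) \<partial>?L\<bar> \<le> (LINT t:{0<..<len G e}|lebesgue. \<bar>h e t\<bar>)"
    proof -
      have "norm (\<integral>t. H (e, t) \<partial>?L) \<le> (\<integral>t. norm (H (e, t)) \<partial>?L)" by (rule integral_norm_bound)
      then show ?thesis unfolding nrm[OF e] by (simp only: real_norm_def)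
    qed
  qed simp
  have "(\<integral>(e, t). h e t \<partial>graph_measure G) = (\<integral>p. H p \<partial>(?C \<Otimes>\<^sub>M ?L))"
    unfolding gm integral_restrict_space[OF A'] H_def[abs_def] ..
  also have "\<dots> = (\<integral>e. (\<integral>t. H (e, t) \<partial>?L) \<partial>?C)" by (rule integral_fst'[OF I, symmetric])
  also have "\<dots> = (\<Sum>\<^sub>\<infinity>e\<in>edges G. \<integral>t. H (e, t) \<partial>?L)" by (rule integral_count_space_infsum(2)[OF sm])
  also have "\<dots> = (\<Sum>\<^sub>\<infinity>e\<in>edges G. LINT t:{0<..<len G e}|lebesgue. h e t)"
    by (rule infsum_cong) (rule Hint)
  finally show "(\<integral>(e, t). h e t \<partial>graph_measure G) = (\<Sum>\<^sub>\<infinity>e\<in>edges G. LINT t:{0<..<len G e}|lebesgue. h e t)" .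
qed

section \<open>The Dirichlet problem\<close>

locale dirichlet_graph = weakly_connected_graph +
  fixes q
  assumes bdry_ne: "bdry G \<iota> \<noteq> {}" and potential: "admissible_potential G q"
begin

lemma countable_edges: "countable (edges G)"
proof -
  have "countable (verts G \<times> verts G)" "edges G \<subseteq> verts G \<times> verts G"
    using graph by (auto simp: is_metric_graph_def)
  then show ?thesis using countable_subset by blast
qed

lemma edge_interval: "e \<in> edges G \<Longrightarrow> schroedinger_interval (on_edge G q e) (len G e)"
proof
  assume e: "e \<in> edges G"
  show "len G e > 0" by (rule edgeD(4)[OF e])
  show "0 \<le> on_edge G q e t" for t using potential edge_point_in[OF e] by (auto simp: admissible_potential_def on_edge_def)
  show "on_edge G q e absolutely_integrable_on {0..len G e}"
    using potential e by (auto simp: admissible_potential_def)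
qed

definition total_q :: "'a edge \<Rightarrow> real" where
  "total_q e = integral {0..len G e} (on_edge G q e)"

lemma total_q_eq:
  assumes "e \<in> edges G"
  shows "(LINT t:{0<..<len G e}|lebesgue. on_edge G q e t) = total_q e"
    "set_integrable lebesgue {0<..<len G e} (on_edge G q e)"
proof -
  interpret schroedinger_interval "on_edge G q e" "len G e" by (rule edge_interval[OF assms])
  show *: "set_integrable lebesgue {0<..<len G e} (on_edge G q e)"
    by (rule set_integrable_subset[OF q]) auto
  show "(LINT t:{0<..<len G e}|lebesgue. on_edge G q e t) = total_q e"
    unfolding total_q_def set_lebesgue_integral_eq_integral(2)[OF *] by (rule integral_open_interval_real[symmetric])
qed

lemma total_q_nonneg: "e \<in> edges G \<Longrightarrow> total_q e \<ge> 0"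
  unfolding total_q_def using schroedinger_interval.q0[OF edge_interval] schroedinger_interval.q_integrable[OF edge_interval]
  by (intro integral_nonneg) auto

lemma summable_total_q: "total_q summable_on edges G"
proof -
  have "integrable (graph_measure G) (\<lambda>(e, t). on_edge G q e t)" using potential by (simp add: admissible_potential_def)
  from integrable_graph_measure(1)[OF countable_edges this] show ?thesis
    using summable_on_cong[of "edges G" _ total_q, OF total_q_eq(1)] by blast
qed

text \<open>By connectedness an isolated vertex would be the whole graph, and then the boundary
  would be empty.\<close>

lemma incident_ne: "v \<in> verts G \<Longrightarrow> incident G v \<noteq> {}"
proof
  assume v: "v \<in> verts G" and em: "incident G v = {}"
  have "y = Vertex v" if "path_length G x r y" "x = Vertex v" for x r y
    using that
  proof (induction rule: path_length.induct)
    case (extend x r e s t)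
    then have "edge_point G e s = Vertex v" by blast
    then have "e \<in> incident G v" using extend.hyps(2) by (auto simp: edge_point_def incident_def split: if_splits)
    then show ?case using em by blast
  qed simp
  moreover have "\<exists>r. path_length G (Vertex v) r y" if "y \<in> points G" for y
    using conn Vertex_in[OF v] that by (auto simp: graph_connected_def)
  ultimately have "points G \<subseteq> {Vertex v}" by blast
  then have "verts G \<subseteq> {v}" using Vertex_in by auto
  then have "finite (verts G)" "\<And>w. w \<in> verts G \<Longrightarrow> degree G w \<noteq> 1"
    using em finite_subset by (auto simp: degree_def)
  then show False using bdry_empty_if_finite bdry_ne by blast
qed

lemma degree_cases: "v \<in> verts G \<Longrightarrow> degree G v = 1 \<or> 2 \<le> degree G v"
  using incident_ne[of v] finite_incident[of v] unfolding degree_def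
  by (metis One_nat_def Suc_1 Suc_leI card_gt_0_iff le_neq_implies_less)

abbreviation "leaves \<equiv> {v \<in> verts G. degree G v = 1}"

text \<open>Infinitely many such vertices would accumulate by compactness. The limit keeps
  \<open>\<epsilon> \<le> \<bar>h y\<bar>\<close>, so it lies off the boundary and is a graph point;
  but a small ball around a graph point contains no other vertex.\<close>

lemma finite_vertices_away_from_bdry:
  fixes h :: "'b \<Rightarrow> real"
  assumes h: "continuous_on UNIV h" and h0: "\<And>y. y \<in> bdry G \<iota> \<Longrightarrow> h y = 0" and "\<epsilon> > 0"
  shows "finite {v \<in> verts G. \<epsilon> \<le> \<bar>h (\<iota> (Vertex v))\<bar>}"
proof (rule ccontr)
  assume inf: "infinite {v \<in> verts G. \<epsilon> \<le> \<bar>h (\<iota> (Vertex v))\<bar>}" (is "infinite ?V")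
  define X where "X = (\<lambda>v. \<iota> (Vertex v)) ` ?V"
  have "inj_on (\<lambda>v. \<iota> (Vertex v)) ?V"
  proof (rule inj_onI)
    fix v w assume "v \<in> ?V" "w \<in> ?V" "\<iota> (Vertex v) = \<iota> (Vertex w)"
    then show "v = w" using iota_inj[OF Vertex_in Vertex_in, of v w] by simp
  qed
  then have "infinite X" unfolding X_def using inf finite_imageD by blast
  then obtain y where y: "y islimpt X"
    using compact_UNIV[unfolded compact_eq_Bolzano_Weierstrass] by blast
  have "closed {y. \<epsilon> \<le> \<bar>h y\<bar>}"
    using h by (intro closed_Collect_le continuous_intros) auto
  moreover have "X \<subseteq> {y. \<epsilon> \<le> \<bar>h y\<bar>}" by (auto simp: X_def)
  ultimately have "\<epsilon> \<le> \<bar>h y\<bar>" using y closed_limpt islimpt_subset by blast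
  then have "y \<notin> bdry G \<iota>" using h0 \<open>\<epsilon> > 0\<close> by auto
  then obtain p where p: "p \<in> points G" "y = \<iota> p" using not_point_bdry by blast
  obtain \<rho> F where \<rho>: "\<rho> > 0" "\<And>z. dist (\<iota> p) z < \<rho> \<Longrightarrow>
     \<exists>x\<in>points G. z = \<iota> x \<and> (x = p \<or> (\<exists>e\<in>F. \<exists>s. 0 < s \<and> s < len G e \<and> x = Inner e s))"
    using local_structure[OF p(1)] by metis
  obtain z where z: "z \<in> X" "z \<noteq> y" "dist z y < \<rho>" using y \<rho>(1) unfolding islimpt_approachable by blast
  obtain v where v: "v \<in> verts G" "z = \<iota> (Vertex v)" using z(1) by (auto simp: X_def)
  have "dist (\<iota> p) z < \<rho>" using z(3) p(2) by (simp add: dist_commute)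
  from \<rho>(2)[OF this] obtain x where x: "x \<in> points G" "z = \<iota> x" "x = p \<or> (\<exists>e s. x = Inner e s)" by blast
  have "x = Vertex v" using iota_inj[OF x(1) Vertex_in[OF v(1)]] x(2) v(2) by simp
  then show False using x p z(2) by auto
qed

end

locale graph_edge_basis = dirichlet_graph +
  fixes y0 y0' y1 y1' :: "'a edge \<Rightarrow> real \<Rightarrow> real" and c k0 k1 :: "'a edge \<Rightarrow> real"
  assumes basis0: "e \<in> edges G \<Longrightarrow> ode_sol (on_edge G q e) (len G e) (y0 e) (y0' e) \<and>
      y0 e 0 = 1 \<and> y0 e (len G e) = 0 \<and> y0' e 0 = - c e - k0 e \<and> y0' e (len G e) = - c e"
    and basis1: "e \<in> edges G \<Longrightarrow> ode_sol (on_edge G q e) (len G e) (y1 e) (y1' e) \<and>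
      y1 e 0 = 0 \<and> y1 e (len G e) = 1 \<and> y1' e 0 = c e \<and> y1' e (len G e) = c e + k1 e"
    and coeffs: "e \<in> edges G \<Longrightarrow> c e > 0 \<and> k0 e \<ge> 0 \<and> k1 e \<ge> 0 \<and> k0 e + k1 e \<le> total_q e"
    and basis_sum: "e \<in> edges G \<Longrightarrow> t \<in> {0..len G e} \<Longrightarrow> 1 - len G e * total_q e \<le> y0 e t + y1 e t"
begin

sublocale network "edges G" c k0 k1
  using coeffs by unfold_locales auto

definition ext :: "('a \<Rightarrow> real) \<Rightarrow> 'a point \<Rightarrow> real" where
  "ext f x = (case x of Vertex v \<Rightarrow> f v | Inner e t \<Rightarrow> f (fst e) * y0 e t + f (snd e) * y1 e t)"

lemma ext_edge_point:
  "e \<in> edges G \<Longrightarrow> t \<in> {0..len G e} \<Longrightarrow>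
    ext f (edge_point G e t) = f (fst e) * y0 e t + f (snd e) * y1 e t"
  using basis0[of e] basis1[of e] edgeD(4)[of e] by (auto simp: ext_def edge_point_def)

lemma ode_sol_ext:
  "e \<in> edges G \<Longrightarrow> ode_sol (on_edge G q e) (len G e)
     (\<lambda>t. f (fst e) * y0 e t + f (snd e) * y1 e t) (\<lambda>t. f (fst e) * y0' e t + f (snd e) * y1' e t)"
  using basis0[of e] basis1[of e] by (intro ode_sol_lincomb) auto

lemma ext_deriv_ends:
  assumes "e \<in> edges G"
  shows "f (fst e) * y0' e 0 + f (snd e) * y1' e 0 = c e * (f (snd e) - f (fst e)) - k0 e * f (fst e)"
    "f (fst e) * y0' e (len G e) + f (snd e) * y1' e (len G e) = c e * (f (snd e) - f (fst e)) + k1 e * f (snd e)"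
proof -
  have v: "y0' e 0 = - c e - k0 e" "y0' e (len G e) = - c e" "y1' e 0 = c e" "y1' e (len G e) = c e + k1 e"
    using basis0[OF assms] basis1[OF assms] by blast+
  show "f (fst e) * y0' e 0 + f (snd e) * y1' e 0 = c e * (f (snd e) - f (fst e)) - k0 e * f (fst e)"
    "f (fst e) * y0' e (len G e) + f (snd e) * y1' e (len G e) = c e * (f (snd e) - f (fst e)) + k1 e * f (snd e)"
    unfolding v by (simp_all add: algebra_simps)
qed

lemma basis_values:
  assumes "e \<in> edges G"
  shows "y0 e 0 = 1" "y0 e (len G e) = 0" "y1 e 0 = 0" "y1 e (len G e) = 1"
  using basis0[OF assms] basis1[OF assms] by auto

text \<open>Compares the edge form with the energy of linear interpolation, which bounds differences
  of vertex values along paths.\<close>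

lemma edge_form_ge:
  assumes e: "e \<in> edges G"
  shows "(f (snd e) - f (fst e))\<^sup>2 / len G e \<le> edge_form e f f"
  using schroedinger_interval.ode_energy_bound[OF edge_interval[OF e] ode_sol_ext[OF e, of f]]
  unfolding ext_deriv_ends[OF e] basis_values[OF e] by (simp add: edge_form_def algebra_simps)

lemma basis_bounds:
  assumes e: "e \<in> edges G" and t: "t \<in> {0..len G e}"
  shows "0 \<le> y0 e t" "0 \<le> y1 e t" "y0 e t + y1 e t \<le> 1"
proof -
  interpret schroedinger_interval "on_edge G q e" "len G e" by (rule edge_interval[OF e])
  show "0 \<le> y0 e t" "0 \<le> y1 e t"
    by (rule ode_nonneg[OF basis0[OF e, THEN conjunct1] _ _ t]; use basis0[OF e] in simp)
      (rule ode_nonneg[OF basis1[OF e, THEN conjunct1] _ _ t]; use basis1[OF e] in simp)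
  have "1 * y0 e t + 1 * y1 e t \<le> 1"
    by (rule ode_le[OF ode_sol_lincomb[OF basis0[OF e, THEN conjunct1] basis1[OF e, THEN conjunct1]] _ _ _ t])
      (use basis0[OF e] basis1[OF e] in simp_all)
  then show "y0 e t + y1 e t \<le> 1" by simp
qed

abbreviation "D0 \<equiv> dirichlet_space (verts G) leaves"

text \<open>Differences of values are bounded by the energy, so it suffices that \<open>g\<close> is
  arbitrarily small at some vertex: at a leaf, or, when there are no leaves, at one of the
  infinitely many vertices by the decay condition.\<close>

lemma poincare: "\<exists>C. \<forall>g\<in>D0. \<forall>v\<in>verts G. (g v)\<^sup>2 \<le> C * energy g g"
proof -
  obtain R where R: "R > 0" "\<And>g v z. v \<in> verts G \<Longrightarrow> z \<in> verts G \<Longrightarrow> \<exists>F. finite F \<and> F \<subseteq> edges G \<and>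
     (g v - g z)\<^sup>2 \<le> R * (\<Sum>e\<in>F. (g (snd e) - g (fst e))\<^sup>2 / len G e)"
    using vertex_energy_bound by blast
  have "(g v)\<^sup>2 \<le> R * energy g g" if g: "g \<in> D0" and v: "v \<in> verts G" for g v
  proof -
    have fin: "finite_energy g" using g by (simp add: dirichlet_space_def)
    have diff: "(g v - g z)\<^sup>2 \<le> R * energy g g" if z: "z \<in> verts G" for z
    proof -
      obtain F where F: "finite F" "F \<subseteq> edges G"
        "(g v - g z)\<^sup>2 \<le> R * (\<Sum>e\<in>F. (g (snd e) - g (fst e))\<^sup>2 / len G e)" using R(2)[OF v z] by blast
      have "(\<Sum>e\<in>F. (g (snd e) - g (fst e))\<^sup>2 / len G e) \<le> (\<Sum>e\<in>F. edge_form e g g)"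
        using F(2) by (intro sum_mono edge_form_ge) auto
      also have "\<dots> \<le> energy g g" unfolding energy_def
        using F(1,2) fin edge_form_nonneg by (intro finite_sum_le_infsum) (auto simp: finite_energy_def)
      finally show ?thesis using F(3) R(1) by (meson less_imp_le mult_left_mono order_trans)
    qed
    have "\<bar>g v\<bar> \<le> sqrt (R * energy g g) + \<epsilon>" if \<epsilon>: "\<epsilon> > 0" for \<epsilon>
    proof -
      have "\<exists>z\<in>verts G. \<bar>g z\<bar> \<le> \<epsilon>"
      proof (cases "leaves = {}")
        case True
        have "infinite (verts G)"
        proof
          assume "finite (verts G)"
          then have "bdry G \<iota> = {}" by (rule bdry_empty_if_finite) (use True in blast)
          then show False using bdry_ne by blast
        qed
        moreover have "finite {v \<in> verts G. \<epsilon> \<le> \<bar>g v\<bar>}" using g \<epsilon> by (simp add: dirichlet_space_def)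
        ultimately have "verts G \<noteq> {v \<in> verts G. \<epsilon> \<le> \<bar>g v\<bar>}" by metis
        then show ?thesis by (auto intro: less_imp_le simp: not_le)
      next
        case False
        then obtain z where "z \<in> leaves" by blast
        then show ?thesis using g \<epsilon> by (intro bexI[of _ z]) (auto simp: dirichlet_space_def)
      qed
      then obtain z where z: "z \<in> verts G" "\<bar>g z\<bar> \<le> \<epsilon>" by blast
      have "\<bar>g v - g z\<bar> \<le> sqrt (R * energy g g)" using diff[OF z(1)] real_le_rsqrt by (metis power2_abs)
      then show ?thesis using z(2) by linarith
    qed
    then have "\<bar>g v\<bar> \<le> sqrt (R * energy g g)" by (rule field_le_epsilon)
    then have "\<bar>g v\<bar>\<^sup>2 \<le> (sqrt (R * energy g g))\<^sup>2" by (intro power_mono) auto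
    then show ?thesis using R(1) energy_nonneg[of g] by simp
  qed
  then show ?thesis by blast
qed

section \<open>Test functions\<close>

lemma continuous_bounded:
  fixes \<phi> :: "'b \<Rightarrow> real"
  assumes "continuous_on UNIV \<phi>"
  obtains M where "M > 0" "\<And>y. \<bar>\<phi> y\<bar> \<le> M"
proof -
  have "bounded (range \<phi>)"
    using assms compact_UNIV by (intro compact_imp_bounded compact_continuous_image)
  then obtain B where "\<And>y. \<bar>\<phi> y\<bar> \<le> B" unfolding bounded_real by auto
  then have "\<bar>\<phi> y\<bar> \<le> \<bar>B\<bar> + 1" for y by (rule order_trans) simp
  then show thesis by (intro that[of "\<bar>B\<bar> + 1"]) auto
qed

lemma test_algebra_continuous: "\<phi> \<in> test_algebra G \<iota> \<Longrightarrow> continuous_on UNIV \<phi>"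
  by (simp add: test_algebra_def)

lemma test_algebra_edge:
  assumes \<phi>: "\<phi> \<in> test_algebra G \<iota>" and e: "e \<in> edges G"
  shows "continuous_on {0..len G e} (on_edge G (\<phi> \<circ> \<iota>) e)"
    and "0 < t \<Longrightarrow> t < len G e \<Longrightarrow> (deriv ^^ n) (on_edge G (\<phi> \<circ> \<iota>) e) differentiable (at t)"
    and "\<exists>d>0. \<forall>t. 0 < t \<longrightarrow> t < len G e \<longrightarrow> t < d \<or> len G e - d < t \<longrightarrow> deriv (on_edge G (\<phi> \<circ> \<iota>) e) t = 0"
proof -
  have c: "continuous_on UNIV \<phi>" using \<phi> by (simp add: test_algebra_def)
  show "continuous_on {0..len G e} (on_edge G (\<phi> \<circ> \<iota>) e)"
    unfolding on_edge_def[abs_def] comp_def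
    by (rule continuous_on_compose2[OF c continuous_on_edge[OF e]]) auto
  show "0 < t \<Longrightarrow> t < len G e \<Longrightarrow> (deriv ^^ n) (on_edge G (\<phi> \<circ> \<iota>) e) differentiable (at t)"
    using \<phi> e by (auto simp: test_algebra_def)
  have nb: "\<forall>v\<in>verts G. \<exists>N. open N \<and> \<iota> (Vertex v) \<in> N \<and>
        (\<forall>e\<in>edges G. \<forall>t\<in>{0<..<len G e}.
           \<iota> (Inner e t) \<in> N \<longrightarrow> deriv (on_edge G (\<phi> \<circ> \<iota>) e) t = 0)"
    using \<phi> unfolding test_algebra_def mem_Collect_eq by (elim conjE)
  have near: "\<exists>d>0. \<forall>t. 0 < t \<longrightarrow> t < len G e \<longrightarrow> \<bar>t - s\<bar> < d \<longrightarrow> deriv (on_edge G (\<phi> \<circ> \<iota>) e) t = 0"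
    if s: "s \<in> {0..len G e}" "edge_point G e s = Vertex v" "v \<in> verts G" for s v
  proof -
    obtain N where N: "open N" "\<iota> (Vertex v) \<in> N" "\<And>t. t \<in> {0<..<len G e} \<Longrightarrow> \<iota> (Inner e t) \<in> N \<Longrightarrow> deriv (on_edge G (\<phi> \<circ> \<iota>) e) t = 0"
      using bspec[OF nb s(3)] e by blast
    obtain d where d: "d > 0" "ball (\<iota> (Vertex v)) d \<subseteq> N" using N open_contains_ball by blast
    show ?thesis
    proof (intro exI[of _ d] conjI allI impI d(1))
      fix t assume t: "0 < t" "t < len G e" "\<bar>t - s\<bar> < d"
      have "dist (\<iota> (edge_point G e s)) (\<iota> (edge_point G e t)) \<le> \<bar>s - t\<bar>"
        using dist_edge_point[OF e s(1)] t by simp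
      then have "\<iota> (Inner e t) \<in> ball (\<iota> (Vertex v)) d"
        using t edge_point_simps(3)[OF e] s(2) by (simp add: abs_minus_commute)
      then show "deriv (on_edge G (\<phi> \<circ> \<iota>) e) t = 0" using N(3)[of t] d(2) t by auto
    qed
  qed
  obtain d1 where d1: "d1 > 0" "\<And>t. 0 < t \<Longrightarrow> t < len G e \<Longrightarrow> \<bar>t - 0\<bar> < d1 \<Longrightarrow> deriv (on_edge G (\<phi> \<circ> \<iota>) e) t = 0"
    using near[of 0 "fst e"] edge_point_simps(1)[OF e] edgeD[OF e] by auto
  obtain d2 where d2: "d2 > 0" "\<And>t. 0 < t \<Longrightarrow> t < len G e \<Longrightarrow> \<bar>t - len G e\<bar> < d2 \<Longrightarrow> deriv (on_edge G (\<phi> \<circ> \<iota>) e) t = 0"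
    using near[of "len G e" "snd e"] edge_point_simps(2)[OF e] edgeD[OF e] by auto
  show "\<exists>d>0. \<forall>t. 0 < t \<longrightarrow> t < len G e \<longrightarrow> t < d \<or> len G e - d < t \<longrightarrow> deriv (on_edge G (\<phi> \<circ> \<iota>) e) t = 0"
    using d1 d2 by (intro exI[of _ "min d1 d2"]) auto
qed

lemma test_algebra_locally_constant:
  assumes \<phi>: "\<phi> \<in> test_algebra G \<iota>"
  obtains F where "finite F" "F \<subseteq> edges G"
    "\<And>e t. e \<in> edges G \<Longrightarrow> e \<notin> F \<Longrightarrow> t \<in> {0..len G e} \<Longrightarrow> \<phi> (\<iota> (edge_point G e t)) = \<phi> (\<iota> (Vertex (fst e)))"
proof -
  obtain F where F: "finite F" "F \<subseteq> edges G" "\<And>e t. e \<in> edges G - F \<Longrightarrow> t \<in> {0<..<len G e} \<Longrightarrow> deriv (on_edge G (\<phi> \<circ> \<iota>) e) t = 0"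
    using \<phi> unfolding test_algebra_def by blast
  have "\<phi> (\<iota> (edge_point G e t)) = \<phi> (\<iota> (Vertex (fst e)))" if e: "e \<in> edges G" "e \<notin> F" and t: "t \<in> {0..len G e}" for e t
  proof -
    let ?f = "on_edge G (\<phi> \<circ> \<iota>) e"
    have "?f t = ?f 0"
    proof (rule DERIV_isconst2[of 0 "len G e" ?f t])
      show "0 < len G e" by (rule edgeD(4)[OF e(1)])
      show "continuous_on {0..len G e} ?f" by (rule test_algebra_edge(1)[OF \<phi> e(1)])
      show "(?f has_real_derivative 0) (at x)" if "0 < x" "x < len G e" for x
        using test_algebra_edge(2)[OF \<phi> e(1) that, of 0] F(3)[of e x] e that
        by (metis DERIV_deriv_iff_real_differentiable DiffI funpow_0 greaterThanLessThan_iff)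
    qed (use t in auto)
    then show ?thesis using edge_point_simps(1)[OF e(1)] by (simp add: on_edge_def)
  qed
  then show thesis using that F by blast
qed

text \<open>Outside a finite set of edges the test function is constant along the edge, the edge
  form reduces to \<open>k0 + k1\<close> times a square, and this is dominated by the summable
  integrals of \<open>q\<close>.\<close>

lemma finite_energy_test:
  assumes \<phi>: "\<phi> \<in> test_algebra G \<iota>"
  shows "finite_energy (\<lambda>v. \<phi> (\<iota> (Vertex v)))" (is "finite_energy ?\<Phi>")
proof -
  obtain M where M: "M > 0" "\<And>y. \<bar>\<phi> y\<bar> \<le> M" using continuous_bounded[OF test_algebra_continuous[OF \<phi>]] by blast
  obtain F where F: "finite F" "F \<subseteq> edges G"
    "\<And>e t. e \<in> edges G \<Longrightarrow> e \<notin> F \<Longrightarrow> t \<in> {0..len G e} \<Longrightarrow> \<phi> (\<iota> (edge_point G e t)) = \<phi> (\<iota> (Vertex (fst e)))"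
    using test_algebra_locally_constant[OF \<phi>] by blast
  have sq: "\<phi> y * \<phi> y \<le> M * M" for y
    using M(2)[of y] M(1) abs_mult_self_eq[of "\<phi> y"] mult_mono[of "\<bar>\<phi> y\<bar>" M "\<bar>\<phi> y\<bar>" M] by simp
  show ?thesis
  proof (rule finite_energyI)
    show "edge_form e ?\<Phi> ?\<Phi> \<le> M * M * total_q e + (if e \<in> F then edge_form e ?\<Phi> ?\<Phi> else 0)" if e: "e \<in> edges G" for e
    proof (cases "e \<in> F")
      case True
      then show ?thesis using total_q_nonneg[OF e] M(1) by simp
    next
      case False
      have l: "len G e \<in> {0..len G e}" using edgeD(4)[OF e] by simp
      have "?\<Phi> (snd e) = ?\<Phi> (fst e)" using F(3)[OF e False l] edge_point_simps(2)[OF e] by simp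
      then have "edge_form e ?\<Phi> ?\<Phi> = (k0 e + k1 e) * (?\<Phi> (fst e) * ?\<Phi> (fst e))"
        by (simp add: edge_form_def algebra_simps)
      also have "\<dots> \<le> total_q e * (M * M)"
        by (rule mult_mono) (use coeffs[OF e] sq total_q_nonneg[OF e] in auto)
      finally show ?thesis using False by (simp add: mult.commute)
    qed
    have "(\<lambda>e. if e \<in> F then edge_form e ?\<Phi> ?\<Phi> else 0) summable_on F" using F(1) by simp
    then have "(\<lambda>e. if e \<in> F then edge_form e ?\<Phi> ?\<Phi> else 0) summable_on edges G"
      by (rule summable_on_cong_neutral[THEN iffD1, rotated -1]) (use F(2) in auto)
    then show "(\<lambda>e. M * M * total_q e + (if e \<in> F then edge_form e ?\<Phi> ?\<Phi> else 0)) summable_on edges G"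
      by (intro summable_on_add summable_on_cmult_right summable_total_q)
  qed
qed

text \<open>The way into \<open>D0\<close>: the decay condition cannot be checked edge by edge and
  comes from compactness, through a continuous function on the completion.\<close>

lemma D0_of_continuous:
  assumes "continuous_on UNIV h" "\<And>y. y \<in> bdry G \<iota> \<Longrightarrow> h y = 0" "\<And>v. v \<in> verts G \<Longrightarrow> g v = h (\<iota> (Vertex v))"
    and "finite_energy g"
  shows "g \<in> D0"
proof -
  have "finite {v \<in> verts G. \<epsilon> \<le> \<bar>g v\<bar>}" if "\<epsilon> > 0" for \<epsilon>
  proof -
    have "{v \<in> verts G. \<epsilon> \<le> \<bar>g v\<bar>} = {v \<in> verts G. \<epsilon> \<le> \<bar>h (\<iota> (Vertex v))\<bar>}" using assms(3) by auto
    then show ?thesis using finite_vertices_away_from_bdry[OF assms(1,2) that] by simp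
  qed
  moreover have "g v = 0" if "v \<in> leaves" for v
  proof -
    have "\<iota> (Vertex v) \<in> bdry G \<iota>" using that by (auto simp: bdry_def)
    then show ?thesis using assms(2,3) that by simp
  qed
  ultimately show ?thesis using assms(4) by (simp add: dirichlet_space_def)
qed

section \<open>Existence of the harmonic extension\<close>

lemma normal_deriv_ode:
  assumes e: "e \<in> edges G" and sol: "ode_sol r (len G e) (on_edge G u e) y'"
  shows "normal_deriv G u e (fst e) = y' 0" "normal_deriv G u e (snd e) = - y' (len G e)"
proof -
  have l: "len G e > 0" by (rule edgeD(4)[OF e])
  have "vector_derivative (on_edge G u e) (at s within {0..len G e}) = y' s" if "s \<in> {0..len G e}" for s
    by (rule vector_derivative_within_closed_interval[OF l that])
      (use ode_solD(1)[OF sol that] in \<open>simp add: has_real_derivative_iff_has_vector_derivative\<close>)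
  then show "normal_deriv G u e (fst e) = y' 0" "normal_deriv G u e (snd e) = - y' (len G e)"
    using l edgeD(3)[OF e] by (auto simp: normal_deriv_def)
qed

lemma ode_sol_cong:
  assumes "ode_sol r l y y'" "\<And>t. t \<in> {0..l} \<Longrightarrow> y t = z t"
  shows "ode_sol r l z y'"
  unfolding ode_sol_def
proof (intro conjI ballI)
  fix t assume t: "t \<in> {0..l}"
  show "(z has_real_derivative y' t) (at t within {0..l})"
    by (rule has_field_derivative_transform_within[OF ode_solD(1)[OF assms(1) t] zero_less_one t]) (use assms(2) in auto)
next
  show "abs_continuous_on y' 0 l" by (rule ode_solD(2)[OF assms(1)])
  have "AE t in lebesgue_on {0..l}. t \<in> {0..l}" by (rule AE_I2) auto
  with ode_solD(3)[OF assms(1)] show "AE t in lebesgue_on {0..l}. (y' has_real_derivative r t * z t) (at t within {0..l})"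
    by eventually_elim (use assms(2) in auto)
qed

lemma ode_sol_ext_on_edge:
  assumes e: "e \<in> edges G" and u: "\<And>x. x \<in> points G \<Longrightarrow> u (\<iota> x) = ext f x"
  shows "ode_sol (on_edge G q e) (len G e) (on_edge G (u \<circ> \<iota>) e) (\<lambda>t. f (fst e) * y0' e t + f (snd e) * y1' e t)"
  by (rule ode_sol_cong[OF ode_sol_ext[OF e]]) (simp add: on_edge_def u edge_point_in[OF e] ext_edge_point[OF e])

text \<open>The minimizer provides vertex values only. The difference of its edge interpolation and
  the cutoff is small off finitely many edges and therefore extends continuously by \<open>0\<close>
  to the added points; so the boundary values are those of the cutoff.\<close>

lemma harmonic_extension_exists:
  assumes \<phi>: "is_cutoff G \<iota> \<Omega> \<phi>" and \<Omega>: "\<Omega> \<subseteq> bdry G \<iota>"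
  obtains f u where "finite_energy f" "\<And>\<psi>. \<psi> \<in> D0 \<Longrightarrow> energy f \<psi> = 0"
    "is_harmonic_extension G \<iota> q (indicator \<Omega>) u" "\<And>x. x \<in> points G \<Longrightarrow> u (\<iota> x) = ext f x"
proof -
  have \<phi>A: "\<phi> \<in> test_algebra G \<iota>" using \<phi> by (simp add: is_cutoff_def)
  define \<Phi> where "\<Phi> v = \<phi> (\<iota> (Vertex v))" for v
  have fin\<Phi>: "finite_energy \<Phi>" unfolding \<Phi>_def[abs_def] by (rule finite_energy_test[OF \<phi>A])
  obtain C where C: "\<And>g v. g \<in> D0 \<Longrightarrow> v \<in> verts G \<Longrightarrow> (g v)\<^sup>2 \<le> C * energy g g" using poincare by blast
  have EV: "edges G \<subseteq> verts G \<times> verts G" using graph by (simp add: is_metric_graph_def)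
  have "\<exists>f. (\<lambda>v. f v - \<Phi> v) \<in> D0 \<and> finite_energy f \<and> (\<forall>\<psi>\<in>D0. energy f \<psi> = 0)"
  proof (rule dirichlet_principle)
    show "finite_energy g" if "g \<in> D0" for g using that by (simp add: dirichlet_space_def)
    show "(\<lambda>_. 0) \<in> D0" by (simp add: dirichlet_space_def finite_energy_def edge_form_def)
    show "(\<lambda>v. a * f v + b * g v) \<in> D0" if "f \<in> D0" "g \<in> D0" for f g a b
      by (rule dirichlet_space_lin[OF that])
    show "\<exists>h\<in>D0. (\<lambda>n. energy (\<lambda>v. h v - g n v) (\<lambda>v. h v - g n v)) \<longlonglongrightarrow> 0"
      if "\<And>n. g n \<in> D0" "\<And>\<epsilon>. \<epsilon> > 0 \<Longrightarrow> \<exists>N. \<forall>m\<ge>N. \<forall>n\<ge>N. energy (\<lambda>v. g m v - g n v) (\<lambda>v. g m v - g n v) < \<epsilon>" for g :: "nat \<Rightarrow> 'a \<Rightarrow> real"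
      by (rule dirichlet_space_complete[OF EV _ C that]) auto
  qed (rule fin\<Phi>)
  then obtain f where f: "(\<lambda>v. f v - \<Phi> v) \<in> D0" "finite_energy f" "\<And>\<psi>. \<psi> \<in> D0 \<Longrightarrow> energy f \<psi> = 0" by blast
  define g where "g v = f v - \<Phi> v" for v
  have g: "g \<in> D0" using f(1) by (simp add: g_def[abs_def])
  obtain M where M: "M > 0" "\<And>y. \<bar>\<phi> y\<bar> \<le> M" using continuous_bounded[OF test_algebra_continuous[OF \<phi>A]] by blast
  obtain F where F: "finite F" "F \<subseteq> edges G"
    "\<And>e t. e \<in> edges G \<Longrightarrow> e \<notin> F \<Longrightarrow> t \<in> {0..len G e} \<Longrightarrow> \<phi> (\<iota> (edge_point G e t)) = \<phi> (\<iota> (Vertex (fst e)))"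
    using test_algebra_locally_constant[OF \<phi>A] by blast
  obtain D where D: "D > 0" "\<And>e. e \<in> edges G \<Longrightarrow> len G e \<le> D" using len_bounded by blast
  define w where "w x = ext f x - \<phi> (\<iota> x)" for x
  have "\<exists>W. continuous_on UNIV W \<and> (\<forall>x\<in>points G. W (\<iota> x) = w x) \<and> (\<forall>y. y \<notin> \<iota> ` points G \<longrightarrow> W y = 0)"
  proof (rule continuous_extension_by_zero)
    fix e assume e: "e \<in> edges G"
    have "continuous_on {0..len G e} (\<lambda>t. (f (fst e) * y0 e t + f (snd e) * y1 e t) - on_edge G (\<phi> \<circ> \<iota>) e t)"
      by (intro continuous_on_diff ode_sol_continuous(1)[OF ode_sol_ext[OF e]] test_algebra_edge(1)[OF \<phi>A e])
    then show "continuous_on {0..len G e} (\<lambda>t. w (edge_point G e t))"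
      by (rule continuous_on_eq) (simp add: w_def ext_edge_point[OF e] on_edge_def)
  next
    fix \<epsilon> :: real assume \<epsilon>: "\<epsilon> > 0"
    define B where "B = {v \<in> verts G. \<epsilon> / 2 \<le> \<bar>g v\<bar>}"
    \<comment> \<open>On the other edges \<open>y0 + y1\<close> deviates from \<open>1\<close> by at
      most \<open>D * total_q e\<close>; times the bound \<open>M\<close> of the cutoff this is less
      than \<open>\<epsilon> / 2\<close>. The remaining half is for the interpolation of
      \<open>g\<close>, small off \<open>E2\<close>.\<close>
    define E1 where "E1 = {e \<in> edges G. \<epsilon> / (2 * M * D) \<le> total_q e}"
    define E2 where "E2 = (\<Union>v\<in>B. incident G v)"
    have "\<forall>\<epsilon>>0. finite {v \<in> verts G. \<epsilon> \<le> \<bar>g v\<bar>}" using g by (simp add: dirichlet_space_def)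
    then have "finite B" unfolding B_def using half_gt_zero[OF \<epsilon>] by blast
    then have "finite E2" unfolding E2_def using finite_incident by (auto simp: B_def)
    moreover have "finite E1" unfolding E1_def
      by (rule finite_large_terms[OF summable_total_q total_q_nonneg]) (use \<epsilon> M D in auto)
    ultimately have fin: "finite (F \<union> E1 \<union> E2)" using F(1) by blast
    have sub: "F \<union> E1 \<union> E2 \<subseteq> edges G" using F(2) by (auto simp: E1_def E2_def incident_def)
    have small: "\<bar>w (edge_point G e t)\<bar> < \<epsilon>" if e: "e \<in> edges G" "e \<notin> F \<union> E1 \<union> E2" and t: "t \<in> {0..len G e}" for e t
    proof -
      let ?h = "y0 e t + y1 e t"
      note b = basis_bounds[OF e(1) t]
      have "e \<in> incident G (fst e)" "e \<in> incident G (snd e)" using e(1) by (auto simp: incident_def)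
      then have ga: "\<bar>g (fst e)\<bar> < \<epsilon> / 2" and gb: "\<bar>g (snd e)\<bar> < \<epsilon> / 2"
        using e(2) edgeD[OF e(1)] by (auto simp: E2_def B_def not_le)
      have l: "len G e \<in> {0..len G e}" using edgeD(4)[OF e(1)] by simp
      have \<Phi>c: "\<Phi> (snd e) = \<Phi> (fst e)" using F(3)[OF e(1) _ l] e(2) edge_point_simps(2)[OF e(1)] by (simp add: \<Phi>_def)
      have \<phi>c: "\<phi> (\<iota> (edge_point G e t)) = \<Phi> (fst e)" using F(3)[OF e(1) _ t] e(2) by (simp add: \<Phi>_def)
      have "f v = g v + \<Phi> v" for v by (simp add: g_def)
      \<comment> \<open>As the cutoff is constant on the edge, the error splits into the
        interpolation of \<open>g\<close> and the defect of \<open>y0 + y1\<close> from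
        \<open>1\<close>.\<close>
      then have "w (edge_point G e t) = (g (fst e) * y0 e t + g (snd e) * y1 e t) - \<Phi> (fst e) * (1 - ?h)"
        using \<Phi>c \<phi>c by (simp add: w_def ext_edge_point[OF e(1) t] algebra_simps)
      then have "\<bar>w (edge_point G e t)\<bar> \<le> (\<bar>g (fst e)\<bar> * y0 e t + \<bar>g (snd e)\<bar> * y1 e t) + \<bar>\<Phi> (fst e)\<bar> * (1 - ?h)"
        using b abs_triangle_ineq4[of "g (fst e) * y0 e t + g (snd e) * y1 e t" "\<Phi> (fst e) * (1 - ?h)"]
          abs_triangle_ineq[of "g (fst e) * y0 e t" "g (snd e) * y1 e t"] by (simp add: abs_mult)
      also have "\<dots> \<le> (\<epsilon> / 2 * y0 e t + \<epsilon> / 2 * y1 e t) + M * (1 - ?h)"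
        using b ga gb M(2) by (intro add_mono mult_right_mono) (auto simp: \<Phi>_def)
      also have "\<dots> = \<epsilon> / 2 * ?h + M * (1 - ?h)" by (simp add: algebra_simps)
      also have "\<dots> \<le> \<epsilon> / 2 * 1 + M * (len G e * total_q e)"
        using b basis_sum[OF e(1) t] \<epsilon> M(1) by (intro add_mono mult_left_mono) auto
      also have "M * (len G e * total_q e) \<le> M * (D * total_q e)"
        using D(2)[OF e(1)] M(1) total_q_nonneg[OF e(1)] by (intro mult_left_mono mult_right_mono) auto
      also have "M * (D * total_q e) < M * (D * (\<epsilon> / (2 * M * D)))"
        using e M(1) D(1) by (intro mult_strict_left_mono) (auto simp: E1_def not_le)
      also have "\<dots> = \<epsilon> / 2" using M(1) D(1) by (simp add: field_simps)
      finally show ?thesis by simp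
    qed
    show "\<exists>F. finite F \<and> F \<subseteq> edges G \<and>
      (\<forall>x\<in>points G. (\<forall>e\<in>F. \<forall>t\<in>{0..len G e}. x \<noteq> edge_point G e t) \<longrightarrow> \<bar>w x\<bar> < \<epsilon>)"
    proof (intro exI[of _ "F \<union> E1 \<union> E2"] conjI ballI impI fin sub)
      fix x assume x: "x \<in> points G" and off: "\<forall>e\<in>F \<union> E1 \<union> E2. \<forall>t\<in>{0..len G e}. x \<noteq> edge_point G e t"
      obtain e t where e: "e \<in> edges G" "t \<in> {0..len G e}" "x = edge_point G e t"
        using x
      proof (cases rule: pointsE)
        case (1 v)
        then obtain e where "e \<in> incident G v" using incident_ne by blast
        then have e: "e \<in> edges G" "fst e = v \<or> snd e = v" by (auto simp: incident_def)
        then show thesis using that[OF e(1), of 0] that[OF e(1), of "len G e"] 1 edge_point_simps(1,2)[OF e(1)] edgeD(4)[OF e(1)] by auto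
      next
        case (2 e t)
        then show thesis using that[of e t] edge_point_simps(3)[of e t] by auto
      qed
      then have "e \<notin> F \<union> E1 \<union> E2" using off by blast
      then show "\<bar>w x\<bar> < \<epsilon>" using small[OF e(1) _ e(2)] e(3) by simp
    qed
  qed
  then obtain W where W: "continuous_on UNIV W" "\<And>x. x \<in> points G \<Longrightarrow> W (\<iota> x) = w x" "\<And>y. y \<notin> \<iota> ` points G \<Longrightarrow> W y = 0" by blast
  define u where "u y = \<phi> y + W y" for y
  have cu: "continuous_on UNIV u" unfolding u_def[abs_def]
    using \<phi>A W(1) by (intro continuous_on_add) (auto simp: test_algebra_def)
  have ue: "u (\<iota> x) = ext f x" if "x \<in> points G" for x using W(2)[OF that] by (simp add: u_def w_def)
  have bd: "u y = indicator \<Omega> y" if y: "y \<in> bdry G \<iota>" for y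
  proof -
    have "W y = 0"
    proof (cases "y \<in> \<iota> ` points G")
      case True
      then obtain p where p: "p \<in> points G" "y = \<iota> p" by blast
      then obtain v where v: "v \<in> verts G" "degree G v = 1" "p = Vertex v" using bdry_cases[OF p(1)] y by blast
      then have "g v = 0" using g by (auto simp: dirichlet_space_def)
      then show ?thesis using W(2)[OF p(1)] p(2) v(3) by (simp add: w_def ext_def g_def \<Phi>_def)
    qed (rule W(3))
    then show ?thesis using \<phi> y by (auto simp: u_def is_cutoff_def indicator_def)
  qed
  have sol: "ode_sol (on_edge G q e) (len G e) (on_edge G (u \<circ> \<iota>) e) (\<lambda>t. f (fst e) * y0' e t + f (snd e) * y1' e t)"
    if "e \<in> edges G" for e
    by (rule ode_sol_ext_on_edge[OF that ue])
  have "q_harmonic G q (u \<circ> \<iota>)"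
    unfolding q_harmonic_def
  proof (intro conjI ballI impI)
    fix e assume "e \<in> edges G"
    from sol[OF this, unfolded ode_sol_def] show "\<exists>u'.
        (\<forall>t\<in>{0..len G e}. (on_edge G (u \<circ> \<iota>) e has_real_derivative u' t) (at t within {0..len G e})) \<and>
        abs_continuous_on u' 0 (len G e) \<and>
        (AE t in lebesgue_on {0..len G e}.
           (u' has_real_derivative on_edge G q e t * on_edge G (u \<circ> \<iota>) e t) (at t within {0..len G e}))"
      by (rule exI[of _ "\<lambda>t. f (fst e) * y0' e t + f (snd e) * y1' e t"])
  next
    fix v assume v: "v \<in> verts G" "2 \<le> degree G v"
    show "\<forall>\<epsilon>>0. \<exists>\<delta>>0. \<forall>y\<in>points G. graph_dist G (Vertex v) y < \<delta> \<longrightarrow> \<bar>(u \<circ> \<iota>) y - (u \<circ> \<iota>) (Vertex v)\<bar> < \<epsilon>"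
    proof (intro allI impI)
      fix \<epsilon> :: real assume "\<epsilon> > 0"
      then obtain \<delta> where \<delta>: "\<delta> > 0" "\<And>y. dist y (\<iota> (Vertex v)) < \<delta> \<Longrightarrow> dist (u y) (u (\<iota> (Vertex v))) < \<epsilon>"
        using cu unfolding continuous_on_iff by blast
      show "\<exists>\<delta>>0. \<forall>y\<in>points G. graph_dist G (Vertex v) y < \<delta> \<longrightarrow> \<bar>(u \<circ> \<iota>) y - (u \<circ> \<iota>) (Vertex v)\<bar> < \<epsilon>"
        using \<delta> dist_eq[OF Vertex_in[OF v(1)]] by (intro exI[of _ \<delta>]) (auto simp: dist_real_def dist_commute)
    qed
    \<comment> \<open>Testing criticality of \<open>f\<close> with the indicator of \<open>v\<close>
      is the Kirchhoff condition at \<open>v\<close>; the indicator lies in \<open>D0\<close>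
      because a vertex of degree at least two is not a leaf.\<close>
    define \<delta> where "\<delta> w = (if w = v then 1 else 0 :: real)" for w
    have out: "edge_form e h \<delta> = 0" if "e \<in> edges G - incident G v" for e h
      using that by (auto simp: edge_form_def \<delta>_def incident_def)
    have inc: "incident G v \<subseteq> edges G" by (auto simp: incident_def)
    have fi: "finite (incident G v)" by (rule finite_incident[OF v(1)])
    have "\<delta> \<in> D0"
    proof -
      have "(\<lambda>e. edge_form e \<delta> \<delta>) summable_on incident G v" using fi by simp
      then have "finite_energy \<delta>" unfolding finite_energy_def
        by (rule summable_on_cong_neutral[THEN iffD1, rotated -1]) (use inc out in auto)
      moreover have "finite {w \<in> verts G. \<epsilon> \<le> \<bar>\<delta> w\<bar>}" if "\<epsilon> > 0" for \<epsilon>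
        by (rule finite_subset[of _ "{v}"]) (use that in \<open>auto simp: \<delta>_def split: if_splits\<close>)
      moreover have "\<delta> w = 0" if "w \<in> leaves" for w using that v by (auto simp: \<delta>_def)
      ultimately show ?thesis by (simp add: dirichlet_space_def)
    qed
    then have "energy f \<delta> = 0" by (rule f(3))
    also have "energy f \<delta> = (\<Sum>\<^sub>\<infinity>e\<in>incident G v. edge_form e f \<delta>)"
      unfolding energy_def by (rule infsum_cong_neutral) (use inc out in auto)
    also have "\<dots> = (\<Sum>e\<in>incident G v. edge_form e f \<delta>)" using fi by simp
    also have "\<dots> = (\<Sum>e\<in>incident G v. - normal_deriv G (u \<circ> \<iota>) e v)"
    proof (rule sum.cong[OF refl])
      fix e assume "e \<in> incident G v"
      then have e: "e \<in> edges G" and or: "fst e = v \<or> snd e = v" by (auto simp: incident_def)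
      note nd = normal_deriv_ode[OF e sol[OF e], unfolded ext_deriv_ends[OF e]]
      from or show "edge_form e f \<delta> = - normal_deriv G (u \<circ> \<iota>) e v"
      proof
        assume a: "fst e = v"
        then have "\<delta> (fst e) = 1" "\<delta> (snd e) = 0" using edgeD(3)[OF e] by (auto simp: \<delta>_def)
        then show ?thesis using nd(1) a by (simp add: edge_form_def algebra_simps)
      next
        assume a: "snd e = v"
        then have "\<delta> (fst e) = 0" "\<delta> (snd e) = 1" using edgeD(3)[OF e] by (auto simp: \<delta>_def)
        then show ?thesis using nd(2) a by (simp add: edge_form_def algebra_simps)
      qed
    qed
    finally show "(\<Sum>e\<in>incident G v. normal_deriv G (u \<circ> \<iota>) e v) = 0" by (simp add: sum_negf)
  qed
  then have "is_harmonic_extension G \<iota> q (indicator \<Omega>) u" using cu bd by (simp add: is_harmonic_extension_def)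
  then show thesis using that[OF f(2,3)] ue by blast
qed

text \<open>A positive maximum spreads along edges, because solutions are convex where they are positive,
  and through vertices, because by the Kirchhoff condition all outgoing derivatives vanish there.\<close>

lemma maximum_principle:
  fixes u :: "'b \<Rightarrow> real"
  assumes u: "continuous_on UNIV u"
    and sol: "\<And>e. e \<in> edges G \<Longrightarrow> \<exists>y'. ode_sol (on_edge G q e) (len G e) (on_edge G (u \<circ> \<iota>) e) y'"
    and kirchhoff: "\<And>v. v \<in> verts G \<Longrightarrow> 2 \<le> degree G v \<Longrightarrow> (\<Sum>e\<in>incident G v. normal_deriv G (u \<circ> \<iota>) e v) = 0"
    and b: "\<And>y. y \<in> bdry G \<iota> \<Longrightarrow> u y \<le> 0"
  shows "u y \<le> 0"
proof (rule ccontr)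
  assume "\<not> u y \<le> 0"
  obtain z where z: "\<And>x. u x \<le> u z"
    using continuous_attains_sup[OF compact_UNIV _ u] by auto
  define M where "M = u z"
  have M: "M > 0" "\<And>x. u x \<le> M" using z[of y] \<open>\<not> u y \<le> 0\<close> z unfolding M_def by (linarith, blast)
  have "z \<notin> bdry G \<iota>" using b[of z] M by (auto simp: M_def)
  then obtain p where p: "p \<in> points G" "z = \<iota> p" using not_point_bdry by blast
  have zero: "normal_deriv G (u \<circ> \<iota>) e v = 0"
    if v: "v \<in> verts G" "u (\<iota> (Vertex v)) = M" and e: "e \<in> incident G v" for v e
  proof -
    have "\<iota> (Vertex v) \<notin> bdry G \<iota>" using b[of "\<iota> (Vertex v)"] v M by auto
    then have "degree G v \<noteq> 1" using v(1) by (auto simp: bdry_def)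
    then have "2 \<le> degree G v" using degree_cases[OF v(1)] by auto
    from kirchhoff[OF v(1) this] have s0: "(\<Sum>e\<in>incident G v. - normal_deriv G (u \<circ> \<iota>) e v) = 0"
      by (simp add: sum_negf)
    have "- normal_deriv G (u \<circ> \<iota>) e v \<ge> 0" if e: "e \<in> incident G v" for e
    proof -
      have eG: "e \<in> edges G" and or: "fst e = v \<or> snd e = v" using e by (auto simp: incident_def)
      obtain y' where y': "ode_sol (on_edge G q e) (len G e) (on_edge G (u \<circ> \<iota>) e) y'" using sol[OF eG] by blast
      have l: "len G e > 0" by (rule edgeD(4)[OF eG])
      have le: "on_edge G (u \<circ> \<iota>) e t \<le> M" for t using M(2) by (simp add: on_edge_def)
      from or show ?thesis
      proof
        assume a: "fst e = v"
        have e0: "on_edge G (u \<circ> \<iota>) e 0 = M" using a v(2) edge_point_simps(1)[OF eG] by (simp add: on_edge_def)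
        have "y' 0 \<le> 0"
        proof (rule ccontr)
          assume "\<not> y' 0 \<le> 0"
          then obtain d where d: "d > 0" "\<And>h. h > 0 \<Longrightarrow> 0 + h \<in> {0..len G e} \<Longrightarrow> h < d \<Longrightarrow>
              on_edge G (u \<circ> \<iota>) e 0 < on_edge G (u \<circ> \<iota>) e (0 + h)"
            using has_real_derivative_pos_inc_right[OF ode_solD(1)[OF y', of 0]] l by auto
          have "on_edge G (u \<circ> \<iota>) e 0 < on_edge G (u \<circ> \<iota>) e (0 + min (d/2) (len G e))"
            by (rule d(2)) (use d(1) l in auto)
          then show False using e0 le[of "0 + min (d/2) (len G e)"] by linarith
        qed
        then show ?thesis using normal_deriv_ode(1)[OF eG y'] a by simp
      next
        assume a: "snd e = v"
        have e0: "on_edge G (u \<circ> \<iota>) e (len G e) = M" using a v(2) edge_point_simps(2)[OF eG] by (simp add: on_edge_def)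
        have "y' (len G e) \<ge> 0"
        proof (rule ccontr)
          assume "\<not> y' (len G e) \<ge> 0"
          then obtain d where d: "d > 0" "\<And>h. h > 0 \<Longrightarrow> len G e - h \<in> {0..len G e} \<Longrightarrow> h < d \<Longrightarrow>
              on_edge G (u \<circ> \<iota>) e (len G e) < on_edge G (u \<circ> \<iota>) e (len G e - h)"
            using has_real_derivative_neg_dec_left[OF ode_solD(1)[OF y', of "len G e"]] l by auto
          have "on_edge G (u \<circ> \<iota>) e (len G e) < on_edge G (u \<circ> \<iota>) e (len G e - min (d/2) (len G e))"
            by (rule d(2)) (use d(1) l in auto)
          then show False using e0 le[of "len G e - min (d/2) (len G e)"] by linarith
        qed
        then show ?thesis using normal_deriv_ode(2)[OF eG y'] a by simp
      qed
    qed
    then have "- normal_deriv G (u \<circ> \<iota>) e v = 0"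
      using sum_nonneg_0[OF finite_incident[OF v(1)] _ s0 e] by blast
    then show ?thesis by simp
  qed
  have spread: "u (\<iota> (edge_point G e t)) = M"
    if e: "e \<in> edges G" and s: "s \<in> {0..len G e}" "u (\<iota> (edge_point G e s)) = M" and t: "t \<in> {0..len G e}" for e s t
  proof -
    interpret schroedinger_interval "on_edge G q e" "len G e" by (rule edge_interval[OF e])
    obtain y' where y': "ode_sol (on_edge G q e) (len G e) (on_edge G (u \<circ> \<iota>) e) y'" using sol[OF e] by blast
    have oe: "on_edge G (u \<circ> \<iota>) e r = u (\<iota> (edge_point G e r))" for r by (simp add: on_edge_def)
    consider "s = 0" | "s = len G e" | "0 < s" "s < len G e" using s(1) by force
    then have "on_edge G (u \<circ> \<iota>) e t \<ge> M"
    proof cases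
      case 1
      have "normal_deriv G (u \<circ> \<iota>) e (fst e) = 0"
        using zero[of "fst e" e] edgeD(1)[OF e] s(2) 1 edge_point_simps(1)[OF e] e by (simp add: incident_def)
      then have "y' 0 = 0" using normal_deriv_ode(1)[OF e y'] by simp
      then have "on_edge G (u \<circ> \<iota>) e t \<ge> on_edge G (u \<circ> \<iota>) e 0"
        using ode_rise_right[OF y', of 0 t] M(1) s(2) 1 t by (simp add: oe)
      then show ?thesis using s(2) 1 by (simp add: oe)
    next
      case 2
      have "normal_deriv G (u \<circ> \<iota>) e (snd e) = 0"
        using zero[of "snd e" e] edgeD(2)[OF e] s(2) 2 edge_point_simps(2)[OF e] e by (simp add: incident_def)
      then have "y' (len G e) = 0" using normal_deriv_ode(2)[OF e y'] by simp
      then have "on_edge G (u \<circ> \<iota>) e t \<ge> on_edge G (u \<circ> \<iota>) e (len G e)"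
        using ode_rise_left[OF y', of "len G e" t] M(1) s(2) 2 t by (simp add: oe)
      then show ?thesis using s(2) 2 by (simp add: oe)
    next
      case 3
      have "\<forall>t\<in>{0..len G e}. on_edge G (u \<circ> \<iota>) e t = on_edge G (u \<circ> \<iota>) e s"
        by (rule ode_interior_max[OF y' 3]) (use M s(2) in \<open>simp_all add: oe\<close>)
      then show ?thesis using s(2) t by (simp add: oe)
    qed
    then show ?thesis using M(2)[of "\<iota> (edge_point G e t)"] by (simp add: oe)
  qed
  have "u (\<iota> x') = M" if "path_length G x r x'" "u (\<iota> x) = M" for x r x'
    using that
  proof (induction rule: path_length.induct)
    case (extend x r e s t)
    then show ?case by (intro spread[of e s t]) simp_all
  qed
  note path = this
  have all: "u (\<iota> x) = M" if x: "x \<in> points G" for x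
  proof -
    obtain r where "path_length G p r x" using conn p(1) x unfolding graph_connected_def by blast
    then show ?thesis using path p(2) by (simp add: M_def)
  qed
  \<comment> \<open>By density the constant passes from the graph to the whole completion, including
    the boundary, where the value should not be positive.\<close>
  have "u x = M" for x
  proof (rule continuous_constant_on_closure[where f = u and S = "\<iota> ` points G"])
    show "continuous_on (closure (\<iota> ` points G)) u" using u by (rule continuous_on_subset) simp
    show "x \<in> closure (\<iota> ` points G)" using completion by (simp add: is_completion_def)
    show "u y = M" if "y \<in> \<iota> ` points G" for y using all that by blast
  qed
  moreover obtain x where "x \<in> bdry G \<iota>" using bdry_ne by blast
  ultimately show False using b[of x] M(1) by simp
qed

section \<open>Uniqueness of the harmonic extension and Green's formula on the graph\<close>

lemma harmonic_le:
  assumes u: "is_harmonic_extension G \<iota> q U u" and w: "is_harmonic_extension G \<iota> q U w"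
  shows "u y \<le> w y"
proof -
  have sol: "\<exists>y'. ode_sol (on_edge G q e) (len G e) (on_edge G (v \<circ> \<iota>) e) y'"
    if "is_harmonic_extension G \<iota> q U v" "e \<in> edges G" for v e
    using that unfolding is_harmonic_extension_def q_harmonic_def ode_sol_def by blast
  have oe: "on_edge G ((\<lambda>x. u x - w x) \<circ> \<iota>) e = (\<lambda>t. 1 * on_edge G (u \<circ> \<iota>) e t + (-1) * on_edge G (w \<circ> \<iota>) e t)" for e
    by (simp add: on_edge_def fun_eq_iff)
  have "u y - w y \<le> 0"
  proof (rule maximum_principle[of "\<lambda>x. u x - w x"])
    show "continuous_on UNIV (\<lambda>x. u x - w x)"
      using u w by (intro continuous_on_diff) (auto simp: is_harmonic_extension_def)
    show "\<exists>y'. ode_sol (on_edge G q e) (len G e) (on_edge G ((\<lambda>x. u x - w x) \<circ> \<iota>) e) y'" if "e \<in> edges G" for e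
      unfolding oe using sol[OF u that] sol[OF w that] ode_sol_lincomb by blast
    show "u y - w y \<le> 0" if "y \<in> bdry G \<iota>" for y using u w that by (simp add: is_harmonic_extension_def)
    fix v assume v: "v \<in> verts G" "2 \<le> degree G v"
    have "normal_deriv G ((\<lambda>x. u x - w x) \<circ> \<iota>) e v = normal_deriv G (u \<circ> \<iota>) e v - normal_deriv G (w \<circ> \<iota>) e v"
      if e: "e \<in> incident G v" for e
    proof -
      have eG: "e \<in> edges G" and or: "fst e = v \<or> snd e = v" using e by (auto simp: incident_def)
      obtain u' w' where s: "ode_sol (on_edge G q e) (len G e) (on_edge G (u \<circ> \<iota>) e) u'"
        "ode_sol (on_edge G q e) (len G e) (on_edge G (w \<circ> \<iota>) e) w'" using sol[OF u eG] sol[OF w eG] by blast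
      from normal_deriv_ode[OF eG s(1)] normal_deriv_ode[OF eG s(2)]
        normal_deriv_ode[OF eG ode_sol_lincomb[OF s, of 1 "-1", folded oe]] or
      show ?thesis by auto
    qed
    then have "(\<Sum>e\<in>incident G v. normal_deriv G ((\<lambda>x. u x - w x) \<circ> \<iota>) e v)
        = (\<Sum>e\<in>incident G v. normal_deriv G (u \<circ> \<iota>) e v) - (\<Sum>e\<in>incident G v. normal_deriv G (w \<circ> \<iota>) e v)"
      by (simp add: sum_subtractf)
    also have "\<dots> = 0" using u w v by (simp add: is_harmonic_extension_def q_harmonic_def)
    finally show "(\<Sum>e\<in>incident G v. normal_deriv G ((\<lambda>x. u x - w x) \<circ> \<iota>) e v) = 0" .
  qed
  then show ?thesis by simp
qed

text \<open>Any two extensions lie below each other, so the definite description in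
  \<open>harmonic_extension\<close> denotes the function at hand.\<close>

lemma harmonic_extension_eq:
  assumes "is_harmonic_extension G \<iota> q U u"
  shows "harmonic_extension G \<iota> q U = u"
  unfolding harmonic_extension_def
proof (rule the_equality[where a = u])
  fix w assume "is_harmonic_extension G \<iota> q U w"
  then have "w x = u x" for x using harmonic_le[OF assms, of w x] harmonic_le[OF _ assms, of w x] by simp
  then show "w = u" by (simp add: fun_eq_iff)
qed (rule assms)

text \<open>On each edge Green's formula yields the edge form of \<open>f\<close> and the vertex
  values of \<open>\<phi>\<close>; what needs an argument is the exchange of integration and
  summation over infinitely many edges.\<close>

lemma integral_schroedinger:
  assumes u: "continuous_on UNIV u" and ue: "\<And>x. x \<in> points G \<Longrightarrow> u (\<iota> x) = ext f x"
    and \<phi>: "\<phi> \<in> test_algebra G \<iota>"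
  shows "(\<integral>(e, t). on_edge G (u \<circ> \<iota>) e t * schroedinger G \<iota> q \<phi> e t \<partial>graph_measure G)
     = energy f (\<lambda>v. \<phi> (\<iota> (Vertex v)))"
proof -
  let ?\<Phi> = "\<lambda>v. \<phi> (\<iota> (Vertex v))"
  define h where "h e t = on_edge G (u \<circ> \<iota>) e t * schroedinger G \<iota> q \<phi> e t" for e t
  have green: "set_integrable lebesgue {0<..<len G e} (h e)"
    "(LINT t:{0<..<len G e}|lebesgue. h e t) = edge_form e f ?\<Phi>" if e: "e \<in> edges G" for e
  proof -
    interpret schroedinger_interval "on_edge G q e" "len G e" by (rule edge_interval[OF e])
    obtain d where d: "d > 0" "\<And>t. 0 < t \<Longrightarrow> t < len G e \<Longrightarrow> t < d \<or> len G e - d < t \<Longrightarrow> deriv (on_edge G (\<phi> \<circ> \<iota>) e) t = 0"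
      using test_algebra_edge(3)[OF \<phi> e] by blast
    note gr = ode_green[OF ode_sol_ext_on_edge[OF e ue] test_algebra_edge(1)[OF \<phi> e] test_algebra_edge(2)[OF \<phi> e] d]
    show "set_integrable lebesgue {0<..<len G e} (h e)"
      using gr(1) by (simp add: h_def[abs_def] schroedinger_def)
    have "(LINT t:{0<..<len G e}|lebesgue. h e t)
      = (f (fst e) * y0' e (len G e) + f (snd e) * y1' e (len G e)) * on_edge G (\<phi> \<circ> \<iota>) e (len G e)
        - (f (fst e) * y0' e 0 + f (snd e) * y1' e 0) * on_edge G (\<phi> \<circ> \<iota>) e 0"
      using gr(2) by (simp add: h_def schroedinger_def)
    also have "\<dots> = edge_form e f ?\<Phi>"
      unfolding ext_deriv_ends[OF e] using edge_point_simps(1,2)[OF e]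
      by (simp add: on_edge_def edge_form_def algebra_simps)
    finally show "(LINT t:{0<..<len G e}|lebesgue. h e t) = edge_form e f ?\<Phi>" .
  qed
  obtain Mu where Mu: "Mu > 0" "\<And>y. \<bar>u y\<bar> \<le> Mu" using continuous_bounded[OF u] by blast
  obtain M where M: "M > 0" "\<And>y. \<bar>\<phi> y\<bar> \<le> M" using continuous_bounded[OF test_algebra_continuous[OF \<phi>]] by blast
  obtain F where F: "finite F" "F \<subseteq> edges G"
    "\<And>e t. e \<in> edges G \<Longrightarrow> e \<notin> F \<Longrightarrow> t \<in> {0..len G e} \<Longrightarrow> \<phi> (\<iota> (edge_point G e t)) = \<phi> (\<iota> (Vertex (fst e)))"
    using test_algebra_locally_constant[OF \<phi>] by blast
  \<comment> \<open>Off the finite set \<open>F\<close> the test function is constant on the edge,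
    so only \<open>q u \<phi>\<close> is left of the integrand, and it is dominated by a multiple of
    \<open>q\<close>.\<close>
  have sm: "(\<lambda>e. LINT t:{0<..<len G e}|lebesgue. \<bar>h e t\<bar>) summable_on edges G"
  proof (rule summable_on_comparison_test)
    define R where "R e = (if e \<in> F then LINT t:{0<..<len G e}|lebesgue. \<bar>h e t\<bar> else 0)" for e
    have "R summable_on F" using F(1) by simp
    then have "R summable_on edges G"
      by (rule summable_on_cong_neutral[THEN iffD1, rotated -1]) (use F(2) in \<open>auto simp: R_def\<close>)
    then show "(\<lambda>e. Mu * M * total_q e + R e) summable_on edges G"
      by (intro summable_on_add summable_on_cmult_right summable_total_q)
    fix e assume e: "e \<in> edges G"
    show "0 \<le> (LINT t:{0<..<len G e}|lebesgue. \<bar>h e t\<bar>)"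
      unfolding set_lebesgue_integral_def by (intro integral_nonneg_AE AE_I2) simp
    show "(LINT t:{0<..<len G e}|lebesgue. \<bar>h e t\<bar>) \<le> Mu * M * total_q e + R e"
    proof (cases "e \<in> F")
      case True
      then show ?thesis using Mu(1) M(1) total_q_nonneg[OF e] by (simp add: R_def)
    next
      case False
      have const: "on_edge G (\<phi> \<circ> \<iota>) e t = \<phi> (\<iota> (Vertex (fst e)))" if "t \<in> {0<..<len G e}" for t
        using F(3)[OF e False, of t] that by (simp add: on_edge_def)
      have bound: "\<bar>h e t\<bar> \<le> Mu * M * on_edge G q e t" if t: "t \<in> {0<..<len G e}" for t
      proof -
        have "(deriv ^^ 2) (on_edge G (\<phi> \<circ> \<iota>) e) t = (deriv ^^ 2) (\<lambda>_. \<phi> (\<iota> (Vertex (fst e)))) t"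
          by (rule funpow_deriv_cong_open[OF open_greaterThanLessThan const t])
        also have "\<dots> = 0" by (simp add: numeral_2_eq_2)
        finally have "h e t = on_edge G (u \<circ> \<iota>) e t * (on_edge G q e t * on_edge G (\<phi> \<circ> \<iota>) e t)"
          by (simp add: h_def schroedinger_def)
        moreover have q0: "0 \<le> on_edge G q e t"
          using schroedinger_interval.q0[OF edge_interval[OF e]] t by simp
        ultimately have "\<bar>h e t\<bar> = \<bar>on_edge G (u \<circ> \<iota>) e t\<bar> * \<bar>on_edge G (\<phi> \<circ> \<iota>) e t\<bar> * on_edge G q e t"
          by (simp add: abs_mult)
        also have "\<dots> \<le> Mu * M * on_edge G q e t"
          using Mu M q0 by (intro mult_right_mono mult_mono) (auto simp: on_edge_def)
        finally show ?thesis .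
      qed
      have "(LINT t:{0<..<len G e}|lebesgue. \<bar>h e t\<bar>) \<le> (LINT t:{0<..<len G e}|lebesgue. Mu * M * on_edge G q e t)"
      proof (rule set_integral_mono)
        show "set_integrable lebesgue {0<..<len G e} (\<lambda>t. \<bar>h e t\<bar>)" by (rule set_integrable_abs[OF green(1)[OF e]])
        show "set_integrable lebesgue {0<..<len G e} (\<lambda>t. Mu * M * on_edge G q e t)"
          using total_q_eq(2)[OF e] by (rule set_integrable_mult_right)
      qed (rule bound)
      also have "\<dots> = Mu * M * total_q e" using total_q_eq(1)[OF e] by simp
      finally show ?thesis using False by (simp add: R_def)
    qed
  qed
  have "(\<integral>(e, t). h e t \<partial>graph_measure G) = (\<Sum>\<^sub>\<infinity>e\<in>edges G. LINT t:{0<..<len G e}|lebesgue. h e t)"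
    by (rule integrable_graph_measure(2)[OF countable_edges green(1) sm])
  also have "\<dots> = energy f ?\<Phi>" unfolding energy_def by (rule infsum_cong) (rule green(2))
  finally show ?thesis by (simp add: h_def)
qed

lemma dirichlet_neumann_properties:
  assumes \<Omega>: "clopen_in (bdry G \<iota>) \<Omega>"
  defines "\<Lambda> \<equiv> dirichlet_neumann G \<iota> q (indicator \<Omega>)"
  shows "\<And>E F. clopen_in (bdry G \<iota>) E \<Longrightarrow> clopen_in (bdry G \<iota>) F \<Longrightarrow> E \<inter> F = {} \<Longrightarrow> \<Lambda> (E \<union> F) = \<Lambda> E + \<Lambda> F"
    and "\<And>E. clopen_in (bdry G \<iota>) E \<Longrightarrow> E \<subseteq> \<Omega> \<Longrightarrow> \<Lambda> E \<ge> 0"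
    and "\<And>E. clopen_in (bdry G \<iota>) E \<Longrightarrow> E \<inter> \<Omega> = {} \<Longrightarrow> \<Lambda> E \<le> 0"
proof -
  have sub: "E \<subseteq> bdry G \<iota>" if "clopen_in (bdry G \<iota>) E" for E
    using that by (auto simp: clopen_in_def dest: openin_imp_subset)
  obtain \<phi> where "is_cutoff G \<iota> \<Omega> \<phi>" using cutoff_exists[OF \<Omega>] by blast
  from harmonic_extension_exists[OF this sub[OF \<Omega>]] obtain f u where
    f: "finite_energy f" "\<And>\<psi>. \<psi> \<in> D0 \<Longrightarrow> energy f \<psi> = 0" and
    u: "is_harmonic_extension G \<iota> q (indicator \<Omega>) u" "\<And>x. x \<in> points G \<Longrightarrow> u (\<iota> x) = ext f x" by blast
  have cu: "continuous_on UNIV u" and bu: "\<And>y. y \<in> bdry G \<iota> \<Longrightarrow> u y = indicator \<Omega> y"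
    using u(1) by (auto simp: is_harmonic_extension_def)
  have uv: "u (\<iota> (Vertex v)) = f v" if "v \<in> verts G" for v using u(2)[OF Vertex_in[OF that]] by (simp add: ext_def)
  \<comment> \<open>The very choice made in \<open>dirichlet_neumann\<close>. The cutoffs of
    different sets are chosen independently and are related only through their boundary
    values.\<close>
  define \<phi> where "\<phi> E = (SOME \<phi>. is_cutoff G \<iota> E \<phi>)" for E
  define \<Phi> where "\<Phi> E v = \<phi> E (\<iota> (Vertex v))" for E v
  have cut: "is_cutoff G \<iota> E (\<phi> E)" if "clopen_in (bdry G \<iota>) E" for E
    unfolding \<phi>_def using cutoff_exists[OF that] by (rule someI_ex)
  have A: "\<phi> E \<in> test_algebra G \<iota>" and c\<phi>: "continuous_on UNIV (\<phi> E)" if "clopen_in (bdry G \<iota>) E" for E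
    using cut[OF that] test_algebra_continuous by (auto simp: is_cutoff_def)
  have b\<phi>: "\<phi> E y = (if y \<in> E then 1 else 0)" if "clopen_in (bdry G \<iota>) E" "y \<in> bdry G \<iota>" for E y
    using cut[OF that(1)] that(2) by (auto simp: is_cutoff_def)
  have fin\<Phi>: "finite_energy (\<Phi> E)" if "clopen_in (bdry G \<iota>) E" for E
    unfolding \<Phi>_def[abs_def] by (rule finite_energy_test[OF A[OF that]])
  have \<Lambda>: "\<Lambda> E = energy f (\<Phi> E)" if "clopen_in (bdry G \<iota>) E" for E
    unfolding \<Lambda>_def dirichlet_neumann_def Let_def harmonic_extension_eq[OF u(1)] \<phi>_def[symmetric] \<Phi>_def[abs_def]
    by (rule integral_schroedinger[OF cu u(2) A[OF that]])
  show "\<Lambda> (E \<union> F) = \<Lambda> E + \<Lambda> F" if E: "clopen_in (bdry G \<iota>) E" and F: "clopen_in (bdry G \<iota>) F" and dj: "E \<inter> F = {}" for E F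
  proof -
    have EF: "clopen_in (bdry G \<iota>) (E \<union> F)" using E F by (auto simp: clopen_in_def)
    have s: "finite_energy (\<lambda>v. \<Phi> E v + \<Phi> F v)" by (rule energy_add(1)[OF fin\<Phi>[OF E] fin\<Phi>[OF F] f(1)])
    \<comment> \<open>The chosen cutoff of \<open>E \<union> F\<close> and the sum of the two others
      agree on the boundary, so their difference lies in \<open>D0\<close> and is orthogonal to
      \<open>f\<close>.\<close>
    have "(\<lambda>v. \<Phi> (E \<union> F) v - (\<Phi> E v + \<Phi> F v)) \<in> D0"
    proof (rule D0_of_continuous[of "\<lambda>y. \<phi> (E \<union> F) y - (\<phi> E y + \<phi> F y)"])
      show "continuous_on UNIV (\<lambda>y. \<phi> (E \<union> F) y - (\<phi> E y + \<phi> F y))"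
        by (intro continuous_on_diff continuous_on_add c\<phi> E F EF)
      show "\<phi> (E \<union> F) y - (\<phi> E y + \<phi> F y) = 0" if "y \<in> bdry G \<iota>" for y
        using b\<phi>[OF E that] b\<phi>[OF F that] b\<phi>[OF EF that] dj by auto
      show "finite_energy (\<lambda>v. \<Phi> (E \<union> F) v - (\<Phi> E v + \<Phi> F v))"
        by (rule energy_diff(1)[OF fin\<Phi>[OF EF] s f(1)])
    qed (simp add: \<Phi>_def)
    from f(2)[OF this] have "energy f (\<Phi> (E \<union> F)) - energy f (\<lambda>v. \<Phi> E v + \<Phi> F v) = 0"
      unfolding energy_diff(3)[OF fin\<Phi>[OF EF] s f(1)] .
    then show ?thesis
      using energy_add(3)[OF fin\<Phi>[OF E] fin\<Phi>[OF F] f(1)] \<Lambda>[OF E] \<Lambda>[OF F] \<Lambda>[OF EF] by simp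
  qed
  show "\<Lambda> E \<ge> 0" if E: "clopen_in (bdry G \<iota>) E" and sb: "E \<subseteq> \<Omega>" for E
    unfolding \<Lambda>[OF E]
  proof -
    obtain M where M: "M > 0" "\<And>y. \<bar>\<phi> E y\<bar> \<le> M" using continuous_bounded[OF c\<phi>[OF E]] by blast
    show "0 \<le> energy f (\<Phi> E)"
    proof (rule energy_nonneg_of_truncation[OF f(1) fin\<Phi>[OF E]])
      show "1 / M > 0" using M(1) by simp
      have le: "s * \<Phi> E v \<le> 1" if "0 < s" "s < 1 / M" for s v
      proof -
        have "s * \<Phi> E v \<le> s * M" using M(2)[of "\<iota> (Vertex v)"] that by (intro mult_left_mono) (auto simp: \<Phi>_def)
        also have "\<dots> \<le> 1" using that M(1) by (simp add: field_simps)
        finally show ?thesis .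
      qed
      show "s * \<Phi> E (fst e) \<le> 1 \<and> s * \<Phi> E (snd e) \<le> 1" if "0 < s" "s < 1 / M" for s and e :: "'a edge"
        using le[OF that] by blast
      fix s assume s: "0 < s" "s < 1 / M" "finite_energy (\<lambda>v. min (s * \<Phi> E v) (1 - f v))"
      show "energy f (\<lambda>v. min (s * \<Phi> E v) (1 - f v)) = 0"
      proof (rule f(2), rule D0_of_continuous[of "\<lambda>y. min (s * \<phi> E y) (1 - u y)", OF _ _ _ s(3)])
        show "continuous_on UNIV (\<lambda>y. min (s * \<phi> E y) (1 - u y))"
          by (intro continuous_on_min continuous_on_mult continuous_on_diff continuous_on_const c\<phi>[OF E] cu)
        \<comment> \<open>On \<open>\<Omega>\<close> the second entry is \<open>0\<close> and the
          first is nonnegative; elsewhere on the boundary the first is \<open>0\<close>, because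
          \<open>E \<subseteq> \<Omega>\<close>, and the second is \<open>1\<close>.\<close>
        show "min (s * \<phi> E y) (1 - u y) = 0" if "y \<in> bdry G \<iota>" for y
          using b\<phi>[OF E that] bu[OF that] sb s(1) by (auto simp: indicator_def)
      qed (simp add: \<Phi>_def uv)
    qed
  qed
  show "\<Lambda> E \<le> 0" if E: "clopen_in (bdry G \<iota>) E" and dj: "E \<inter> \<Omega> = {}" for E
    unfolding \<Lambda>[OF E]
  proof (rule energy_nonpos_of_truncation[OF f(1) fin\<Phi>[OF E]])
    fix s :: real assume s: "0 < s" "finite_energy (\<lambda>v. min (f v) (s * \<Phi> E v))"
    show "energy f (\<lambda>v. min (f v) (s * \<Phi> E v)) = 0"
    proof (rule f(2), rule D0_of_continuous[of "\<lambda>y. min (u y) (s * \<phi> E y)", OF _ _ _ s(2)])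
      show "continuous_on UNIV (\<lambda>y. min (u y) (s * \<phi> E y))"
        by (intro continuous_on_min continuous_on_mult continuous_on_const c\<phi>[OF E] cu)
      \<comment> \<open>On \<open>\<Omega>\<close> the second entry is \<open>0\<close> by
        disjointness and the first is \<open>1\<close>; elsewhere on the boundary the first is
        \<open>0\<close> and the second is nonnegative.\<close>
      show "min (u y) (s * \<phi> E y) = 0" if "y \<in> bdry G \<iota>" for y
        using b\<phi>[OF E that] bu[OF that] dj s(1) by (auto simp: indicator_def)
    qed (simp add: \<Phi>_def uv)
  qed
qed

end

text \<open>One choice of a tuple per edge keeps the solutions and their coefficients
  matched.\<close>

lemma (in dirichlet_graph) edge_basis_exists:
  "\<exists>y0 y0' y1 y1' c k0 k1. graph_edge_basis G \<iota> q y0 y0' y1 y1' c k0 k1"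
proof -
  define B where "B e T \<longleftrightarrow> (case T of (y0, y0', y1, y1', c, k0, k1) \<Rightarrow>
      ode_sol (on_edge G q e) (len G e) y0 y0' \<and>
      y0 0 = 1 \<and> y0 (len G e) = 0 \<and> y0' 0 = - c - k0 \<and> y0' (len G e) = - c \<and>
      ode_sol (on_edge G q e) (len G e) y1 y1' \<and>
      y1 0 = 0 \<and> y1 (len G e) = 1 \<and> y1' 0 = c \<and> y1' (len G e) = c + k1 \<and>
      c > 0 \<and> k0 \<ge> 0 \<and> k1 \<ge> 0 \<and> k0 + k1 \<le> total_q e \<and>
      (\<forall>t\<in>{0..len G e}. 1 - len G e * total_q e \<le> y0 t + y1 t))" for e and
      T :: "(real \<Rightarrow> real) \<times> (real \<Rightarrow> real) \<times> (real \<Rightarrow> real) \<times> (real \<Rightarrow> real) \<times> real \<times> real \<times> real"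
  have "\<exists>T. B e T" if e: "e \<in> edges G" for e
  proof -
    interpret schroedinger_interval "on_edge G q e" "len G e" by (rule edge_interval[OF e])
    show ?thesis
    proof (rule edge_basis)
      fix y0 y0' y1 y1' c k0 k1
      assume "ode_sol (on_edge G q e) (len G e) y0 y0'" "y0 0 = 1" "y0 (len G e) = 0" "y0' 0 = - c - k0" "y0' (len G e) = - c"
        "ode_sol (on_edge G q e) (len G e) y1 y1'" "y1 0 = 0" "y1 (len G e) = 1" "y1' 0 = c" "y1' (len G e) = c + k1"
        "c > 0" "k0 \<ge> 0" "k1 \<ge> 0" "k0 + k1 \<le> integral {0..len G e} (on_edge G q e)"
        "\<And>t. t \<in> {0..len G e} \<Longrightarrow> 1 - len G e * integral {0..len G e} (on_edge G q e) \<le> y0 t + y1 t"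
      then have "B e (y0, y0', y1, y1', c, k0, k1)" by (simp add: B_def total_q_def)
      then show "\<exists>T. B e T" by blast
    qed
  qed
  then obtain T where T: "\<And>e. e \<in> edges G \<Longrightarrow> B e (T e)" by metis
  have "graph_edge_basis G \<iota> q (\<lambda>e. fst (T e)) (\<lambda>e. fst (snd (T e))) (\<lambda>e. fst (snd (snd (T e))))
      (\<lambda>e. fst (snd (snd (snd (T e))))) (\<lambda>e. fst (snd (snd (snd (snd (T e))))))
      (\<lambda>e. fst (snd (snd (snd (snd (snd (T e))))))) (\<lambda>e. snd (snd (snd (snd (snd (snd (T e)))))))"
    by unfold_locales (use T in \<open>auto simp: B_def split_beta\<close>)
  then show ?thesis by blast
qed

text \<open>The extension of clopen functions to measures speaks of clopen subsets of the compact
  space itself, whereas the Dirichlet-Neumann function lives on clopen subsets of the whole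
  boundary; for a clopen part of the boundary the two notions are matched here.\<close>

lemma clopen_in_trans:
  assumes "clopen_in S T"
  shows "clopen_in T E \<longleftrightarrow> clopen_in S E \<and> E \<subseteq> T"
proof
  have T: "openin (top_of_set S) T" "closedin (top_of_set S) T" "T \<subseteq> S"
    using assms by (auto simp: clopen_in_def dest: openin_imp_subset)
  show "clopen_in S E \<and> E \<subseteq> T" if "clopen_in T E"
    using that T unfolding clopen_in_def by (meson openin_trans closedin_trans openin_imp_subset)
  show "clopen_in T E" if "clopen_in S E \<and> E \<subseteq> T"
    using that T unfolding clopen_in_def by (meson openin_subset_trans closedin_subset_trans)
qed

theorem theorem4p6:
  fixes G :: "'v metric_graph"
    and \<iota> :: "'v point \<Rightarrow> 'p::complete_space"
    and q :: "'v point \<Rightarrow> real"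
    and \<Omega> :: "'p set"
  assumes "is_metric_graph G"
    and "graph_connected G"
    and "is_completion G \<iota>"
    and "weakly_connected G \<iota>"
    and "compact (UNIV :: 'p set)"
    and "bdry G \<iota> \<noteq> {}"
    and "admissible_potential G q"
    and "clopen_in (bdry G \<iota>) \<Omega>"
    and "\<Omega> \<noteq> {}"
    and "\<Omega> \<noteq> bdry G \<iota>"
  shows "(\<exists>\<mu> :: 'p measure. finite_measure \<mu> \<and> sets \<mu> = sets (restrict_space borel \<Omega>) \<and>
            (\<forall>E. clopen_in (bdry G \<iota>) E \<and> E \<subseteq> \<Omega> \<longrightarrow>
               measure \<mu> E = dirichlet_neumann G \<iota> q (indicator \<Omega>) E)) \<and>
         (\<exists>\<nu> :: 'p set \<Rightarrow> real. signed_measure_on (restrict_space borel (bdry G \<iota>)) \<nu> \<and>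
            (\<forall>E. clopen_in (bdry G \<iota>) E \<longrightarrow>
               \<nu> E = dirichlet_neumann G \<iota> q (indicator \<Omega>) E))"
proof -
  interpret dirichlet_graph G \<iota> q by unfold_locales (fact assms)+
  obtain y0 y0' y1 y1' c k0 k1 where "graph_edge_basis G \<iota> q y0 y0' y1 y1' c k0 k1"
    using edge_basis_exists by blast
  then interpret graph_edge_basis G \<iota> q y0 y0' y1 y1' c k0 k1 .
  let ?B = "bdry G \<iota>"
  define \<Lambda> where "\<Lambda> = dirichlet_neumann G \<iota> q (indicator \<Omega>)"
  note props = dirichlet_neumann_properties[OF assms(8), folded \<Lambda>_def]
  have \<Omega>': "clopen_in ?B (?B - \<Omega>)"
    using assms(8) by (auto simp: clopen_in_def intro: openin_diff closedin_diff)
  have sub: "E \<subseteq> ?B" if "clopen_in ?B E" for E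
    using that by (auto simp: clopen_in_def dest: openin_imp_subset)
  have ext: "\<exists>\<mu>. finite_measure \<mu> \<and> sets \<mu> = sets (restrict_space borel K) \<and> (\<forall>E. clopen_in ?B E \<and> E \<subseteq> K \<longrightarrow> measure \<mu> E = m E)"
    if K: "clopen_in ?B K" and pos: "\<And>E. clopen_in ?B E \<Longrightarrow> E \<subseteq> K \<Longrightarrow> m E \<ge> 0"
      and add: "\<And>E F. clopen_in ?B E \<Longrightarrow> clopen_in ?B F \<Longrightarrow> E \<inter> F = {} \<Longrightarrow> m (E \<union> F) = m E + m F" for K and m :: "'p set \<Rightarrow> real"
  proof -
    note tr = clopen_in_trans[OF K]
    have cK: "compact K" using K closedin_compact[OF compact_bdry] by (auto simp: clopen_in_def)
    have sep: "\<exists>E. clopen_in K E \<and> x \<in> E \<and> y \<notin> E" if xy: "x \<in> K" "y \<in> K" "x \<noteq> y" for x y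
    proof -
      obtain E where E: "clopen_in ?B E" "x \<in> E" "y \<notin> E"
        using bdry_clopen_separation[of x y] sub[OF K] xy by blast
      have "clopen_in ?B (E \<inter> K)" using E(1) K by (auto simp: clopen_in_def)
      then show ?thesis using E xy tr by (intro exI[of _ "E \<inter> K"]) auto
    qed
    have "\<exists>\<mu>. finite_measure \<mu> \<and> sets \<mu> = sets (restrict_space borel K) \<and> (\<forall>E. clopen_in K E \<longrightarrow> measure \<mu> E = m E)"
      by (rule clopen_measure_extension[OF cK sep]) (simp_all add: tr pos add)
    then show ?thesis unfolding tr .
  qed
  obtain \<mu> where \<mu>: "finite_measure \<mu>" "sets \<mu> = sets (restrict_space borel \<Omega>)"
    "\<And>E. clopen_in ?B E \<Longrightarrow> E \<subseteq> \<Omega> \<Longrightarrow> measure \<mu> E = \<Lambda> E"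
    using ext[OF assms(8), of \<Lambda>] props(1,2) by blast
  have "\<exists>\<mu>. finite_measure \<mu> \<and> sets \<mu> = sets (restrict_space borel (?B - \<Omega>)) \<and> (\<forall>E. clopen_in ?B E \<and> E \<subseteq> ?B - \<Omega> \<longrightarrow> measure \<mu> E = - \<Lambda> E)"
  proof (rule ext[OF \<Omega>'])
    show "0 \<le> - \<Lambda> E" if "clopen_in ?B E" "E \<subseteq> ?B - \<Omega>" for E using props(3)[OF that(1)] that(2) by auto
    show "- \<Lambda> (E \<union> F) = - \<Lambda> E + - \<Lambda> F" if "clopen_in ?B E" "clopen_in ?B F" "E \<inter> F = {}" for E F
      using props(1)[OF that] by simp
  qed
  then obtain \<mu>' where \<mu>': "finite_measure \<mu>'" "sets \<mu>' = sets (restrict_space borel (?B - \<Omega>))"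
    "\<And>E. clopen_in ?B E \<Longrightarrow> E \<subseteq> ?B - \<Omega> \<Longrightarrow> measure \<mu>' E = - \<Lambda> E" by blast
  \<comment> \<open>\<open>\<Omega>\<close> and its complement in the boundary form a Hahn
    decomposition: \<open>\<mu>\<close> is the positive part, and \<open>\<mu>'\<close> extends the
    negated values off \<open>\<Omega>\<close>.\<close>
  define \<nu> where "\<nu> A = measure \<mu> (A \<inter> \<Omega>) - measure \<mu>' (A - \<Omega>)" for A
  have "signed_measure_on (restrict_space borel ?B) \<nu>"
    unfolding signed_measure_on_def
  proof (intro conjI allI impI)
    show "\<nu> {} = 0" by (simp add: \<nu>_def)
    fix A :: "nat \<Rightarrow> 'p set"
    assume A: "range A \<subseteq> sets (restrict_space borel ?B)" "disjoint_family A"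
    have m: "A i \<inter> \<Omega> \<in> sets \<mu>" "A i - \<Omega> \<in> sets \<mu>'" for i
    proof -
      obtain S where S: "S \<in> sets borel" "A i = ?B \<inter> S" using A(1) by (auto simp: sets_restrict_space)
      have "A i \<inter> \<Omega> = \<Omega> \<inter> S" "A i - \<Omega> = (?B - \<Omega>) \<inter> S" using S(2) sub[OF assms(8)] by auto
      then show "A i \<inter> \<Omega> \<in> sets \<mu>" "A i - \<Omega> \<in> sets \<mu>'"
        unfolding \<mu>(2) \<mu>'(2) sets_restrict_space using S(1) by auto
    qed
    have dj: "disjoint_family (\<lambda>i. A i \<inter> \<Omega>)" "disjoint_family (\<lambda>i. A i - \<Omega>)"
      using A(2) unfolding disjoint_family_on_def by blast+
    have "(\<lambda>i. measure \<mu> (A i \<inter> \<Omega>)) sums measure \<mu> (\<Union>i. A i \<inter> \<Omega>)"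
      by (rule finite_measure.finite_measure_UNION[OF \<mu>(1) _ dj(1)]) (use m in blast)
    moreover have "(\<lambda>i. measure \<mu>' (A i - \<Omega>)) sums measure \<mu>' (\<Union>i. A i - \<Omega>)"
      by (rule finite_measure.finite_measure_UNION[OF \<mu>'(1) _ dj(2)]) (use m in blast)
    moreover have "(\<Union>i. A i \<inter> \<Omega>) = (\<Union>i. A i) \<inter> \<Omega>" "(\<Union>i. A i - \<Omega>) = (\<Union>i. A i) - \<Omega>" by auto
    ultimately show "(\<lambda>i. \<nu> (A i)) sums \<nu> (\<Union>i. A i)" unfolding \<nu>_def by (auto intro: sums_diff)
  qed
  moreover have "\<nu> E = \<Lambda> E" if E: "clopen_in ?B E" for E
  proof -
    have c: "clopen_in ?B (E \<inter> \<Omega>)" "clopen_in ?B (E - \<Omega>)"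
      using E assms(8) by (auto simp: clopen_in_def intro: openin_diff closedin_diff)
    have "\<nu> E = \<Lambda> (E \<inter> \<Omega>) + \<Lambda> (E - \<Omega>)"
      using \<mu>(3)[OF c(1)] \<mu>'(3)[OF c(2) Diff_mono[OF sub[OF E] order_refl]] by (simp add: \<nu>_def)
    also have "\<dots> = \<Lambda> ((E \<inter> \<Omega>) \<union> (E - \<Omega>))" by (rule props(1)[OF c, symmetric]) auto
    also have "(E \<inter> \<Omega>) \<union> (E - \<Omega>) = E" by auto
    finally show ?thesis .
  qed
  ultimately show ?thesis using \<mu> unfolding \<Lambda>_def by blast
qed

end
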